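(* If $X$ is an ANR with the fuzzy ribbons property, then $X\times\mathbb{R}$ has the disjoint disks property.
   Context: $I=[0,1]$; $X$ is a metrizable ANR with a fixed metric. A topographical map pair is a pair $(f,\tau)$ of maps $f:Z\to X$, $\tau:Z\to I$. It is in the category $\mathcal{K}$ if $f:K\times I\to X$ and $\tau:K\times I\to I$ for some finite $1$-complex $K$, and $K\times\{e\}\subset\tau^{-1}(e)$ for $e=0,1$. It is in the category $\mathcal{K}_c$ if moreover $f$ is a constant homotopy ($f(x,t)=f(x,0)$ for all $x,t$) and $\tau(x,t)=t$. Let $(f_i,\tau_i)\in\mathcal{K}$, $i=1,2$, with $f_i:K_i\times I\to X$ and $\tau_i:K_i\times I\to I$. Then $(f_2,\tau_2)$ is fractured over $(f_1,\tau_1)$ if there are finitely many pairwise disjoint ($2$-dimensional, closed) balls $B_1,\dots,B_m$ in $K_2\times I$ such that (1) $f_2^{-1}(\operatorname{im} f_1)\subset\bigcup_{j=1}^m\operatorname{int}(B_j)$, and (2) $\tau_1(f_1^{-1}(f_2(B_j)))\ne I$ for each $j$. $X$ has the fuzzy ribbons property if for any $(f_1,\tau_1)\in\mathcal{K}_c$, $(f_2,\tau_2)\in\mathcal{K}$ and $\varepsilon>0$ there are maps $\tau_i'$ and $\varepsilon$-approximations $f_i'$ of $f_i$ (in the sup metric), $i=1,2$, with $(f'_i,\tau'_i)\in\mathcal{K}$ (on the same domains), such that $(f_2',\tau_2')$ is fractured over $(f_1',\tau_1')$. The $\tau_i'$ are not required to be close to the $\tau_i$. A space $Y$ has the disjoint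 disks property if for every pair of maps $D^2\to Y$ and every $\varepsilon>0$ there are $\varepsilon$-close maps with disjoint images ($D^2$ the closed $2$-disk). *)

theory Defs
  imports "HOL-Analysis.Analysis"
begin

text \<open>
  Absolute neighbourhood retracts for the class of metrizable spaces. The constant \<open>ANR\<close> of
  HOL-Analysis is tailored to finite-dimensional spaces, so it is not used here. A definition
  cannot quantify over types, so the ambient metrizable spaces \<open>Y\<close> have their points in
  \<^typ>\<open>'a \<Rightarrow> real\<close>. This loses nothing: by Kuratowski and Wojdyslawski, \<open>X\<close> is homeomorphic to a
  closed subset of a convex set of bounded functions with the sup metric. That convex set is one
  of the admissible \<open>Y\<close>, and by Dugundji it is an absolute extensor for metrizable spaces.
\<close>

definition metrizable_ANR :: "'a topology \<Rightarrow> bool" where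
  "metrizable_ANR X \<longleftrightarrow>
     metrizable_space X \<and>
     (\<forall>(Y :: ('a \<Rightarrow> real) topology) A.
        metrizable_space Y \<and> closedin Y A \<and> X homeomorphic_space subtopology Y A \<longrightarrow>
        (\<exists>U. openin Y U \<and> A \<subseteq> U \<and> A retract_of_space subtopology Y U))"

text \<open>
  Finite 1-complexes are realised as polyhedra of simplicial complexes in 3-space; every finite
  1-complex has such a realisation. Degenerate ones (isolated vertices, empty) are included.
\<close>

definition finite_1_complex :: "(real^3) set \<Rightarrow> bool" where
  "finite_1_complex K \<longleftrightarrow>
     (\<exists>\<C>. simplicial_complex \<C> \<and> (\<forall>S\<in>\<C>. aff_dim S \<le> 1) \<and> K = \<Union>\<C>)"

text \<open>
  The space \<open>X\<close> is a subset of a metric-space type, with the inherited metric. Maps are total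
  functions of which only the restriction to the stated domain matters.
\<close>

definition topographical_map_pair ::
    "'z::topological_space set \<Rightarrow> 'a::metric_space set \<Rightarrow> ('z \<Rightarrow> 'a) \<Rightarrow> ('z \<Rightarrow> real) \<Rightarrow> bool" where
  "topographical_map_pair Z X f \<tau> \<longleftrightarrow>
     continuous_on Z f \<and> f ` Z \<subseteq> X \<and> continuous_on Z \<tau> \<and> \<tau> ` Z \<subseteq> {0..1}"

definition category_K ::
    "'a::metric_space set \<Rightarrow> (real^3) set \<Rightarrow> ((real^3) \<times> real \<Rightarrow> 'a) \<Rightarrow> ((real^3) \<times> real \<Rightarrow> real) \<Rightarrow> bool"
  where
  "category_K X K f \<tau> \<longleftrightarrow>
     finite_1_complex K \<and>
     topographical_map_pair (K \<times> {0..1}) X f \<tau> \<and>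
     (\<forall>x\<in>K. \<tau> (x, 0) = 0 \<and> \<tau> (x, 1) = 1)"

definition category_Kc ::
    "'a::metric_space set \<Rightarrow> (real^3) set \<Rightarrow> ((real^3) \<times> real \<Rightarrow> 'a) \<Rightarrow> ((real^3) \<times> real \<Rightarrow> real) \<Rightarrow> bool"
  where
  "category_Kc X K f \<tau> \<longleftrightarrow>
     category_K X K f \<tau> \<and>
     (\<forall>x\<in>K. \<forall>t\<in>{0..1}. f (x, t) = f (x, 0) \<and> \<tau> (x, t) = t)"

text \<open>
  A ball \<open>B j\<close> is an embedded closed 2-disk, parametrised by \<open>h j\<close>. Its interior is the interior
  of \<open>B j\<close> as a disk, \<open>h j ` ball 0 1\<close> (independent of the parametrisation by invariance of
  domain), not the topological interior relative to \<open>K2 \<times> {0..1}\<close>. The map \<open>\<tau>2\<close> plays no role in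
  the definition.
\<close>

definition fractured_over ::
    "(real^3) set \<Rightarrow> ((real^3) \<times> real \<Rightarrow> 'a) \<Rightarrow> ((real^3) \<times> real \<Rightarrow> real) \<Rightarrow>
     (real^3) set \<Rightarrow> ((real^3) \<times> real \<Rightarrow> 'a) \<Rightarrow> ((real^3) \<times> real \<Rightarrow> real) \<Rightarrow> bool" where
  "fractured_over K2 f2 \<tau>2 K1 f1 \<tau>1 \<longleftrightarrow>
     (\<exists>(m::nat) (B :: nat \<Rightarrow> ((real^3) \<times> real) set) (h :: nat \<Rightarrow> real^2 \<Rightarrow> (real^3) \<times> real).
        (\<forall>j<m. B j \<subseteq> K2 \<times> {0..1} \<and> (\<exists>k. homeomorphism (cball 0 1) (B j) (h j) k)) \<and>
        disjoint_family_on B {..<m} \<and>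
        {z \<in> K2 \<times> {0..1}. f2 z \<in> f1 ` (K1 \<times> {0..1})} \<subseteq> (\<Union>j<m. h j ` ball 0 1) \<and>
        (\<forall>j<m. \<tau>1 ` {z \<in> K1 \<times> {0..1}. f1 z \<in> f2 ` B j} \<noteq> {0..1}))"

definition fuzzy_ribbons_property :: "'a::metric_space set \<Rightarrow> bool" where
  "fuzzy_ribbons_property X \<longleftrightarrow>
     (\<forall>K1 f1 \<tau>1 K2 f2 \<tau>2 (\<epsilon>::real).
        category_Kc X K1 f1 \<tau>1 \<and> category_K X K2 f2 \<tau>2 \<and> \<epsilon> > 0 \<longrightarrow>
        (\<exists>f1' \<tau>1' f2' \<tau>2'.
           category_K X K1 f1' \<tau>1' \<and> (\<forall>z\<in>K1 \<times> {0..1}. dist (f1' z) (f1 z) < \<epsilon>) \<and>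
           category_K X K2 f2' \<tau>2' \<and> (\<forall>z\<in>K2 \<times> {0..1}. dist (f2' z) (f2 z) < \<epsilon>) \<and>
           fractured_over K2 f2' \<tau>2' K1 f1' \<tau>1'))"

definition disjoint_disks_property :: "'b::metric_space set \<Rightarrow> bool" where
  "disjoint_disks_property Y \<longleftrightarrow>
     (\<forall>(f :: real^2 \<Rightarrow> 'b) (g :: real^2 \<Rightarrow> 'b) (\<epsilon>::real).
        continuous_on (cball 0 1) f \<and> f ` cball 0 1 \<subseteq> Y \<and>
        continuous_on (cball 0 1) g \<and> g ` cball 0 1 \<subseteq> Y \<and> \<epsilon> > 0 \<longrightarrow>
        (\<exists>f' g'.
           continuous_on (cball 0 1) f' \<and> f' ` cball 0 1 \<subseteq> Y \<and>
           continuous_on (cball 0 1) g' \<and> g' ` cball 0 1 \<subseteq> Y \<and>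
           (\<forall>z\<in>cball 0 1. dist (f' z) (f z) < \<epsilon>) \<and>
           (\<forall>z\<in>cball 0 1. dist (g' z) (g z) < \<epsilon>) \<and>
           f' ` cball 0 1 \<inter> g' ` cball 0 1 = {}))"

end

theory Submission
  imports Defs
begin

text \<open>
  Replace each disc by a staircase over a fine triangulation: the triangles are pushed to distinct
  heights, a triangle \<open>D\<close> at height \<open>c\<close> becomes a cap \<open>\<partial>D \<times> [c, c + \<delta>]\<close> carrying a null-homotopy of the
  boundary of \<open>D\<close> inside its image, and everything else becomes part of a vertical wall over the
  1-skeleton, that is, a constant homotopy. All slabs \<open>[c, c + \<delta>]\<close> of both discs are disjoint. So caps do
  not meet each other, walls do not meet once the 1-skeleta have disjoint images, and in each slab one
  has to separate a cap from the wall of the other disc. There the fuzzy ribbons property applies to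
  the wall (a constant homotopy) and the cap. Fracturedness allows the height function of the cap to be
  redefined, by Tietze, as a constant on each ball that is avoided by the heights of the wall. The new
  pairs are reconnected to the old ones in thin collars by means of the short paths available in an
  ANR. Prior disjointness at the ends of the slab keeps the collars disjoint.
\<close>

subsection \<open>Short paths in an ANR\<close>

text \<open>The fuzzy ribbons property gives no hold on the new heights beyond their values 0 and 1
  at the two ends. Its output is therefore rescaled to a slab of thickness \<open>\<delta>\<close>:
  whatever the heights do inside, they cost at most \<open>\<delta>\<close> in the vertical
  direction, and the fixed end values allow gluing to the straight wall outside. The remaining
  obstacle is the gluing itself, where a collar of one pair could meet the other pair at the same
  height. This is why a cap contracts to a point of the adjusted graph map \<open>g i\<close> and
  not of the given map: both ends of the cap homotopy then lie in the image of \<open>g i\<close>,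
  at positive distance from the graph of the other disc. The ANR hypothesis enters only through
  short paths: nearby points are joined by a straight segment in a space of bounded functions, and
  the segment is retracted to \<open>X\<close>.\<close>

lemma compact_disjoint_dist_pos:
  fixes S T :: "'a::metric_space set"
  assumes "compact S" "compact T" "S \<inter> T = {}"
  obtains d where "d > 0" "\<And>x y. x \<in> S \<Longrightarrow> y \<in> T \<Longrightarrow> d \<le> dist x y"
proof (cases "S \<times> T = {}")
  case True
  then show ?thesis using that[of 1] by auto
next
  case False
  have "continuous_on (S \<times> T) (\<lambda>p. dist (fst p) (snd p))"
    by (intro continuous_intros)
  then obtain p where p: "p \<in> S \<times> T" "\<And>q. q \<in> S \<times> T \<Longrightarrow> dist (fst p) (snd p) \<le> dist (fst q) (snd q)"
    using continuous_attains_inf[OF compact_Times[OF assms(1,2)] False] by blast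
  have "dist (fst p) (snd p) > 0"
    using p(1) assms(3) by (auto simp: mem_Times_iff)
  then show ?thesis
    using p that[of "dist (fst p) (snd p)"] by force
qed

text \<open>The Kuratowski embedding of the whole type. Subtracting the distance to the arbitrary
  base point \<open>undefined\<close> keeps the functions bounded even when distances are
  not.\<close>

definition kuratowski :: "'a::metric_space \<Rightarrow> ('a \<Rightarrow>\<^sub>C real)" where
  "kuratowski x = Bcontfun (\<lambda>w. dist x w - dist undefined w)"

lemma apply_kuratowski: "apply_bcontfun (kuratowski x) w = dist x w - dist undefined w"
proof -
  have "bounded (range (\<lambda>w. dist x w - dist undefined w))"
    unfolding bounded_iff
  proof (intro exI ballI)
    fix y assume "y \<in> range (\<lambda>w. dist x w - dist undefined w)"
    then show "norm y \<le> dist x undefined"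
      using dist_triangle[of x _ undefined] dist_triangle[of undefined _ x]
      by (auto simp: dist_commute abs_le_iff algebra_simps)
  qed
  then have "(\<lambda>w. dist x w - dist undefined w) \<in> bcontfun"
    by (auto simp: bcontfun_def intro!: continuous_intros)
  then show ?thesis
    by (simp add: kuratowski_def Bcontfun_inverse)
qed

lemma dist_kuratowski: "dist (kuratowski x) (kuratowski y) = dist x y"
proof (rule antisym)
  show "dist (kuratowski x) (kuratowski y) \<le> dist x y"
    by (rule dist_bound)
      (simp add: apply_kuratowski dist_real_def abs_le_iff dist_triangle dist_triangle2 dist_triangle3
        algebra_simps, metis add.commute dist_commute dist_triangle)
  show "dist x y \<le> dist (kuratowski x) (kuratowski y)"
    using dist_bounded[of "kuratowski x" y "kuratowski y"]
    by (simp add: apply_kuratowski dist_real_def)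
qed

lemma continuous_on_kuratowski [continuous_intros]:
  "continuous_on A f \<Longrightarrow> continuous_on A (\<lambda>x. kuratowski (f x))"
  using continuous_on_compose2[of UNIV kuratowski A f]
  by (metis continuous_on_iff dist_kuratowski UNIV_I subset_UNIV)

text \<open>These segments stand in for the convex hull of the embedded space: they are all that
  short paths need, and on them an explicit distance bound shows that the embedded \<open>X\<close>
  is closed.\<close>

definition kuratowski_segments :: "'a::metric_space set \<Rightarrow> ('a \<Rightarrow>\<^sub>C real) set" where
  "kuratowski_segments X =
     {(1 - t) *\<^sub>R kuratowski x + t *\<^sub>R kuratowski y | x y t. x \<in> X \<and> y \<in> X \<and> 0 \<le> t \<and> t \<le> 1}"

lemma kuratowski_in_segments: "x \<in> X \<Longrightarrow> kuratowski x \<in> kuratowski_segments X"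
  unfolding kuratowski_segments_def by (force intro: exI[of _ 0])

lemma closedin_kuratowski:
  "closedin (top_of_set (kuratowski_segments X)) (kuratowski ` X)"
proof -
  have "openin (top_of_set (kuratowski_segments X)) (kuratowski_segments X - kuratowski ` X)"
    unfolding openin_euclidean_subtopology_iff
  proof safe
    fix p assume p: "p \<in> kuratowski_segments X" "p \<notin> kuratowski ` X"
    then obtain x y t where xyt: "x \<in> X" "y \<in> X" "0 \<le> t" "t \<le> 1"
      and pe: "p = (1 - t) *\<^sub>R kuratowski x + t *\<^sub>R kuratowski y"
      by (auto simp: kuratowski_segments_def)
    have "t \<noteq> 0" "t \<noteq> 1" "x \<noteq> y"
      using xyt pe p(2) by (auto simp: scaleR_add_left[symmetric])
    \<comment> \<open>\<open>m\<close> bounds from below the distance from the inner point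
      \<open>p\<close> of a segment to every \<open>kuratowski z\<close>: evaluated at the
      coordinate \<open>z\<close>, the two functions differ by the convex combination of
      \<open>dist x z\<close> and \<open>dist y z\<close>.\<close>
    define m where "m = min t (1 - t) * dist x y"
    have m: "m > 0"
      using \<open>t \<noteq> 0\<close> \<open>t \<noteq> 1\<close> \<open>x \<noteq> y\<close> xyt by (auto simp: m_def)
    have "m \<le> dist (kuratowski z) p" for z
    proof -
      have "m \<le> min t (1 - t) * (dist x z + dist y z)"
        unfolding m_def using dist_triangle2[of x y z] xyt by (intro mult_left_mono) auto
      also have "\<dots> \<le> (1 - t) * dist x z + t * dist y z"
        unfolding distrib_left by (intro add_mono mult_right_mono) auto
      also have "\<dots> = apply_bcontfun p z - apply_bcontfun (kuratowski z) z"
        by (simp add: pe apply_kuratowski plus_bcontfun.rep_eq scaleR_bcontfun.rep_eq algebra_simps)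
      also have "\<dots> \<le> dist (apply_bcontfun (kuratowski z) z) (apply_bcontfun p z)"
        by (simp add: dist_real_def)
      finally show ?thesis
        using dist_bounded order_trans by blast
    qed
    then have "\<forall>x'\<in>kuratowski_segments X. dist x' p < m \<longrightarrow> x' \<in> kuratowski_segments X - kuratowski ` X"
      by (metis DiffI imageE not_le)
    then show "\<exists>e>0. \<forall>x'\<in>kuratowski_segments X. dist x' p < e \<longrightarrow> x' \<in> kuratowski_segments X - kuratowski ` X"
      using m by blast
  qed
  then show ?thesis
    by (auto simp: closedin_def kuratowski_in_segments)
qed

text \<open>\<open>metrizable_ANR\<close> offers only ambient spaces whose points are plain
  functions, so the metric of the segments is transported along the injection
  \<open>apply_bcontfun\<close>. The retraction found there is carried back by
  \<open>Bcontfun\<close>.\<close>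

lemma ANR_kuratowski_retraction:
  fixes X :: "'a::metric_space set"
  assumes "metrizable_ANR (top_of_set X)"
  obtains U r where "openin (top_of_set (kuratowski_segments X)) U" "kuratowski ` X \<subseteq> U"
    "continuous_on U r" "r ` U \<subseteq> kuratowski ` X" "\<And>p. p \<in> kuratowski ` X \<Longrightarrow> r p = p"
proof -
  define Z where "Z = kuratowski_segments X"
  define M where "M = apply_bcontfun ` Z"
  define d where "d = (\<lambda>p q :: 'a \<Rightarrow> real. dist (Bcontfun p) (Bcontfun q))"
  interpret Metric_space M d
    by unfold_locales
      (auto simp: d_def M_def dist_commute apply_bcontfun_inverse apply_bcontfun_inject dist_triangle)
  \<comment> \<open>Open sets correspond on both sides, so \<open>apply_bcontfun\<close> is a
    homeomorphism from \<open>Z\<close> onto \<open>M\<close>; \<open>h1\<close> and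
    \<open>h2\<close> are its two directions.\<close>
  have op: "openin mtopology (apply_bcontfun ` V) \<longleftrightarrow> openin (top_of_set Z) V" if "V \<subseteq> Z" for V
  proof -
    have mb: "mball (apply_bcontfun p) s = apply_bcontfun ` {q \<in> Z. dist q p < s}" if "p \<in> Z" for p s
      using that unfolding mball_def by (auto simp: d_def M_def apply_bcontfun_inverse dist_commute)
    have "mball (apply_bcontfun p) s \<subseteq> apply_bcontfun ` V \<longleftrightarrow> (\<forall>q\<in>Z. dist q p < s \<longrightarrow> q \<in> V)"
      if "p \<in> V" for p s
    proof -
      have "p \<in> Z" using that \<open>V \<subseteq> Z\<close> by blast
      then show ?thesis unfolding mb[OF \<open>p \<in> Z\<close>] by (auto simp: apply_bcontfun_inject)
    qed
    moreover have "apply_bcontfun ` V \<subseteq> M" using that by (auto simp: M_def)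
    ultimately show ?thesis
      using that unfolding openin_mtopology openin_euclidean_subtopology_iff by blast
  qed
  have op': "\<exists>V\<subseteq>Z. P = apply_bcontfun ` V" if "openin mtopology P" for P
    using openin_subset[OF that] unfolding topspace_mtopology unfolding M_def by (auto simp: subset_image_iff)
  have h1: "continuous_map (top_of_set Z) mtopology apply_bcontfun"
    unfolding continuous_map_alt
  proof (intro conjI allI impI)
    fix P assume "openin mtopology P"
    then obtain V where V: "V \<subseteq> Z" "P = apply_bcontfun ` V" using op' by blast
    have "{x \<in> Z. apply_bcontfun x \<in> P} = V" using V by (auto simp: apply_bcontfun_inject)
    then show "openin (top_of_set Z) (apply_bcontfun -` P \<inter> topspace (top_of_set Z))"
      using V op \<open>openin mtopology P\<close> by (simp add: vimage_def Int_def conj_commute)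
  qed (unfold topspace_mtopology, auto simp: M_def)
  have h2: "continuous_map mtopology (top_of_set Z) Bcontfun"
    unfolding continuous_map_alt
  proof (intro conjI allI impI)
    fix V assume V: "openin (top_of_set Z) V"
    then have "V \<subseteq> Z" using openin_subset by force
    then have "Bcontfun -` V \<inter> M = apply_bcontfun ` V"
      by (auto simp: M_def apply_bcontfun_inverse)
    then show "openin mtopology (Bcontfun -` V \<inter> topspace mtopology)"
      using V op \<open>V \<subseteq> Z\<close> by simp
  qed (unfold topspace_mtopology, auto simp: M_def apply_bcontfun_inverse)
  define A where "A = apply_bcontfun ` kuratowski ` X"
  have kZ: "kuratowski ` X \<subseteq> Z" by (auto simp: Z_def kuratowski_in_segments)
  have AM: "A \<subseteq> M" using kZ by (auto simp: A_def M_def)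
  have clA: "closedin mtopology A"
  proof -
    have "M - A = apply_bcontfun ` (Z - kuratowski ` X)"
      by (auto simp: M_def A_def apply_bcontfun_inject)
    then show ?thesis
      using AM op[of "Z - kuratowski ` X"] closedin_kuratowski[of X]
      by (auto simp: closedin_def Z_def)
  qed
  define k where "k = (\<lambda>x :: 'a. apply_bcontfun (kuratowski x))"
  define ki where "ki = inv_into X (kuratowski :: 'a \<Rightarrow> _)"
  have inj: "inj_on kuratowski X" by (metis dist_kuratowski dist_eq_0_iff inj_onI)
  have ki: "continuous_on (kuratowski ` X) ki" "ki ` kuratowski ` X \<subseteq> X"
    unfolding ki_def continuous_on_iff
    using inj by (auto simp: dist_kuratowski intro!: exI)
  have "homeomorphic_maps (top_of_set X) (subtopology mtopology A) k (\<lambda>p. ki (Bcontfun p))"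
    unfolding homeomorphic_maps_def
  proof (intro conjI)
    have "continuous_map (top_of_set X) (top_of_set Z) kuratowski"
      using kZ by (auto intro!: continuous_intros)
    from continuous_map_compose[OF this h1]
    show "continuous_map (top_of_set X) (subtopology mtopology A) k"
      by (auto simp: continuous_map_in_subtopology k_def o_def A_def)
    have "continuous_map (subtopology mtopology A) (top_of_set (kuratowski ` X)) Bcontfun"
      using continuous_map_from_subtopology[OF h2, of A]
      by (auto simp: continuous_map_in_subtopology A_def apply_bcontfun_inverse)
    from continuous_map_compose[OF this, of "top_of_set X" ki] ki
    show "continuous_map (subtopology mtopology A) (top_of_set X) (\<lambda>p. ki (Bcontfun p))"
      by (auto simp: o_def)
  qed (use inj AM in \<open>auto simp: k_def ki_def A_def apply_bcontfun_inverse\<close>)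
  then have "top_of_set X homeomorphic_space subtopology mtopology A"
    by (auto simp: homeomorphic_space_def)
  then obtain P where P: "openin mtopology P" "A \<subseteq> P" "A retract_of_space subtopology mtopology P"
    using assms clA metrizable_space_mtopology unfolding metrizable_ANR_def by blast
  then obtain U where U: "U \<subseteq> Z" "P = apply_bcontfun ` U" using op' by blast
  from P(3) obtain r where r: "continuous_map (subtopology mtopology P) (subtopology mtopology A) r"
    "\<And>x. x \<in> A \<Longrightarrow> r x = x"
    using P(2) by (auto simp: retract_of_space_def subtopology_subtopology Int_absorb1)
  define r' where "r' = (\<lambda>p. Bcontfun (r (apply_bcontfun p)))"
  show ?thesis
  proof (rule that[of U r'])
    show "openin (top_of_set (kuratowski_segments X)) U"
      using P(1) U op by (simp add: Z_def)
    show "kuratowski ` X \<subseteq> U"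
      using P(2) unfolding U(2) A_def by (simp add: inj_image_subset_iff inj_def apply_bcontfun_inject)
    have c1: "continuous_map (top_of_set U) (subtopology mtopology P) apply_bcontfun"
      using continuous_map_from_subtopology[OF h1, of U] U
      by (auto simp: continuous_map_in_subtopology subtopology_subtopology Int_absorb1)
    have c2: "continuous_map (subtopology mtopology A) (top_of_set (kuratowski ` X)) Bcontfun"
      using continuous_map_from_subtopology[OF h2, of A]
      by (auto simp: continuous_map_in_subtopology A_def apply_bcontfun_inverse)
    have "continuous_map (top_of_set U) (top_of_set (kuratowski ` X)) r'"
      using continuous_map_compose[OF continuous_map_compose[OF c1 r(1)] c2]
      by (simp add: r'_def o_def)
    then show "continuous_on U r'" "r' ` U \<subseteq> kuratowski ` X"
      by auto
    show "r' p = p" if "p \<in> kuratowski ` X" for p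
      using that r(2)[of "apply_bcontfun p"] by (auto simp: r'_def A_def apply_bcontfun_inverse)
  qed
qed


text \<open>The path is the retracted image of the straight segment between the embedded points.
  Compactness of \<open>C\<close> makes \<open>\<delta>\<close> uniform; \<open>y\<close> ranges
  over all of \<open>X\<close>, because approximations of maps into \<open>C\<close> may leave
  \<open>C\<close>.\<close>

lemma ANR_short_paths:
  fixes X :: "'a::metric_space set"
  assumes "metrizable_ANR (top_of_set X)" "compact C" "C \<subseteq> X" "\<epsilon> > 0"
  obtains \<delta> :: real and lam where "\<delta> > 0"
    "continuous_on {(x, y, t). x \<in> C \<and> y \<in> X \<and> dist x y < \<delta> \<and> t \<in> {0..1::real}} (\<lambda>(x, y, t). lam x y t)"
    "\<And>x y t. x \<in> C \<Longrightarrow> y \<in> X \<Longrightarrow> dist x y < \<delta> \<Longrightarrow> t \<in> {0..1} \<Longrightarrow> lam x y t \<in> X \<and> dist (lam x y t) x < \<epsilon>"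
    "\<And>x y. x \<in> C \<Longrightarrow> y \<in> X \<Longrightarrow> lam x y 0 = x" "\<And>x y. x \<in> C \<Longrightarrow> y \<in> X \<Longrightarrow> lam x y 1 = y"
proof -
  obtain U and r :: "('a \<Rightarrow>\<^sub>C real) \<Rightarrow> _"
    where U: "openin (top_of_set (kuratowski_segments X)) U" "kuratowski ` X \<subseteq> U"
    and r: "continuous_on U r" "r ` U \<subseteq> kuratowski ` X" "\<And>p. p \<in> kuratowski ` X \<Longrightarrow> r p = p"
    using ANR_kuratowski_retraction[OF assms(1)] by metis
  have inj: "inj_on kuratowski X" by (metis dist_kuratowski dist_eq_0_iff inj_onI)
  define ki where "ki = inv_into X (kuratowski :: 'a \<Rightarrow> _)"
  have ki: "continuous_on (kuratowski ` X) ki"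
    unfolding ki_def continuous_on_iff
    using inj by (auto simp: dist_kuratowski intro!: exI)
  have kik: "ki (kuratowski x) = x" if "x \<in> X" for x
    using inj that by (simp add: ki_def)
  have "\<exists>\<rho>>0. \<forall>q\<in>kuratowski_segments X. dist q (kuratowski x) < \<rho> \<longrightarrow>
      q \<in> U \<and> dist (r q) (kuratowski x) < \<epsilon> / 2" if "x \<in> C" for x
  proof -
    have kx: "kuratowski x \<in> U" "r (kuratowski x) = kuratowski x" using that assms(3) U r by auto
    obtain d1 where d1: "d1 > 0" "\<And>q. q \<in> kuratowski_segments X \<Longrightarrow> dist q (kuratowski x) < d1 \<Longrightarrow> q \<in> U"
      using U(1) kx(1) unfolding openin_euclidean_subtopology_iff by meson
    obtain d2 where d2: "d2 > 0" "\<And>q. q \<in> U \<Longrightarrow> dist q (kuratowski x) < d2 \<Longrightarrow> dist (r q) (kuratowski x) < \<epsilon> / 2"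
      using r(1) kx assms(4) unfolding continuous_on_iff by (metis half_gt_zero)
    show ?thesis
      using d1 d2 by (intro exI[of _ "min d1 d2"]) auto
  qed
  then obtain \<rho> where \<rho>: "\<And>x. x \<in> C \<Longrightarrow> \<rho> x > 0"
    "\<And>x q. x \<in> C \<Longrightarrow> q \<in> kuratowski_segments X \<Longrightarrow> dist q (kuratowski x) < \<rho> x \<Longrightarrow>
      q \<in> U \<and> dist (r q) (kuratowski x) < \<epsilon> / 2"
    by metis
  have "compact (kuratowski ` C)"
    by (intro compact_continuous_image continuous_intros assms)
  \<comment> \<open>\<open>\<delta>\<close> is a Lebesgue number: a segment shorter than
    \<open>\<delta>\<close> that starts at \<open>kuratowski x\<close> stays in a ball about one
    \<open>kuratowski x0\<close>. The retracted point of the segment and \<open>kuratowski x\<close>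
    itself are then both \<open>\<epsilon> / 2\<close>-close to the centre.\<close>
  then obtain \<delta> where \<delta>: "\<delta> > 0"
    "\<And>p. p \<in> kuratowski ` C \<Longrightarrow> \<exists>G\<in>(\<lambda>x. ball (kuratowski x) (\<rho> x)) ` C. ball p \<delta> \<subseteq> G"
    by (rule Heine_Borel_lemma[of _ "(\<lambda>x. ball (kuratowski x) (\<rho> x)) ` C"]) (use \<rho>(1) in auto)
  define seg where "seg = (\<lambda>(x :: 'a, y :: 'a, t :: real). (1 - t) *\<^sub>R kuratowski x + t *\<^sub>R kuratowski y)"
  define lam where "lam = (\<lambda>x y t. ki (r (seg (x :: 'a, y :: 'a, t :: real))))"
  let ?D = "{(x, y, t). x \<in> C \<and> y \<in> X \<and> dist x y < \<delta> \<and> t \<in> {0..1::real}}"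
  have key: "seg (x, y, t) \<in> U \<and> dist (r (seg (x, y, t))) (kuratowski x) < \<epsilon>"
    if "x \<in> C" "y \<in> X" "dist x y < \<delta>" "t \<in> {0..1}" for x y t
  proof -
    have "kuratowski x \<in> kuratowski ` C" using that(1) by simp
    then obtain x0 where x0: "x0 \<in> C" "ball (kuratowski x) \<delta> \<subseteq> ball (kuratowski x0) (\<rho> x0)"
      using \<delta>(2) by blast
    have "dist (seg (x, y, t)) (kuratowski x) = t * dist x y"
    proof -
      have "seg (x, y, t) - kuratowski x = t *\<^sub>R (kuratowski y - kuratowski x)"
        by (simp add: seg_def algebra_simps)
      then show ?thesis
        using that(4) by (simp add: dist_norm[of "seg _"]) (metis dist_kuratowski dist_norm dist_commute)
    qed
    also have "\<dots> \<le> dist x y" using that(4) by (simp add: mult_left_le_one_le)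
    finally have "seg (x, y, t) \<in> ball (kuratowski x) \<delta>" using that(3) by (simp add: dist_commute)
    moreover have "kuratowski x \<in> ball (kuratowski x) \<delta>" using \<delta>(1) by simp
    ultimately have "seg (x, y, t) \<in> ball (kuratowski x0) (\<rho> x0)" "kuratowski x \<in> ball (kuratowski x0) (\<rho> x0)"
      using x0(2) by blast+
    then have b: "dist (seg (x, y, t)) (kuratowski x0) < \<rho> x0" "dist (kuratowski x) (kuratowski x0) < \<rho> x0"
      by (simp_all add: dist_commute)
    have "seg (x, y, t) \<in> kuratowski_segments X"
      using that assms(3) by (auto simp: seg_def kuratowski_segments_def)
    from \<rho>(2)[OF x0(1) this b(1)] \<rho>(2)[OF x0(1) kuratowski_in_segments[of x X] b(2)] r(3)[of "kuratowski x"]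
    show ?thesis
      using that(1) assms(3) dist_triangle_half_l[of "r (seg (x,y,t))" "kuratowski x0" \<epsilon> "kuratowski x"] by auto
  qed
  show ?thesis
  proof (rule that[of \<delta> lam])
    have "continuous_on ?D seg"
      unfolding seg_def case_prod_beta by (intro continuous_intros)
    then have "continuous_on ?D (\<lambda>p. ki (r (seg p)))"
      using key r(2)
      by (intro continuous_on_compose2[OF ki] continuous_on_compose2[OF r(1)]) auto
    then show "continuous_on ?D (\<lambda>(x, y, t). lam x y t)"
      by (simp add: lam_def case_prod_beta)
    show "lam x y t \<in> X \<and> dist (lam x y t) x < \<epsilon>"
      if "x \<in> C" "y \<in> X" "dist x y < \<delta>" "t \<in> {0..1}" for x y t
    proof -
      have "r (seg (x, y, t)) \<in> kuratowski ` X"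
        using key[OF that] r(2) by blast
      then obtain w where "w \<in> X" "r (seg (x, y, t)) = kuratowski w" by blast
      then show ?thesis
        using key[OF that] by (simp add: lam_def kik dist_kuratowski)
    qed
    show "lam x y 0 = x" "lam x y 1 = y" if "x \<in> C" "y \<in> X" for x y
      using that assms(3) r(3) kik by (auto simp: lam_def seg_def)
  qed (fact \<delta>(1))
qed

subsection \<open>Discs in the product of a graph and an interval\<close>

lemma finite_1_complex_imp_compact: "finite_1_complex K \<Longrightarrow> compact K"
  unfolding finite_1_complex_def simplicial_complex_def
  using compact_simplex by (metis compact_Union)

lemma simplicial_complex_Int_face:
  assumes "simplicial_complex \<C>" "S \<in> \<C>" "T \<in> \<C>"
  shows "S \<inter> T face_of S" "S \<inter> T face_of T"
  using assms unfolding simplicial_complex_def by (blast, metis Int_commute)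

lemma simplicial_complex_face:
  "simplicial_complex \<C> \<Longrightarrow> S \<in> \<C> \<Longrightarrow> F face_of S \<Longrightarrow> F \<in> \<C>"
  unfolding simplicial_complex_def by blast

lemma simplicial_complex_simplex:
  assumes "simplicial_complex \<C>" "S \<in> \<C>"
  shows "polyhedron S" "compact S" "convex S"
  using assms simplex_imp_polyhedron compact_simplex convex_simplex
  unfolding simplicial_complex_def by metis+

lemma simplicial_complex_subset:
  assumes "simplicial_complex \<C>" "\<D> \<subseteq> \<C>" "\<And>F S. S \<in> \<D> \<Longrightarrow> F face_of S \<Longrightarrow> F \<in> \<D>"
  shows "simplicial_complex \<D>"
proof -
  have "finite \<D>" using assms finite_subset unfolding simplicial_complex_def by blast
  then show ?thesis
    using assms unfolding simplicial_complex_def by blast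
qed

lemma skeleton_simplicial_complex:
  assumes "simplicial_complex \<C>"
  shows "simplicial_complex {S \<in> \<C>. aff_dim S \<le> d}"
proof (rule simplicial_complex_subset[OF assms])
  fix F S assume "S \<in> {S \<in> \<C>. aff_dim S \<le> d}" "F face_of S"
  then show "F \<in> {S \<in> \<C>. aff_dim S \<le> d}"
    using assms aff_dim_subset[OF face_of_imp_subset, of F S] unfolding simplicial_complex_def by auto
qed auto

text \<open>A simplex of top dimension is a proper face of no other simplex, so a point of its
  relative interior lies in no other one. Conversely, its relative frontier is covered by proper
  faces, which belong to the complex.\<close>

lemma top_simplex_rel_interior:
  fixes e :: "'a::euclidean_space set"
  assumes C: "simplicial_complex \<C>" "e \<in> \<C>" "\<And>S. S \<in> \<C> \<Longrightarrow> aff_dim S \<le> aff_dim e"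
  shows "rel_interior e = \<Union>\<C> - \<Union>(\<C> - {e})"
proof (intro set_eqI iffI)
  fix x assume x: "x \<in> rel_interior e"
  have False if "S \<in> \<C>" "S \<noteq> e" "x \<in> S" for S
  proof -
    have f: "e \<inter> S face_of e" "e \<inter> S face_of S"
      using simplicial_complex_Int_face C that by blast+
    moreover have "x \<in> e \<inter> S" using x that rel_interior_subset by blast
    ultimately have "e \<inter> S = e" using face_of_disjoint_rel_interior x by blast
    with f(2) have "e face_of S" by simp
    moreover have "convex S" using C that simplicial_complex_simplex by blast
    ultimately have "aff_dim e < aff_dim S" using face_of_aff_dim_lt that by blast
    then show False using C that by force
  qed
  then show "x \<in> \<Union>\<C> - \<Union>(\<C> - {e})" using x C rel_interior_subset by blast
next
  have poly: "polyhedron e" using C simplicial_complex_simplex by blast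
  fix x assume x: "x \<in> \<Union>\<C> - \<Union>(\<C> - {e})"
  have "rel_frontier e \<subseteq> \<Union>(\<C> - {e})"
    unfolding rel_frontier_of_polyhedron_alt[OF poly]
    using C unfolding simplicial_complex_def by blast
  then have "x \<in> e" "x \<notin> rel_frontier e" using x by auto
  then show "x \<in> rel_interior e"
    using polyhedron_imp_closed[OF poly] by (simp add: rel_frontier_def)
qed

lemma openin_top_simplex_rel_interior:
  fixes e :: "'a::euclidean_space set"
  assumes "simplicial_complex \<C>" "e \<in> \<C>" "\<And>S. S \<in> \<C> \<Longrightarrow> aff_dim S \<le> aff_dim e"
  shows "openin (top_of_set (\<Union>\<C>)) (rel_interior e)"
proof -
  have "closed (\<Union>(\<C> - {e}))"
    using simplicial_complex_simplex(2)[OF assms(1)] assms(1) compact_imp_closed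
    unfolding simplicial_complex_def by (intro closed_Union) auto
  then have "openin (top_of_set (\<Union>\<C>)) (\<Union>\<C> - \<Union>(\<C> - {e}))"
    by (auto simp: openin_open Diff_eq[of "\<Union>\<C>"])
  then show ?thesis
    using top_simplex_rel_interior[OF assms] by simp
qed

text \<open>Invariance of domain: over the open edge \<open>rel_interior e\<close> the product is a
  planar strip, in which the interior of a disc is open. An interior point at height 0 would force
  points of negative height.\<close>

lemma disc_avoids_edge_bottom:
  fixes h :: "real^2 \<Rightarrow> 'a::euclidean_space \<times> real"
  assumes C: "simplicial_complex \<C>" "\<And>S. S \<in> \<C> \<Longrightarrow> aff_dim S \<le> 1"
    and e: "e \<in> \<C>" "aff_dim e = 1" "x \<in> rel_interior e"
    and h: "homeomorphism (cball 0 1) B h k" "B \<subseteq> \<Union>\<C> \<times> {0..1}"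
    and w: "w \<in> ball 0 1" "h w = (x, t)"
  shows "t \<noteq> 0"
proof
  assume "t = 0"
  define A where "A = {v \<in> ball 0 1. fst (h v) \<in> rel_interior e}"
  have hc: "continuous_on (ball 0 1) h" "inj_on h (ball 0 1)" "h ` ball 0 1 \<subseteq> \<Union>\<C> \<times> {0..1}"
  proof -
    have "continuous_on (cball 0 1) h" "inj_on h (cball 0 1)" "h ` cball 0 1 \<subseteq> \<Union>\<C> \<times> {0..1}"
      using h unfolding homeomorphism_def by (auto intro: inj_on_inverseI)
    then show "continuous_on (ball 0 1) h" "inj_on h (ball 0 1)" "h ` ball 0 1 \<subseteq> \<Union>\<C> \<times> {0..1}"
      using ball_subset_cball[of "0 :: real^2" 1] by (blast intro: continuous_on_subset inj_on_subset)+
  qed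
  have "openin (top_of_set (ball 0 1)) (ball 0 1 \<inter> (\<lambda>v. fst (h v)) -` rel_interior e)"
  proof (rule continuous_openin_preimage)
    show "continuous_on (ball 0 1) (\<lambda>v. fst (h v))" by (intro continuous_intros hc)
    show "(\<lambda>v. fst (h v)) \<in> ball 0 1 \<rightarrow> \<Union>\<C>" using hc(3) by fastforce
    show "openin (top_of_set (\<Union>\<C>)) (rel_interior e)"
      using openin_top_simplex_rel_interior[OF C(1) e(1)] C(2) e(2) by simp
  qed
  then have "open A"
    by (simp add: A_def openin_open_eq vimage_def Int_def)
  obtain a b where ab: "e = closed_segment a b" "a \<noteq> b"
  proof -
    obtain n where "n simplex e" using C e unfolding simplicial_complex_def by blast
    then have "1 simplex e" using aff_dim_simplex e(2) by metis
    then obtain D where D: "card D = 2" "e = convex hull D" unfolding simplex_def by auto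
    then obtain a b where "D = {a, b}" "a \<noteq> b" unfolding card_2_iff by blast
    then show thesis using that D(2) segment_convex_hull by metis
  qed
  \<comment> \<open>Planar coordinates of the strip: the position along the edge, up to scale, and
    the height.\<close>
  define \<phi> where "\<phi> = (\<lambda>v. ((fst (h v) - a) \<bullet> (b - a), snd (h v)))"
  have "continuous_on A \<phi>"
    unfolding \<phi>_def by (intro continuous_intros continuous_on_subset[OF hc(1)]) (auto simp: A_def)
  moreover have "inj_on \<phi> A"
  proof (rule inj_onI)
    fix u v assume u: "u \<in> A" and v: "v \<in> A" and eq: "\<phi> u = \<phi> v"
    have "fst (h u) \<in> closed_segment a b" "fst (h v) \<in> closed_segment a b"
      using u v rel_interior_subset[of e] by (auto simp: A_def ab)
    then obtain p q where p: "fst (h u) = a + p *\<^sub>R (b - a)" and q: "fst (h v) = a + q *\<^sub>R (b - a)"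
      by (auto simp: in_segment algebra_simps)
    with eq ab have "p = q" by (simp add: \<phi>_def)
    with p q eq have "h u = h v" by (simp add: \<phi>_def prod_eq_iff)
    then show "u = v" using hc(2) u v by (auto simp: A_def inj_on_def)
  qed
  ultimately have "open (\<phi> ` A)"
    using \<open>open A\<close> by (intro invariance_of_domain_gen) auto
  moreover have "\<phi> w \<in> \<phi> ` A" using w e(3) by (auto simp: A_def)
  ultimately obtain r where r: "r > 0" "ball (\<phi> w) r \<subseteq> \<phi> ` A"
    using open_contains_ball by blast
  have "(fst (\<phi> w), - r / 2) \<in> ball (\<phi> w) r"
    using r w \<open>t = 0\<close> by (simp add: \<phi>_def dist_Pair_Pair dist_real_def)
  then have "(fst (\<phi> w), - r / 2) \<in> \<phi> ` A" using r(2) by blast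
  then obtain v where "v \<in> A" "snd (\<phi> v) = - r / 2" by (metis imageE snd_conv)
  moreover have "snd (h v) \<ge> 0" if "v \<in> A" for v
    using hc(3) that by (fastforce simp: A_def)
  ultimately show False using r(1) by (force simp: \<phi>_def)
qed

text \<open>A connected set over finitely many points lies over a single one, where the height would
  embed an open disc of the plane in the line, against invariance of dimension.\<close>

lemma no_disc_in_finite_times_real:
  fixes h :: "real^2 \<Rightarrow> 'a::metric_space \<times> real"
  assumes "finite V" "homeomorphism (cball 0 1) B h k" "B \<subseteq> V \<times> {0..1}"
  shows False
proof -
  have h: "continuous_on (cball 0 1) h" "inj_on h (cball 0 1)" "h ` cball 0 1 \<subseteq> V \<times> {0..1}"
    using assms(2,3) unfolding homeomorphism_def by (auto intro: inj_on_inverseI)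
  have "connected ((\<lambda>v. fst (h v)) ` cball 0 1)"
    by (intro connected_continuous_image continuous_intros h) simp
  moreover have "finite ((\<lambda>v. fst (h v)) ` cball 0 1)"
    using h(3) by (intro finite_subset[OF _ assms(1)]) force
  ultimately obtain c where c: "(\<lambda>v. fst (h v)) ` cball 0 1 \<subseteq> {c}"
    by (metis connected_finite_iff_sing empty_subsetI order_refl)
  have "inj_on (\<lambda>v. snd (h v)) (ball 0 1)"
  proof (rule inj_onI)
    fix u v assume uv: "u \<in> ball 0 1" "v \<in> ball (0::real^2) 1" "snd (h u) = snd (h v)"
    then have "u \<in> cball 0 1" "v \<in> cball 0 1" by auto
    moreover from this have "fst (h u) = fst (h v)" using c by blast
    ultimately show "u = v" using uv h(2) by (auto simp: inj_on_def prod_eq_iff)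
  qed
  moreover have "continuous_on (ball 0 1) (\<lambda>v. snd (h v))"
    by (intro continuous_intros continuous_on_subset[OF h(1)]) auto
  ultimately have "DIM(real^2) \<le> DIM(real)"
    by (intro invariance_of_dimension[of "ball 0 1" "\<lambda>v. snd (h v)"]) auto
  then show False by simp
qed

subsection \<open>Disjoint maps of graphs\<close>

lemma finite_separation:
  fixes V :: "'a::metric_space set"
  assumes "finite V"
  obtains r where "r > 0" "\<And>v w. v \<in> V \<Longrightarrow> w \<in> V \<Longrightarrow> v \<noteq> w \<Longrightarrow> r \<le> dist v w"
proof -
  \<comment> \<open>The extra element 1 keeps \<open>Min D\<close> meaningful when \<open>V\<close>
    has at most one point.\<close>
  define D where "D = insert 1 ((\<lambda>(v, w). dist v w) ` {(v, w) \<in> V \<times> V. v \<noteq> w})"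
  have "finite {(v, w) \<in> V \<times> V. v \<noteq> w}"
    by (rule finite_subset[of _ "V \<times> V"]) (use assms in auto)
  then have D: "finite D" "D \<noteq> {}" by (auto simp: D_def)
  show ?thesis
  proof (rule that)
    show "Min D > 0" using D by (auto simp: D_def)
    show "Min D \<le> dist v w" if "v \<in> V" "w \<in> V" "v \<noteq> w" for v w
    proof -
      have "dist v w \<in> D"
        unfolding D_def using that by (intro insertI2 image_eqI[of _ _ "(v, w)"]) auto
      then show ?thesis by (rule Min_le[OF D(1)])
    qed
  qed
qed

text \<open>On a small ball about \<open>v\<close> the short path from \<open>f x\<close> to
  \<open>p v\<close> is followed up to a time that falls from 1 at the centre to 0 on the sphere.
  The tolerance \<open>\<delta>\<close> is fixed before \<open>p\<close>, since the new values will
  come from an application of the fuzzy ribbons property whose accuracy has to be chosen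
  first.\<close>

lemma ANR_perturb_at_finite_set:
  fixes X :: "'a::metric_space set" and f :: "'b::metric_space \<Rightarrow> 'a"
  assumes ANR: "metrizable_ANR (top_of_set X)"
    and f: "compact K" "continuous_on K f" "f ` K \<subseteq> X"
    and V: "finite V" "V \<subseteq> K" and "\<epsilon> > 0"
  obtains \<delta> :: real where "\<delta> > 0"
    "\<forall>p. p ` V \<subseteq> X \<and> (\<forall>v\<in>V. dist (p v) (f v) < \<delta>) \<longrightarrow>
        (\<exists>g. continuous_on K g \<and> g ` K \<subseteq> X \<and> (\<forall>v\<in>V. g v = p v) \<and> (\<forall>x\<in>K. dist (g x) (f x) < \<epsilon>))"
proof -
  obtain \<delta> lam where \<delta>: "\<delta> > 0" and
    lam: "continuous_on {(x, y, t). x \<in> f ` K \<and> y \<in> X \<and> dist x y < \<delta> \<and> t \<in> {0..1::real}} (\<lambda>(x, y, t). lam x y t)"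
    "\<And>x y t. x \<in> f ` K \<Longrightarrow> y \<in> X \<Longrightarrow> dist x y < \<delta> \<Longrightarrow> t \<in> {0..1} \<Longrightarrow> lam x y t \<in> X \<and> dist (lam x y t) x < \<epsilon>"
    "\<And>x y. x \<in> f ` K \<Longrightarrow> y \<in> X \<Longrightarrow> lam x y 0 = x" "\<And>x y. x \<in> f ` K \<Longrightarrow> y \<in> X \<Longrightarrow> lam x y 1 = y"
    using that by (rule ANR_short_paths[OF ANR compact_continuous_image[OF f(2,1)] f(3) \<open>\<epsilon> > 0\<close>])
  obtain r0 where r0: "r0 > 0" "\<And>v w. v \<in> V \<Longrightarrow> w \<in> V \<Longrightarrow> v \<noteq> w \<Longrightarrow> r0 \<le> dist v w"
    using finite_separation[OF V(1)] by blast
  obtain r1 where r1: "r1 > 0" "\<And>x y. x \<in> K \<Longrightarrow> y \<in> K \<Longrightarrow> dist y x < r1 \<Longrightarrow> dist (f y) (f x) < \<delta> / 2"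
    using compact_uniformly_continuous[OF f(2,1)] \<delta> unfolding uniformly_continuous_on_def
    by (meson half_gt_zero)
  \<comment> \<open>The bound \<open>r0 / 3\<close> makes the closed balls disjoint. The bound
    \<open>r1 / 2\<close> keeps \<open>f x\<close> within \<open>\<delta> / 2\<close> of
    \<open>f v\<close> on each, which together with the \<open>\<delta> / 2\<close> allowed for
    \<open>p v\<close> leaves \<open>p v\<close> within the range \<open>\<delta>\<close> of short
    paths from \<open>f x\<close>.\<close>
  define r where "r = min (r0 / 3) (r1 / 2)"
  have r: "r > 0" "r < r1" "2 * r < r0" using r0(1) r1(1) by (auto simp: r_def)
  have uniq: "v = w" if "v \<in> V" "w \<in> V" "dist x v \<le> r" "dist x w \<le> r" for x v w
    using r0(2)[of v w] that r(3) dist_triangle3[of v w x] by force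
  show ?thesis
  proof (rule that[of "\<delta> / 2"]; (intro allI impI)?)
    fix p assume "p ` V \<subseteq> X \<and> (\<forall>v\<in>V. dist (p v) (f v) < \<delta> / 2)"
    then have p: "p ` V \<subseteq> X" "\<And>v. v \<in> V \<Longrightarrow> dist (p v) (f v) < \<delta> / 2" by blast+
    define c where "c = (\<lambda>x. SOME v. v \<in> V \<and> dist x v \<le> r)"
    have c: "c x = v" if "v \<in> V" "dist x v \<le> r" for x v
      unfolding c_def using that uniq by (intro some_equality) auto
    define g where "g = (\<lambda>x. if \<exists>v\<in>V. dist x v \<le> r then lam (f x) (p (c x)) (1 - dist x (c x) / r) else f x)"
    have g: "g x = lam (f x) (p v) (1 - dist x v / r)" if "v \<in> V" "dist x v \<le> r" for x v
      using that c[OF that] by (auto simp: g_def)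
    have near: "f x \<in> f ` K" "p v \<in> X" "dist (f x) (p v) < \<delta>" "1 - dist x v / r \<in> {0..1}"
      if "v \<in> V" "x \<in> K" "dist x v \<le> r" for x v
    proof -
      have "dist (f x) (f v) < \<delta> / 2" using r1(2)[of v x] that V(2) r(2) by auto
      then show "dist (f x) (p v) < \<delta>"
        using p(2)[OF that(1)] dist_triangle_half_l[of "f x" "f v" \<delta> "p v"] by (simp add: dist_commute)
    qed (use that p(1) r(1) in auto)
    define U where "U = K - (\<Union>v\<in>V. ball v r)"
    have gU: "g x = f x" if "x \<in> U" for x
    proof (cases "\<exists>v\<in>V. dist x v \<le> r")
      case True
      then obtain v where v: "v \<in> V" "dist x v \<le> r" by blast
      then have "dist x v = r" using that by (force simp: U_def dist_commute)
      then show ?thesis using g[OF v] lam(3) near(1,2)[OF v(1) _ v(2)] that r(1) by (simp add: U_def)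
    qed (simp add: g_def)
    have "continuous_on (K \<inter> cball v r) g" if "v \<in> V" for v
    proof -
      have "continuous_on (K \<inter> cball v r) (\<lambda>x. (f x, p v, 1 - dist x v / r))"
        using r(1) by (intro continuous_intros continuous_on_subset[OF f(2)]) auto
      then have "continuous_on (K \<inter> cball v r) (\<lambda>x. (\<lambda>(x, y, t). lam x y t) (f x, p v, 1 - dist x v / r))"
        by (rule continuous_on_compose2[OF lam(1)])
          (use near[OF that] in \<open>auto simp: dist_commute\<close>)
      then show ?thesis
        by (rule continuous_on_eq) (use g[OF that] in \<open>auto simp: dist_commute\<close>)
    qed
    then have "continuous_on (\<Union>v\<in>V. K \<inter> cball v r) g"
      using V(1) f(1) by (intro continuous_on_closed_Union) (auto intro: closed_Int compact_imp_closed)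
    moreover have "continuous_on U g"
      using gU by (intro continuous_on_eq[OF continuous_on_subset[OF f(2)]]) (auto simp: U_def)
    moreover have "closed U" unfolding U_def
      using f(1) by (intro closed_Diff) (auto intro: compact_imp_closed)
    moreover have "closed (\<Union>v\<in>V. K \<inter> cball v r)"
      using V(1) f(1) by (intro closed_UN) (auto intro: closed_Int compact_imp_closed)
    ultimately have "continuous_on (U \<union> (\<Union>v\<in>V. K \<inter> cball v r)) g"
      by (intro continuous_on_closed_Un) auto
    moreover have "U \<union> (\<Union>v\<in>V. K \<inter> cball v r) = K" by (auto simp: U_def)
    ultimately have "continuous_on K g" by simp
    moreover have "g x \<in> X \<and> dist (g x) (f x) < \<epsilon>" if "x \<in> K" for x
    proof (cases "\<exists>v\<in>V. dist x v \<le> r")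
      case True
      then obtain v where v: "v \<in> V" "dist x v \<le> r" by blast
      then show ?thesis using g[OF v] near[OF v(1) that v(2)] lam(2) by simp
    next
      case False
      then show ?thesis using that f(3) \<open>\<epsilon> > 0\<close> by (auto simp: g_def)
    qed
    moreover have "g v = p v" if "v \<in> V" for v
      using g[OF that, of v] r(1) lam(4) near[OF that, of v] that V(2) by auto
    ultimately show "\<exists>g. continuous_on K g \<and> g ` K \<subseteq> X \<and> (\<forall>v\<in>V. g v = p v) \<and> (\<forall>x\<in>K. dist (g x) (f x) < \<epsilon>)"
      by blast
  qed (use \<delta> in simp)
qed

lemma category_Kc_const:
  assumes "finite_1_complex K" "continuous_on K f" "f ` K \<subseteq> X"
  shows "category_Kc X K (\<lambda>z. f (fst z)) snd"
proof -
  have "continuous_on (K \<times> {0..1::real}) (\<lambda>z. f (fst z))"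
    by (intro continuous_on_compose2[OF assms(2)] continuous_intros) auto
  then show ?thesis
    using assms unfolding category_Kc_def category_K_def topographical_map_pair_def
    by (auto intro!: continuous_on_snd continuous_on_id)
qed

lemma fuzzy_ribbonsE:
  assumes "fuzzy_ribbons_property X" "finite_1_complex K1" "continuous_on K1 f1" "f1 ` K1 \<subseteq> X"
    and "finite_1_complex K2" "continuous_on (K2 \<times> {0..1}) f2" "f2 ` (K2 \<times> {0..1}) \<subseteq> X" "\<epsilon> > 0"
  obtains f1' \<tau>1 f2' \<tau>2 where "category_K X K1 f1' \<tau>1" "category_K X K2 f2' \<tau>2"
    "\<And>x t. x \<in> K1 \<Longrightarrow> t \<in> {0..1} \<Longrightarrow> dist (f1' (x, t)) (f1 x) < \<epsilon>"
    "\<And>z. z \<in> K2 \<times> {0..1} \<Longrightarrow> dist (f2' z) (f2 z) < \<epsilon>"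
    "fractured_over K2 f2' \<tau>2 K1 f1' \<tau>1"
proof -
  have "category_K X K2 f2 snd"
    using assms(5-7) unfolding category_K_def topographical_map_pair_def
    by (auto intro!: continuous_on_snd continuous_on_id)
  then obtain f1' \<tau>1 f2' \<tau>2 where "category_K X K1 f1' \<tau>1"
    "\<forall>z\<in>K1 \<times> {0..1}. dist (f1' z) (f1 (fst z)) < \<epsilon>" "category_K X K2 f2' \<tau>2"
    "\<forall>z\<in>K2 \<times> {0..1}. dist (f2' z) (f2 z) < \<epsilon>" "fractured_over K2 f2' \<tau>2 K1 f1' \<tau>1"
    using assms(1) category_Kc_const[OF assms(2-4)] \<open>\<epsilon> > 0\<close> unfolding fuzzy_ribbons_property_def
    by blast
  then show ?thesis by (intro that[of f1' \<tau>1 f2' \<tau>2]) auto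
qed

lemma fractured_overE:
  assumes "fractured_over K2 f2 \<tau>2 K1 f1 \<tau>1"
  obtains m :: nat and B and h :: "nat \<Rightarrow> real^2 \<Rightarrow> (real^3) \<times> real" where
    "\<And>j. j < m \<Longrightarrow> B j \<subseteq> K2 \<times> {0..1}"
    "\<And>j. j < m \<Longrightarrow> \<exists>k. homeomorphism (cball (0 :: real^2) 1) (B j) (h j) k"
    "\<And>i j. i < m \<Longrightarrow> j < m \<Longrightarrow> i \<noteq> j \<Longrightarrow> B i \<inter> B j = {}"
    "{z \<in> K2 \<times> {0..1}. f2 z \<in> f1 ` (K1 \<times> {0..1})} \<subseteq> (\<Union>j<m. h j ` ball 0 1)"
    "\<And>j. j < m \<Longrightarrow> \<tau>1 ` {z \<in> K1 \<times> {0..1}. f1 z \<in> f2 ` B j} \<noteq> {0..1}"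
proof -
  from assms obtain m :: nat and B and h :: "nat \<Rightarrow> real^2 \<Rightarrow> (real^3) \<times> real" where
    *: "(\<forall>j<m. B j \<subseteq> K2 \<times> {0..1} \<and> (\<exists>k. homeomorphism (cball 0 1) (B j) (h j) k)) \<and>
      disjoint_family_on B {..<m} \<and>
      {z \<in> K2 \<times> {0..1}. f2 z \<in> f1 ` (K1 \<times> {0..1})} \<subseteq> (\<Union>j<m. h j ` ball 0 1) \<and>
      (\<forall>j<m. \<tau>1 ` {z \<in> K1 \<times> {0..1}. f1 z \<in> f2 ` B j} \<noteq> {0..1})"
    unfolding fractured_over_def by (elim exE)
  show ?thesis
    by (rule that[of m B h]) (use * in \<open>simp_all add: disjoint_family_on_def\<close>)
qed

lemma fractured_over_disc:
  assumes "fractured_over K2 f2 \<tau>2 K1 f1 \<tau>1" "z \<in> K2 \<times> {0..1}" "f2 z \<in> f1 ` (K1 \<times> {0..1})"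
  obtains B k w and h :: "real^2 \<Rightarrow> (real^3) \<times> real" where "homeomorphism (cball 0 1) B h k"
    "B \<subseteq> K2 \<times> {0..1}" "w \<in> ball 0 1" "h w = z"
proof (rule fractured_overE[OF assms(1)])
  fix m :: nat and B and h :: "nat \<Rightarrow> real^2 \<Rightarrow> (real^3) \<times> real"
  assume B: "\<And>j. j < m \<Longrightarrow> B j \<subseteq> K2 \<times> {0..1}" "\<And>j. j < m \<Longrightarrow> \<exists>k. homeomorphism (cball 0 1) (B j) (h j) k"
    and "{z \<in> K2 \<times> {0..1}. f2 z \<in> f1 ` (K1 \<times> {0..1})} \<subseteq> (\<Union>j<m. h j ` ball 0 1)"
  then obtain j w where j: "j < m" "w \<in> ball 0 1" "h j w = z" using assms(2,3) by auto
  then show ?thesis using B that by blast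
qed

lemma category_KD:
  assumes "category_K X K f \<tau>"
  shows "continuous_on (K \<times> {0..1}) f" "f ` (K \<times> {0..1}) \<subseteq> X"
    "continuous_on (K \<times> {0..1}) \<tau>" "\<tau> ` (K \<times> {0..1}) \<subseteq> {0..1}"
    "\<And>x. x \<in> K \<Longrightarrow> \<tau> (x, 0) = 0" "\<And>x. x \<in> K \<Longrightarrow> \<tau> (x, 1) = 1"
  using assms unfolding category_K_def topographical_map_pair_def by blast+

lemma category_K_slice:
  assumes "category_K X K f \<tau>" "t \<in> {0..1}"
  shows "continuous_on K (\<lambda>x. f (x, t))" "(\<lambda>x. f (x, t)) ` K \<subseteq> X"
proof -
  show "continuous_on K (\<lambda>x. f (x, t))"
    by (rule continuous_on_compose2[OF category_KD(1)[OF assms(1)]]) (use assms(2) in \<open>auto intro!: continuous_intros\<close>)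
  show "(\<lambda>x. f (x, t)) ` K \<subseteq> X"
    using category_KD(2)[OF assms(1)] assms(2) by auto
qed

text \<open>
  A disc in \<open>K2 \<times> {0..1}\<close> meets the bottom in no interior point, except possibly over a vertex of
  \<open>K2\<close>. So a first application of the property, with \<open>K2\<close> replaced by its vertices (over which there
  are no discs at all), makes the second one yield disjoint bottoms.
\<close>

lemma fuzzy_ribbons_disjoint_graphs:
  fixes X :: "'a::metric_space set"
  assumes ANR: "metrizable_ANR (top_of_set X)" and fuzzy: "fuzzy_ribbons_property X"
    and K1: "finite_1_complex K1" and f1: "continuous_on K1 f1" "f1 ` K1 \<subseteq> X"
    and K2: "finite_1_complex K2" and f2: "continuous_on K2 f2" "f2 ` K2 \<subseteq> X" and "\<epsilon> > 0"
  obtains g1 g2 where "continuous_on K1 g1" "g1 ` K1 \<subseteq> X" "continuous_on K2 g2" "g2 ` K2 \<subseteq> X"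
    "\<And>x. x \<in> K1 \<Longrightarrow> dist (g1 x) (f1 x) < \<epsilon>" "\<And>x. x \<in> K2 \<Longrightarrow> dist (g2 x) (f2 x) < \<epsilon>"
    "g1 ` K1 \<inter> g2 ` K2 = {}"
proof -
  obtain \<C> where \<C>: "simplicial_complex \<C>" "\<And>S. S \<in> \<C> \<Longrightarrow> aff_dim S \<le> 1" "K2 = \<Union>\<C>"
    using K2 unfolding finite_1_complex_def by blast
  define V where "V = \<Union>{S \<in> \<C>. aff_dim S \<le> 0}"
  have "finite S" if "aff_dim S \<le> 0" for S :: "(real^3) set"
  proof (cases "S = {}")
    case False
    then have "aff_dim S = 0" using that aff_dim_geq[of S] aff_dim_empty[of S] by linarith
    then obtain a where "S = {a}" unfolding aff_dim_eq_0 by blast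
    then show ?thesis by simp
  qed simp
  moreover have "finite \<C>" using \<C>(1) unfolding simplicial_complex_def by blast
  ultimately have V: "finite V" "V \<subseteq> K2"
    unfolding V_def \<C>(3) by auto
  have V1: "finite_1_complex V"
    unfolding finite_1_complex_def V_def
    using skeleton_simplicial_complex[OF \<C>(1), of 0] by (intro exI[of _ "{S \<in> \<C>. aff_dim S \<le> 0}"]) auto
  have cK1: "compact K1" and cK2: "compact K2"
    using K1 K2 finite_1_complex_imp_compact by auto
  \<comment> \<open>\<open>\<delta>\<close> tells how far the first application may move the values
    at the vertices so that the change still extends over \<open>K2\<close>.\<close>
  obtain \<delta> where \<delta>: "\<delta> > 0" "\<forall>p. p ` V \<subseteq> X \<and> (\<forall>v\<in>V. dist (p v) (f2 v) < \<delta>) \<longrightarrow>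
        (\<exists>g. continuous_on K2 g \<and> g ` K2 \<subseteq> X \<and> (\<forall>v\<in>V. g v = p v) \<and> (\<forall>x\<in>K2. dist (g x) (f2 x) < \<epsilon> / 2))"
    using that by (rule ANR_perturb_at_finite_set[OF ANR cK2 f2 V half_gt_zero[OF \<open>\<epsilon> > 0\<close>]])
  have f2V: "continuous_on (V \<times> {0..1::real}) (\<lambda>z. f2 (fst z))"
    by (intro continuous_on_compose2[OF f2(1)] continuous_intros) (use V(2) in auto)
  have f2VX: "(\<lambda>z. f2 (fst z)) ` (V \<times> {0..1::real}) \<subseteq> X" using V(2) f2(2) by (force simp: image_subset_iff)
  have \<epsilon>\<delta>: "min (\<epsilon> / 2) \<delta> > 0" using \<open>\<epsilon> > 0\<close> \<delta>(1) by simp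
  obtain a1 \<tau>1 a2 \<tau>2 where a: "category_K X K1 a1 \<tau>1" "category_K X V a2 \<tau>2"
    "\<And>x t. x \<in> K1 \<Longrightarrow> t \<in> {0..1} \<Longrightarrow> dist (a1 (x, t)) (f1 x) < min (\<epsilon> / 2) \<delta>"
    "\<And>z. z \<in> V \<times> {0..1} \<Longrightarrow> dist (a2 z) (f2 (fst z)) < min (\<epsilon> / 2) \<delta>"
    "fractured_over V a2 \<tau>2 K1 a1 \<tau>1"
    using that by (rule fuzzy_ribbonsE[OF fuzzy K1 f1 V1 f2V f2VX \<epsilon>\<delta>])
  have dis: "a2 (v, 0) \<noteq> a1 (x, 0)" if v: "v \<in> V" and x: "x \<in> K1" for v x
  proof
    assume eq: "a2 (v, 0) = a1 (x, 0)"
    show False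
      by (rule fractured_over_disc[OF a(5), of "(v, 0)"])
        (use v x eq no_disc_in_finite_times_real[OF V(1)] in auto)
  qed
  have "(\<lambda>v. a2 (v, 0)) ` V \<subseteq> X" using category_K_slice(2)[OF a(2)] by simp
  then obtain p2 where p2: "continuous_on K2 p2" "p2 ` K2 \<subseteq> X" "\<And>v. v \<in> V \<Longrightarrow> p2 v = a2 (v, 0)"
    "\<And>x. x \<in> K2 \<Longrightarrow> dist (p2 x) (f2 x) < \<epsilon> / 2"
    using \<delta>(2)[rule_format, of "\<lambda>v. a2 (v, 0)"] a(4) by auto
  define p1 where "p1 = (\<lambda>x. a1 (x, 0))"
  have p1: "continuous_on K1 p1" "p1 ` K1 \<subseteq> X"
    unfolding p1_def using category_K_slice[OF a(1), of 0] by auto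
  have "compact (p1 ` K1)" "compact (p2 ` V)"
    using p1(1) cK1 compact_continuous_image finite_imp_compact V(1) by blast+
  moreover have "p1 ` K1 \<inter> p2 ` V = {}"
    using dis p2(3) by (auto simp: p1_def) metis
  \<comment> \<open>The gap \<open>d\<close> between the image of \<open>K1\<close> and the values
    at the vertices outlasts the second application, which moves each map by less than
    \<open>d / 2\<close>. So only points over open edges remain to be treated.\<close>
  ultimately obtain d where d: "d > 0" "\<And>x y. x \<in> p1 ` K1 \<Longrightarrow> y \<in> p2 ` V \<Longrightarrow> d \<le> dist x y"
    using compact_disjoint_dist_pos by metis
  have p2c: "continuous_on (K2 \<times> {0..1::real}) (\<lambda>z. p2 (fst z))"
    by (intro continuous_on_compose2[OF p2(1)] continuous_intros) auto
  have p2X: "(\<lambda>z. p2 (fst z)) ` (K2 \<times> {0..1::real}) \<subseteq> X" using p2(2) by auto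
  have \<epsilon>d: "min (\<epsilon> / 2) (d / 2) > 0" using \<open>\<epsilon> > 0\<close> d(1) by simp
  obtain b1 \<sigma>1 b2 \<sigma>2 where b: "category_K X K1 b1 \<sigma>1" "category_K X K2 b2 \<sigma>2"
    "\<And>x t. x \<in> K1 \<Longrightarrow> t \<in> {0..1} \<Longrightarrow> dist (b1 (x, t)) (p1 x) < min (\<epsilon> / 2) (d / 2)"
    "\<And>z. z \<in> K2 \<times> {0..1} \<Longrightarrow> dist (b2 z) (p2 (fst z)) < min (\<epsilon> / 2) (d / 2)"
    "fractured_over K2 b2 \<sigma>2 K1 b1 \<sigma>1"
    using that by (rule fuzzy_ribbonsE[OF fuzzy K1 p1 K2 p2c p2X \<epsilon>d])
  have disj: "b2 (x, 0) \<noteq> b1 (y, 0)" if x: "x \<in> K2" and y: "y \<in> K1" for x y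
  proof
    assume eq: "b2 (x, 0) = b1 (y, 0)"
    have "x \<notin> V"
    proof
      assume "x \<in> V"
      then have "d \<le> dist (p1 y) (p2 x)" using d(2) y by blast
      moreover have "dist (b1 (y, 0)) (p1 y) < d / 2" "dist (b2 (x, 0)) (p2 x) < d / 2"
        using b(3)[OF y, of 0] b(4)[of "(x, 0)"] x by auto
      ultimately show False
        using dist_triangle_half_r[of "b1 (y, 0)" "p1 y" d "p2 x"] eq by simp
    qed
    obtain e where e: "e \<in> \<C>" "x \<in> e" using x \<C>(3) by blast
    then have "aff_dim e = 1" using \<open>x \<notin> V\<close> \<C>(2)[OF e(1)] unfolding V_def by force
    have "x \<notin> rel_frontier e"
    proof
      assume "x \<in> rel_frontier e"
      then obtain F where F: "F face_of e" "F \<noteq> e" "x \<in> F"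
        using rel_frontier_of_polyhedron_alt[OF simplicial_complex_simplex(1)[OF \<C>(1) e(1)]] by blast
      then have "aff_dim F < 1"
        using face_of_aff_dim_lt simplicial_complex_simplex(3)[OF \<C>(1) e(1)] \<open>aff_dim e = 1\<close> by metis
      then show False
        using F simplicial_complex_face[OF \<C>(1) e(1)] \<open>x \<notin> V\<close> unfolding V_def by force
    qed
    then have "x \<in> rel_interior e"
      using e(2) closure_closed[OF compact_imp_closed[OF simplicial_complex_simplex(2)[OF \<C>(1) e(1)]]]
      by (simp add: rel_frontier_def)
    have "b2 (x, 0) \<in> b1 ` (K1 \<times> {0..1})" "(x, 0 :: real) \<in> K2 \<times> {0..1}" using x y eq by auto
    then obtain B k w and h :: "real^2 \<Rightarrow> (real^3) \<times> real" where h: "homeomorphism (cball 0 1) B h k"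
      "B \<subseteq> \<Union>\<C> \<times> {0..1}" "w \<in> ball 0 1" "h w = (x, 0)"
      using fractured_over_disc[OF b(5)] \<C>(3) by metis
    then show False
      using disc_avoids_edge_bottom[OF \<C>(1,2) e(1) \<open>aff_dim e = 1\<close> \<open>x \<in> rel_interior e\<close> h] by simp
  qed
  show ?thesis
  proof (rule that[of "\<lambda>x. b1 (x, 0)" "\<lambda>x. b2 (x, 0)"])
    show "dist (b1 (x, 0)) (f1 x) < \<epsilon>" if "x \<in> K1" for x
      using a(3)[OF that, of 0] b(3)[OF that, of 0] dist_triangle_half_l[of "b1 (x, 0)" "p1 x" \<epsilon> "f1 x"]
      by (simp add: p1_def dist_commute)
    show "dist (b2 (x, 0)) (f2 x) < \<epsilon>" if "x \<in> K2" for x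
      using p2(4)[OF that] b(4)[of "(x, 0)"] that dist_triangle_half_l[of "b2 (x, 0)" "p2 x" \<epsilon> "f2 x"]
      by (simp add: dist_commute)
    show "(\<lambda>x. b1 (x, 0)) ` K1 \<inter> (\<lambda>x. b2 (x, 0)) ` K2 = {}"
      using disj by fastforce
  qed (use category_K_slice[OF b(1), of 0] category_K_slice[OF b(2), of 0] in auto)
qed

subsection \<open>Separation in one slab\<close>

text \<open>Besides homotopies this also joins height functions, whence the arbitrary value type.
  For collars, the middle third holds the given pair and the outer thirds hold the two
  collars.\<close>

definition join3 :: "('b \<times> real \<Rightarrow> 'c) \<Rightarrow> ('b \<times> real \<Rightarrow> 'c) \<Rightarrow> ('b \<times> real \<Rightarrow> 'c) \<Rightarrow> 'b \<times> real \<Rightarrow> 'c" where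
  "join3 a b c z = (if snd z \<le> 1/3 then a (fst z, 3 * snd z)
     else if snd z \<le> 2/3 then b (fst z, 3 * snd z - 1) else c (fst z, 3 * snd z - 2))"

lemma join3_eqs:
  assumes "a (x, 1) = b (x, 0)" "b (x, 1) = c (x, 0)"
  shows "t \<le> 1/3 \<Longrightarrow> join3 a b c (x, t) = a (x, 3 * t)"
    "1/3 \<le> t \<Longrightarrow> t \<le> 2/3 \<Longrightarrow> join3 a b c (x, t) = b (x, 3 * t - 1)"
    "2/3 \<le> t \<Longrightarrow> join3 a b c (x, t) = c (x, 3 * t - 2)"
proof -
  show "t \<le> 1/3 \<Longrightarrow> join3 a b c (x, t) = a (x, 3 * t)" by (simp add: join3_def)
  show "1/3 \<le> t \<Longrightarrow> t \<le> 2/3 \<Longrightarrow> join3 a b c (x, t) = b (x, 3 * t - 1)"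
    using assms by (cases "t = 1/3"; (hypsubst)?) (simp_all add: join3_def)
  show "2/3 \<le> t \<Longrightarrow> join3 a b c (x, t) = c (x, 3 * t - 2)"
    using assms by (cases "t = 2/3"; (hypsubst)?) (simp_all add: join3_def)
qed

lemma join3_image:
  assumes "\<And>t. t \<in> {0..1} \<Longrightarrow> P (a (x, t))" "\<And>t. t \<in> {0..1} \<Longrightarrow> P (b (x, t))"
    "\<And>t. t \<in> {0..1} \<Longrightarrow> P (c (x, t))" "t \<in> {0..1}"
  shows "P (join3 a b c (x, t))"
  using assms by (auto simp: join3_def)

lemma continuous_on_join3:
  fixes K :: "'b::metric_space set"
  assumes "closed K" "continuous_on (K \<times> {0..1}) a" "continuous_on (K \<times> {0..1}) b" "continuous_on (K \<times> {0..1}) c"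
    and ab: "\<And>x. x \<in> K \<Longrightarrow> a (x, 1) = b (x, 0)" and bc: "\<And>x. x \<in> K \<Longrightarrow> b (x, 1) = c (x, 0)"
  shows "continuous_on (K \<times> {0..1}) (join3 a b c)"
proof -
  have 1: "continuous_on (K \<times> {0..1/3}) (join3 a b c)"
  proof (rule continuous_on_eq)
    show "continuous_on (K \<times> {0..1/3}) (\<lambda>z. a (fst z, 3 * snd z))"
      by (rule continuous_on_compose2[OF assms(2)]) (auto intro!: continuous_intros)
  qed (use join3_eqs[where a = a and b = b and c = c] ab bc in auto)
  have 2: "continuous_on (K \<times> {1/3..2/3}) (join3 a b c)"
  proof (rule continuous_on_eq)
    show "continuous_on (K \<times> {1/3..2/3}) (\<lambda>z. b (fst z, 3 * snd z - 1))"
      by (rule continuous_on_compose2[OF assms(3)]) (auto intro!: continuous_intros)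
  qed (use join3_eqs[where a = a and b = b and c = c] ab bc in auto)
  have 3: "continuous_on (K \<times> {2/3..1}) (join3 a b c)"
  proof (rule continuous_on_eq)
    show "continuous_on (K \<times> {2/3..1}) (\<lambda>z. c (fst z, 3 * snd z - 2))"
      by (rule continuous_on_compose2[OF assms(4)]) (auto intro!: continuous_intros)
  qed (use join3_eqs[where a = a and b = b and c = c] ab bc in auto)
  have "continuous_on (K \<times> {0..1/3} \<union> (K \<times> {1/3..2/3} \<union> K \<times> {2/3..1})) (join3 a b c)"
    using assms(1) 1 2 3 by (intro continuous_on_closed_Un closed_Un closed_Times) auto
  moreover have "K \<times> {0..1/3} \<union> (K \<times> {1/3..2/3} \<union> K \<times> {2/3..1}) = K \<times> {0..1::real}" by auto
  ultimately show ?thesis by simp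
qed

text \<open>Heights matter only on the set \<open>C\<close> of points whose image meets the other
  pair. The balls are compact and disjoint, so a height that is constant on each
  \<open>C \<inter> B j\<close> is continuous on \<open>C\<close>. By \<open>ends\<close> this does
  not conflict with the values 0 and 1 prescribed at the two ends, and Tietze extends the whole
  prescription.\<close>

lemma fractured_over_disjoint_heights:
  fixes X :: "'a::metric_space set"
  assumes c1: "category_K X K1 f1 \<tau>1" and c2: "category_K X K2 f2 \<tau>2" and fr: "fractured_over K2 f2 \<tau>2 K1 f1 \<tau>1"
    and ends: "\<And>y e. y \<in> K2 \<Longrightarrow> e \<in> {0, 1} \<Longrightarrow> f2 (y, e) \<notin> f1 ` (K1 \<times> {0..1})"
  obtains \<tau> where "category_K X K2 f2 \<tau>"
    "\<And>z1 z2. z1 \<in> K1 \<times> {0..1} \<Longrightarrow> z2 \<in> K2 \<times> {0..1} \<Longrightarrow> \<tau>1 z1 = \<tau> z2 \<Longrightarrow> f1 z1 \<noteq> f2 z2"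
proof (rule fractured_overE[OF fr])
  fix m :: nat and B and h :: "nat \<Rightarrow> real^2 \<Rightarrow> (real^3) \<times> real"
  assume B: "\<And>j. j < m \<Longrightarrow> B j \<subseteq> K2 \<times> {0..1}" "\<And>j. j < m \<Longrightarrow> \<exists>k. homeomorphism (cball 0 1) (B j) (h j) k"
    and disj: "\<And>i j. i < m \<Longrightarrow> j < m \<Longrightarrow> i \<noteq> j \<Longrightarrow> B i \<inter> B j = {}"
    and sub: "{z \<in> K2 \<times> {0..1}. f2 z \<in> f1 ` (K1 \<times> {0..1})} \<subseteq> (\<Union>j<m. h j ` ball 0 1)"
    and ne: "\<And>j. j < m \<Longrightarrow> \<tau>1 ` {z \<in> K1 \<times> {0..1}. f1 z \<in> f2 ` B j} \<noteq> {0..1}"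
  have K: "finite_1_complex K1" "finite_1_complex K2" using c1 c2 by (auto simp: category_K_def)
  have cK: "compact (K1 \<times> {0..1::real})" "compact (K2 \<times> {0..1::real})" "compact K2"
    using K finite_1_complex_imp_compact by (auto intro: compact_Times)
  define C where "C = {z \<in> K2 \<times> {0..1}. f2 z \<in> f1 ` (K1 \<times> {0..1})}"
  have "compact (f1 ` (K1 \<times> {0..1}))"
    using compact_continuous_image[OF category_KD(1)[OF c1] cK(1)] .
  moreover have "C = f2 -` (f1 ` (K1 \<times> {0..1})) \<inter> K2 \<times> {0..1}" by (auto simp: C_def)
  ultimately have "closed C"
    using continuous_on_closed_vimage[OF compact_imp_closed[OF cK(2)], of f2] category_KD(1)[OF c2] compact_imp_closed
    by metis
  have compB: "compact (B j)" if j: "j < m" for j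
    using B(2)[OF j] compact_continuous_image[OF _ compact_cball] unfolding homeomorphism_def by metis
  have hB: "h j ` ball 0 1 \<subseteq> B j" if j: "j < m" for j
    using B(2)[OF j] ball_subset_cball unfolding homeomorphism_def by blast
  have CB: "\<exists>j<m. z \<in> B j" if "z \<in> C" for z
    using sub that hB unfolding C_def by blast
  \<comment> \<open>A subset of the unit interval that is not all of it misses some
    \<open>t\<close>; this becomes the height of \<open>C \<inter> B j\<close>.\<close>
  have "\<exists>t\<in>{0..1}. \<forall>z\<in>K1 \<times> {0..1}. f1 z \<in> f2 ` B j \<longrightarrow> \<tau>1 z \<noteq> t" if j: "j < m" for j
  proof -
    have "\<tau>1 ` {z \<in> K1 \<times> {0..1}. f1 z \<in> f2 ` B j} \<subseteq> {0..1}"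
      using category_KD(4)[OF c1] by (auto simp: image_subset_iff)
    with ne[OF j] have "\<tau>1 ` {z \<in> K1 \<times> {0..1}. f1 z \<in> f2 ` B j} \<subset> {0..1}" by (rule psubsetI[rotated])
    from psubset_imp_ex_mem[OF this] obtain u
      where "u \<in> {0..1}" "u \<notin> \<tau>1 ` {z \<in> K1 \<times> {0..1}. f1 z \<in> f2 ` B j}"
      by (elim exE DiffE)
    then show ?thesis by (intro bexI[of _ u]) auto
  qed
  then obtain t where t: "\<And>j. j < m \<Longrightarrow> t j \<in> {0..1}"
    "\<And>j z. j < m \<Longrightarrow> z \<in> K1 \<times> {0..1} \<Longrightarrow> f1 z \<in> f2 ` B j \<Longrightarrow> \<tau>1 z \<noteq> t j"
    by metis
  define idx where "idx = (\<lambda>z. SOME j. j < m \<and> z \<in> B j)"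
  have idx: "idx z = j" if "j < m" "z \<in> B j" for z j
    unfolding idx_def using that disj by (intro some_equality) blast+
  define \<psi> where "\<psi> = (\<lambda>z. if z \<in> C then t (idx z) else snd z)"
  let ?E = "K2 \<times> {0} \<union> K2 \<times> {1::real}"
  have CE: "?E \<inter> C = {}" using ends unfolding C_def by auto
  have "closed ?E" using cK(3) compact_imp_closed by (intro closed_Un closed_Times) auto
  have "continuous_on ?E \<psi>"
    by (rule continuous_on_eq[of _ snd]) (use CE in \<open>auto simp: \<psi>_def intro!: continuous_intros\<close>)
  moreover have "continuous_on (\<Union>j\<in>{..<m}. C \<inter> B j) \<psi>"
  proof (rule continuous_on_closed_Union)
    show "closed (C \<inter> B j)" if "j \<in> {..<m}" for j
      using \<open>closed C\<close> compB compact_imp_closed that by (intro closed_Int) auto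
    show "continuous_on (C \<inter> B j) \<psi>" if "j \<in> {..<m}" for j
      by (rule continuous_on_eq[of _ "\<lambda>_. t j"]) (use idx that in \<open>auto simp: \<psi>_def\<close>)
  qed simp
  moreover have "(\<Union>j\<in>{..<m}. C \<inter> B j) = C" using CB by blast
  ultimately have "continuous_on ?E \<psi>" "continuous_on C \<psi>" by simp_all
  then have "continuous_on (?E \<union> C) \<psi>"
    by (rule continuous_on_closed_Un[OF \<open>closed ?E\<close> \<open>closed C\<close>])
  moreover have "closedin (top_of_set UNIV) (?E \<union> C)"
    using \<open>closed C\<close> \<open>closed ?E\<close> by auto
  moreover have "\<psi> z \<in> cbox 0 1" if "z \<in> ?E \<union> C" for z
  proof (cases "z \<in> C")
    case True
    then obtain j where "j < m" "z \<in> B j" using CB by blast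
    then show ?thesis using t(1)[of j] idx[of j z] True by (simp add: \<psi>_def mem_box_real)
  next
    case False
    then show ?thesis using that by (auto simp: \<psi>_def mem_box_real)
  qed
  ultimately obtain \<tau> where \<tau>: "continuous_on UNIV \<tau>" "\<And>z. z \<in> ?E \<union> C \<Longrightarrow> \<tau> z = \<psi> z" "\<And>z. z \<in> UNIV \<Longrightarrow> \<tau> z \<in> cbox 0 1"
    using Tietze_closed_interval_1[of "?E \<union> C" \<psi> UNIV 0 1] by (metis zero_le_one)
  show ?thesis
  proof (rule that)
    have "\<tau> (y, 0) = 0 \<and> \<tau> (y, 1) = 1" if "y \<in> K2" for y
    proof -
      have "(y, 0) \<notin> C" "(y, 1) \<notin> C" using CE that by blast+
      then show ?thesis using that \<tau>(2)[of "(y, 0)"] \<tau>(2)[of "(y, 1)"] by (simp add: \<psi>_def)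
    qed
    then show "category_K X K2 f2 \<tau>"
      using K(2) category_KD(1,2)[OF c2] \<tau>(3) continuous_on_subset[OF \<tau>(1)]
      unfolding category_K_def topographical_map_pair_def by (auto simp: mem_box_real)
    show "f1 z1 \<noteq> f2 z2" if z: "z1 \<in> K1 \<times> {0..1}" "z2 \<in> K2 \<times> {0..1}" and eq: "\<tau>1 z1 = \<tau> z2" for z1 z2
    proof
      assume f: "f1 z1 = f2 z2"
      then have "f2 z2 \<in> f1 ` (K1 \<times> {0..1})" using z(1) by (metis imageI)
      then have C: "z2 \<in> C" using z unfolding C_def by simp
      then obtain j where j: "j < m" "z2 \<in> B j" using CB by blast
      then have "\<tau> z2 = t j" using \<tau>(2) C idx by (simp add: \<psi>_def)
      moreover have "f1 z1 \<in> f2 ` B j" using f j(2) by simp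
      ultimately show False using t(2)[OF j(1) z(1)] eq by simp
    qed
  qed
qed

text \<open>The pair is squeezed into the middle third, and the outer thirds carry short paths
  joining it to \<open>q0\<close> and \<open>q1\<close>. The new height is the identity on the outer
  thirds and \<open>(1 + \<tau>) / 3\<close> in the middle, so each third of a vertical line keeps
  its own band of heights: two pairs treated in this way can be at equal height only within
  corresponding thirds.\<close>

lemma category_K_collar:
  fixes X :: "'a::metric_space set"
  assumes c: "category_K X K f \<tau>" and q: "continuous_on K q0" "continuous_on K q1" "q0 ` K \<subseteq> C" "q1 ` K \<subseteq> C"
    and near: "\<And>x. x \<in> K \<Longrightarrow> dist (q0 x) (f (x, 0)) < \<delta>" "\<And>x. x \<in> K \<Longrightarrow> dist (q1 x) (f (x, 1)) < \<delta>"
    and lam: "continuous_on {(x, y, t). x \<in> C \<and> y \<in> X \<and> dist x y < \<delta> \<and> t \<in> {0..1::real}} (\<lambda>(x, y, t). lam x y t)"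
    "\<And>x y t. x \<in> C \<Longrightarrow> y \<in> X \<Longrightarrow> dist x y < \<delta> \<Longrightarrow> t \<in> {0..1} \<Longrightarrow> lam x y t \<in> X \<and> dist (lam x y t) x < \<epsilon>"
    "\<And>x y. x \<in> C \<Longrightarrow> y \<in> X \<Longrightarrow> lam x y 0 = x" "\<And>x y. x \<in> C \<Longrightarrow> y \<in> X \<Longrightarrow> lam x y 1 = y"
  shows "\<exists>F T. category_K X K F T \<and> (\<forall>x\<in>K. F (x, 0) = q0 x \<and> F (x, 1) = q1 x \<and> (\<forall>t.
      (0 \<le> t \<and> t \<le> 1/3 \<longrightarrow> T (x, t) = t \<and> dist (F (x, t)) (q0 x) < \<epsilon>) \<and>
      (1/3 \<le> t \<and> t \<le> 2/3 \<longrightarrow> T (x, t) = (1 + \<tau> (x, 3 * t - 1)) / 3 \<and> F (x, t) = f (x, 3 * t - 1)) \<and>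
      (2/3 \<le> t \<and> t \<le> 1 \<longrightarrow> T (x, t) = t \<and> dist (F (x, t)) (q1 x) < \<epsilon>)))"
proof -
  have K: "finite_1_complex K" using c by (simp add: category_K_def)
  then have clK: "closed K" using finite_1_complex_imp_compact compact_imp_closed by blast
  define a where "a = (\<lambda>(x, t). lam (q0 x) (f (x, 0)) t)"
  define b where "b = (\<lambda>(x, t). lam (q1 x) (f (x, 1)) (1 - t))"
  define F where "F = join3 a f b"
  define T where "T = join3 (\<lambda>z. snd z / 3) (\<lambda>z. (1 + \<tau> z) / 3) (\<lambda>z. (2 + snd z) / 3)"
  have f01: "f (x, 0) \<in> X" "f (x, 1) \<in> X" if "x \<in> K" for x
    using category_KD(2)[OF c] that by auto
  have qC: "q0 x \<in> C" "q1 x \<in> C" if "x \<in> K" for x using q(3,4) that by auto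
  have fst0: "continuous_on (K \<times> {0..1::real}) (\<lambda>z. p (fst z))" if "continuous_on K p" for p :: "real^3 \<Rightarrow> 'a"
    by (intro continuous_on_compose2[OF that] continuous_intros) auto
  have "continuous_on (K \<times> {0..1}) (\<lambda>z. (\<lambda>(x, y, t). lam x y t) (q0 (fst z), f (fst z, 0), snd z))"
    by (rule continuous_on_compose2[OF lam(1)])
      (use near(1) f01 qC in \<open>auto intro!: continuous_on_Pair fst0 q(1) category_K_slice[OF c] continuous_on_snd continuous_on_id\<close>)
  then have ca: "continuous_on (K \<times> {0..1}) a"
    by (rule continuous_on_eq) (auto simp: a_def)
  have "continuous_on (K \<times> {0..1}) (\<lambda>z. (\<lambda>(x, y, t). lam x y t) (q1 (fst z), f (fst z, 1), 1 - snd z))"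
    by (rule continuous_on_compose2[OF lam(1)])
      (use near(2) f01 qC in \<open>auto intro!: continuous_on_Pair fst0 q(2) category_K_slice[OF c] continuous_on_snd continuous_on_id continuous_on_diff continuous_on_const\<close>)
  then have cb: "continuous_on (K \<times> {0..1}) b"
    by (rule continuous_on_eq) (auto simp: b_def)
  have m: "a (x, 1) = f (x, 0)" "f (x, 1) = b (x, 0)" if "x \<in> K" for x
    using that f01 qC lam(4) by (auto simp: a_def b_def)
  have ab: "a (x, t) \<in> X" "dist (a (x, t)) (q0 x) < \<epsilon>" "b (x, t) \<in> X" "dist (b (x, t)) (q1 x) < \<epsilon>"
    if "x \<in> K" "t \<in> {0..1}" for x t
    using lam(2)[of "q0 x" "f (x, 0)" t] lam(2)[of "q1 x" "f (x, 1)" "1 - t"] that f01 qC near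
    by (auto simp: a_def b_def)
  have \<tau>01: "\<tau> (x, 0) = 0" "\<tau> (x, 1) = 1" if "x \<in> K" for x
    using category_KD(5,6)[OF c] that by auto
  have \<tau>I: "\<tau> (x, t) \<in> {0..1}" if "x \<in> K" "t \<in> {0..1}" for x t
    using category_KD(4)[OF c] that by (auto simp: image_subset_iff)
  note Feq = join3_eqs[of a _ f b, OF m, folded F_def]
  have Teq: "t \<le> 1/3 \<Longrightarrow> T (x, t) = t" "1/3 \<le> t \<Longrightarrow> t \<le> 2/3 \<Longrightarrow> T (x, t) = (1 + \<tau> (x, 3 * t - 1)) / 3"
    "2/3 \<le> t \<Longrightarrow> T (x, t) = t" if "x \<in> K" for x t
    using join3_eqs[of "\<lambda>z. snd z / 3" x "\<lambda>z. (1 + \<tau> z) / 3" "\<lambda>z. (2 + snd z) / 3" t] \<tau>01[OF that]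
    unfolding T_def by simp_all
  have cF: "continuous_on (K \<times> {0..1}) F"
    unfolding F_def using continuous_on_join3[OF clK ca category_KD(1)[OF c] cb] m by simp
  have cT: "continuous_on (K \<times> {0..1}) T"
    unfolding T_def using \<tau>01
    by (intro continuous_on_join3[OF clK]) (auto intro!: continuous_intros category_KD(3)[OF c])
  have "F (x, t) \<in> X" if "x \<in> K" "t \<in> {0..1}" for x t
    unfolding F_def
    by (rule join3_image[where P = "\<lambda>u. u \<in> X"]) (use that ab category_KD(2)[OF c] in auto)
  moreover have "T (x, t) \<in> {0..1}" if "x \<in> K" "t \<in> {0..1}" for x t
    unfolding T_def
    by (rule join3_image[where P = "\<lambda>u. u \<in> {0..1}"]) (use that \<tau>I in force)+
  ultimately have "category_K X K F T"
    using K cF cT Teq[of _ 0] Teq[of _ 1] unfolding category_K_def topographical_map_pair_def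
    by (auto simp: image_subset_iff)
  moreover have "F (x, 0) = q0 x" "F (x, 1) = q1 x" if "x \<in> K" for x
    using Feq(1)[of x 0] Feq(3)[of x 1] that lam(3) f01[OF that] qC[OF that] by (auto simp: a_def b_def)
  moreover have "T (x, t) = t \<and> dist (F (x, t)) (q0 x) < \<epsilon>" if "x \<in> K" "0 \<le> t \<and> t \<le> 1/3" for x t
    using Feq(1)[of x t] Teq(1)[of x t] that ab(2)[of x "3 * t"] by auto
  moreover have "T (x, t) = (1 + \<tau> (x, 3 * t - 1)) / 3 \<and> F (x, t) = f (x, 3 * t - 1)"
    if "x \<in> K" "1/3 \<le> t \<and> t \<le> 2/3" for x t
    using Feq(2)[of x t] Teq(2)[of x t] that by auto
  moreover have "T (x, t) = t \<and> dist (F (x, t)) (q1 x) < \<epsilon>" if "x \<in> K" "2/3 \<le> t \<and> t \<le> 1" for x t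
    using Feq(3)[of x t] Teq(3)[of x t] that ab(4)[of x "3 * t - 2"] by auto
  ultimately show ?thesis
    by (intro exI[of _ F] exI[of _ T] conjI ballI allI impI; simp)
qed

text \<open>\<open>F2\<close> is required to be close only to some point on the same vertical line,
  as collars reparametrise the time. The last clause amounts to disjoint images of
  \<open>(F1, T1)\<close> and \<open>(F2, T2)\<close> in the product with the line.\<close>

definition separated_slab ::
    "'a::metric_space set \<Rightarrow> (real^3) set \<Rightarrow> (real^3 \<Rightarrow> 'a) \<Rightarrow> (real^3) set \<Rightarrow> ((real^3) \<times> real \<Rightarrow> 'a) \<Rightarrow> real \<Rightarrow>
     ((real^3) \<times> real \<Rightarrow> 'a) \<Rightarrow> ((real^3) \<times> real \<Rightarrow> real) \<Rightarrow>
     ((real^3) \<times> real \<Rightarrow> 'a) \<Rightarrow> ((real^3) \<times> real \<Rightarrow> real) \<Rightarrow> bool" where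
  "separated_slab X K1 f1 K2 f2 \<epsilon> F1 T1 F2 T2 \<longleftrightarrow>
    category_K X K1 F1 T1 \<and> category_K X K2 F2 T2 \<and>
    (\<forall>x\<in>K1. F1 (x, 0) = f1 x \<and> F1 (x, 1) = f1 x \<and> (\<forall>t\<in>{0..1}. dist (F1 (x, t)) (f1 x) < \<epsilon>)) \<and>
    (\<forall>y\<in>K2. F2 (y, 0) = f2 (y, 0) \<and> F2 (y, 1) = f2 (y, 1) \<and>
      (\<forall>t\<in>{0..1}. \<exists>s\<in>{0..1}. dist (F2 (y, t)) (f2 (y, s)) < \<epsilon>)) \<and>
    (\<forall>x\<in>K1. \<forall>y\<in>K2. \<forall>s\<in>{0..1}. \<forall>t\<in>{0..1}. T1 (x, s) = T2 (y, t) \<longrightarrow> F1 (x, s) \<noteq> F2 (y, t))"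

text \<open>Compactness turns \<open>ends\<close> into a gap \<open>d\<close>. In the outer thirds
  the collars stay within \<open>d / 2\<close> of the original end values, hence apart; in the
  middle third the heights from \<open>fractured_over_disjoint_heights\<close> separate the
  approximations.\<close>

lemma fuzzy_ribbons_slab:
  fixes X :: "'a::metric_space set" and f2 :: "(real^3) \<times> real \<Rightarrow> 'a"
  assumes ANR: "metrizable_ANR (top_of_set X)" and fuzzy: "fuzzy_ribbons_property X"
    and K1: "finite_1_complex K1" and f1: "continuous_on K1 f1" "f1 ` K1 \<subseteq> X"
    and K2: "finite_1_complex K2" and f2: "continuous_on (K2 \<times> {0..1}) f2" "f2 ` (K2 \<times> {0..1}) \<subseteq> X"
    and ends: "\<And>x y e. x \<in> K1 \<Longrightarrow> y \<in> K2 \<Longrightarrow> e \<in> {0, 1} \<Longrightarrow> f1 x \<noteq> f2 (y, e)" and "\<epsilon> > 0"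
  shows "\<exists>F1 T1 F2 T2. separated_slab X K1 f1 K2 f2 \<epsilon> F1 T1 F2 T2"
proof -
  have cK: "compact K1" "compact (K2 \<times> {0..1::real})" "compact (K2 \<times> {0, 1::real})"
    using K1 K2 finite_1_complex_imp_compact by (auto intro: compact_Times)
  define C where "C = f1 ` K1 \<union> f2 ` (K2 \<times> {0..1})"
  have C: "compact C" "C \<subseteq> X"
    unfolding C_def using compact_Un[OF compact_continuous_image[OF f1(1) cK(1)] compact_continuous_image[OF f2(1) cK(2)]] f1(2) f2(2)
    by simp_all
  have "compact (f1 ` K1)" "compact (f2 ` (K2 \<times> {0, 1}))"
    by (intro compact_continuous_image cK f1(1) continuous_on_subset[OF f2(1)]; auto)+
  moreover have "f1 ` K1 \<inter> f2 ` (K2 \<times> {0, 1}) = {}" using ends by blast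
  ultimately obtain d where d: "d > 0" "\<And>x y. x \<in> f1 ` K1 \<Longrightarrow> y \<in> f2 ` (K2 \<times> {0, 1}) \<Longrightarrow> d \<le> dist x y"
    using compact_disjoint_dist_pos by metis
  have sep: "u \<noteq> v" if "x \<in> K1" "y \<in> K2" "e \<in> {0, 1}" "dist u (f1 x) < d / 2" "dist v (f2 (y, e)) < d / 2" for u v x y e
  proof
    assume "u = v"
    then have "dist (f1 x) (f2 (y, e)) < d"
      using dist_triangle_half_r[of u "f1 x" d "f2 (y, e)"] that(4,5) by simp
    moreover have "d \<le> dist (f1 x) (f2 (y, e))" using d(2) that(1-3) by blast
    ultimately show False by simp
  qed
  define \<epsilon>' where "\<epsilon>' = min \<epsilon> (d / 2)"
  have \<epsilon>': "\<epsilon>' > 0" "\<epsilon>' \<le> \<epsilon>" "\<epsilon>' \<le> d / 2" using d(1) \<open>\<epsilon> > 0\<close> by (auto simp: \<epsilon>'_def)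
  obtain \<delta> lam where \<delta>: "\<delta> > 0" and
    lam: "continuous_on {(x, y, t). x \<in> C \<and> y \<in> X \<and> dist x y < \<delta> \<and> t \<in> {0..1::real}} (\<lambda>(x, y, t). lam x y t)"
    "\<And>x y t. x \<in> C \<Longrightarrow> y \<in> X \<Longrightarrow> dist x y < \<delta> \<Longrightarrow> t \<in> {0..1} \<Longrightarrow> lam x y t \<in> X \<and> dist (lam x y t) x < \<epsilon>'"
    "\<And>x y. x \<in> C \<Longrightarrow> y \<in> X \<Longrightarrow> lam x y 0 = x" "\<And>x y. x \<in> C \<Longrightarrow> y \<in> X \<Longrightarrow> lam x y 1 = y"
    using that by (rule ANR_short_paths[OF ANR C \<epsilon>'(1)])
  have \<epsilon>\<delta>: "min \<epsilon>' \<delta> > 0" using \<epsilon>' \<delta> by simp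
  obtain a1 \<tau>1 a2 \<tau> where a: "category_K X K1 a1 \<tau>1" "category_K X K2 a2 \<tau>"
    "\<And>x t. x \<in> K1 \<Longrightarrow> t \<in> {0..1} \<Longrightarrow> dist (a1 (x, t)) (f1 x) < min \<epsilon>' \<delta>"
    "\<And>z. z \<in> K2 \<times> {0..1} \<Longrightarrow> dist (a2 z) (f2 z) < min \<epsilon>' \<delta>"
    "fractured_over K2 a2 \<tau> K1 a1 \<tau>1"
    using that by (rule fuzzy_ribbonsE[OF fuzzy K1 f1 K2 f2 \<epsilon>\<delta>])
  \<comment> \<open>The whole homotopy \<open>a1\<close>, and not merely its ends, stays within
    \<open>d / 2\<close> of \<open>f1\<close>, because the first pair starts as a constant
    homotopy.\<close>
  have "a2 (y, e) \<notin> a1 ` (K1 \<times> {0..1})" if y: "y \<in> K2" and e: "e \<in> {0, 1}" for y e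
  proof
    assume "a2 (y, e) \<in> a1 ` (K1 \<times> {0..1})"
    then obtain x t where xt: "x \<in> K1" "t \<in> {0..1}" "a1 (x, t) = a2 (y, e)" by (auto dest: sym)
    have "(y, e) \<in> K2 \<times> {0..1}" using y e by auto
    then show False using sep[OF xt(1) y e, of "a1 (x, t)" "a2 (y, e)"] a(3)[OF xt(1,2)] a(4) xt(3) \<epsilon>'(3) by fastforce
  qed
  then obtain \<tau>2 where \<tau>2: "category_K X K2 a2 \<tau>2"
    "\<And>z1 z2. z1 \<in> K1 \<times> {0..1} \<Longrightarrow> z2 \<in> K2 \<times> {0..1} \<Longrightarrow> \<tau>1 z1 = \<tau>2 z2 \<Longrightarrow> a1 z1 \<noteq> a2 z2"
    using fractured_over_disjoint_heights[OF a(1,2,5)] by blast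
  have n1: "dist (f1 x) (a1 (x, e)) < \<delta>" if "x \<in> K1" "e \<in> {0, 1}" for x e
    using a(3)[OF that(1), of e] that(2) by (auto simp: dist_commute)
  have n2: "dist (f2 (y, e)) (a2 (y, e)) < \<delta>" if "y \<in> K2" "e \<in> {0, 1}" for y e
    using a(4)[of "(y, e)"] that by (auto simp: dist_commute)
  have f1C: "f1 ` K1 \<subseteq> C" and f20: "(\<lambda>y. f2 (y, 0)) ` K2 \<subseteq> C" "(\<lambda>y. f2 (y, 1)) ` K2 \<subseteq> C"
    by (auto simp: C_def)
  have f2c: "continuous_on K2 (\<lambda>y. f2 (y, 0))" "continuous_on K2 (\<lambda>y. f2 (y, 1))"
    by (intro continuous_on_compose2[OF f2(1)] continuous_intros; auto)+
  have n1': "\<And>x. x \<in> K1 \<Longrightarrow> dist (f1 x) (a1 (x, 0)) < \<delta>" "\<And>x. x \<in> K1 \<Longrightarrow> dist (f1 x) (a1 (x, 1)) < \<delta>"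
    and n2': "\<And>y. y \<in> K2 \<Longrightarrow> dist (f2 (y, 0)) (a2 (y, 0)) < \<delta>" "\<And>y. y \<in> K2 \<Longrightarrow> dist (f2 (y, 1)) (a2 (y, 1)) < \<delta>"
    using n1 n2 by simp_all
  have "\<exists>F1 T1. category_K X K1 F1 T1 \<and> (\<forall>x\<in>K1. F1 (x, 0) = f1 x \<and> F1 (x, 1) = f1 x \<and> (\<forall>t.
      (0 \<le> t \<and> t \<le> 1/3 \<longrightarrow> T1 (x, t) = t \<and> dist (F1 (x, t)) (f1 x) < \<epsilon>') \<and>
      (1/3 \<le> t \<and> t \<le> 2/3 \<longrightarrow> T1 (x, t) = (1 + \<tau>1 (x, 3 * t - 1)) / 3 \<and> F1 (x, t) = a1 (x, 3 * t - 1)) \<and>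
      (2/3 \<le> t \<and> t \<le> 1 \<longrightarrow> T1 (x, t) = t \<and> dist (F1 (x, t)) (f1 x) < \<epsilon>')))"
    by (rule category_K_collar[OF a(1) f1(1) f1(1) f1C f1C n1' lam])
  then obtain F1 T1 where *: "category_K X K1 F1 T1 \<and> (\<forall>x\<in>K1. F1 (x, 0) = f1 x \<and> F1 (x, 1) = f1 x \<and> (\<forall>t.
      (0 \<le> t \<and> t \<le> 1/3 \<longrightarrow> T1 (x, t) = t \<and> dist (F1 (x, t)) (f1 x) < \<epsilon>') \<and>
      (1/3 \<le> t \<and> t \<le> 2/3 \<longrightarrow> T1 (x, t) = (1 + \<tau>1 (x, 3 * t - 1)) / 3 \<and> F1 (x, t) = a1 (x, 3 * t - 1)) \<and>
      (2/3 \<le> t \<and> t \<le> 1 \<longrightarrow> T1 (x, t) = t \<and> dist (F1 (x, t)) (f1 x) < \<epsilon>')))"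
    by (elim exE)
  have F1: "category_K X K1 F1 T1" "\<And>x. x \<in> K1 \<Longrightarrow> F1 (x, 0) = f1 x" "\<And>x. x \<in> K1 \<Longrightarrow> F1 (x, 1) = f1 x"
    "\<And>x t. x \<in> K1 \<Longrightarrow> 0 \<le> t \<Longrightarrow> t \<le> 1/3 \<Longrightarrow> T1 (x, t) = t \<and> dist (F1 (x, t)) (f1 x) < \<epsilon>'"
    "\<And>x t. x \<in> K1 \<Longrightarrow> 1/3 \<le> t \<Longrightarrow> t \<le> 2/3 \<Longrightarrow> T1 (x, t) = (1 + \<tau>1 (x, 3 * t - 1)) / 3 \<and> F1 (x, t) = a1 (x, 3 * t - 1)"
    "\<And>x t. x \<in> K1 \<Longrightarrow> 2/3 \<le> t \<Longrightarrow> t \<le> 1 \<Longrightarrow> T1 (x, t) = t \<and> dist (F1 (x, t)) (f1 x) < \<epsilon>'"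
    using * by simp_all
  have "\<exists>F2 T2. category_K X K2 F2 T2 \<and> (\<forall>y\<in>K2. F2 (y, 0) = f2 (y, 0) \<and> F2 (y, 1) = f2 (y, 1) \<and> (\<forall>t.
      (0 \<le> t \<and> t \<le> 1/3 \<longrightarrow> T2 (y, t) = t \<and> dist (F2 (y, t)) (f2 (y, 0)) < \<epsilon>') \<and>
      (1/3 \<le> t \<and> t \<le> 2/3 \<longrightarrow> T2 (y, t) = (1 + \<tau>2 (y, 3 * t - 1)) / 3 \<and> F2 (y, t) = a2 (y, 3 * t - 1)) \<and>
      (2/3 \<le> t \<and> t \<le> 1 \<longrightarrow> T2 (y, t) = t \<and> dist (F2 (y, t)) (f2 (y, 1)) < \<epsilon>')))"
    by (rule category_K_collar[OF \<tau>2(1) f2c f20 n2' lam])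
  then obtain F2 T2 where *: "category_K X K2 F2 T2 \<and> (\<forall>y\<in>K2. F2 (y, 0) = f2 (y, 0) \<and> F2 (y, 1) = f2 (y, 1) \<and> (\<forall>t.
      (0 \<le> t \<and> t \<le> 1/3 \<longrightarrow> T2 (y, t) = t \<and> dist (F2 (y, t)) (f2 (y, 0)) < \<epsilon>') \<and>
      (1/3 \<le> t \<and> t \<le> 2/3 \<longrightarrow> T2 (y, t) = (1 + \<tau>2 (y, 3 * t - 1)) / 3 \<and> F2 (y, t) = a2 (y, 3 * t - 1)) \<and>
      (2/3 \<le> t \<and> t \<le> 1 \<longrightarrow> T2 (y, t) = t \<and> dist (F2 (y, t)) (f2 (y, 1)) < \<epsilon>')))"
    by (elim exE)
  have F2: "category_K X K2 F2 T2" "\<And>y. y \<in> K2 \<Longrightarrow> F2 (y, 0) = f2 (y, 0)" "\<And>y. y \<in> K2 \<Longrightarrow> F2 (y, 1) = f2 (y, 1)"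
    "\<And>y t. y \<in> K2 \<Longrightarrow> 0 \<le> t \<Longrightarrow> t \<le> 1/3 \<Longrightarrow> T2 (y, t) = t \<and> dist (F2 (y, t)) (f2 (y, 0)) < \<epsilon>'"
    "\<And>y t. y \<in> K2 \<Longrightarrow> 1/3 \<le> t \<Longrightarrow> t \<le> 2/3 \<Longrightarrow> T2 (y, t) = (1 + \<tau>2 (y, 3 * t - 1)) / 3 \<and> F2 (y, t) = a2 (y, 3 * t - 1)"
    "\<And>y t. y \<in> K2 \<Longrightarrow> 2/3 \<le> t \<Longrightarrow> t \<le> 1 \<Longrightarrow> T2 (y, t) = t \<and> dist (F2 (y, t)) (f2 (y, 1)) < \<epsilon>'"
    using * by simp_all
  have \<tau>I: "\<tau>1 (x, t) \<in> {0..1}" "\<tau>2 (y, t) \<in> {0..1}" if "x \<in> K1" "y \<in> K2" "t \<in> {0..1}" for x y t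
    using category_KD(4)[OF a(1)] category_KD(4)[OF \<tau>2(1)] that by (auto simp: image_subset_iff)
  show ?thesis
    unfolding separated_slab_def
  proof (rule exI[of _ F1], rule exI[of _ T1], rule exI[of _ F2], rule exI[of _ T2], intro conjI ballI impI)
    show "dist (F1 (x, t)) (f1 x) < \<epsilon>" if "x \<in> K1" "t \<in> {0..1}" for x t
    proof -
      consider "t \<le> 1/3" | "1/3 \<le> t" "t \<le> 2/3" | "2/3 \<le> t" by linarith
      then have "dist (F1 (x, t)) (f1 x) < \<epsilon>'"
        using F1(4-6)[OF that(1), of t] a(3)[OF that(1), of "3 * t - 1"] that(2) by cases auto
      then show ?thesis using \<epsilon>'(2) by simp
    qed
    show "\<exists>s\<in>{0..1}. dist (F2 (y, t)) (f2 (y, s)) < \<epsilon>" if "y \<in> K2" "t \<in> {0..1}" for y t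
    proof -
      consider "t \<le> 1/3" | "1/3 \<le> t" "t \<le> 2/3" | "2/3 \<le> t" by linarith
      then have "\<exists>s\<in>{0..1}. dist (F2 (y, t)) (f2 (y, s)) < \<epsilon>'"
      proof cases
        case 1 then show ?thesis using F2(4)[OF that(1), of t] that(2) by (intro bexI[of _ 0]) auto
      next
        case 2 then show ?thesis using F2(5)[OF that(1), of t] a(4)[of "(y, 3 * t - 1)"] that
          by (intro bexI[of _ "3 * t - 1"]) auto
      next
        case 3 then show ?thesis using F2(6)[OF that(1), of t] that(2) by (intro bexI[of _ 1]) auto
      qed
      then show ?thesis using \<epsilon>'(2) by force
    qed
    fix x y s t
    assume xy: "x \<in> K1" "y \<in> K2" "s \<in> {0..1}" "t \<in> {0..1}" and eq: "T1 (x, s) = T2 (y, t)"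
    have T1: "T1 (x, s) \<in> {1/3..2/3}" if "1/3 \<le> s" "s \<le> 2/3"
      using F1(5)[OF xy(1) that] \<tau>I(1)[OF xy(1,2), of "3 * s - 1"] that by auto
    have T2: "T2 (y, t) \<in> {1/3..2/3}" if "1/3 \<le> t" "t \<le> 2/3"
      using F2(5)[OF xy(2) that] \<tau>I(2)[OF xy(1,2), of "3 * t - 1"] that by auto
    \<comment> \<open>The height reveals the third in which the parameter lies, so equal heights
      leave only three cases.\<close>
    have T1': "(T1 (x, s) < 1/3 \<longleftrightarrow> s < 1/3) \<and> (2/3 < T1 (x, s) \<longleftrightarrow> 2/3 < s)"
    proof -
      consider "s < 1/3" | "1/3 \<le> s" "s \<le> 2/3" | "2/3 < s" by linarith
      then show ?thesis using T1 F1(4,6)[OF xy(1), of s] xy(3) by cases auto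
    qed
    have T2': "(T2 (y, t) < 1/3 \<longleftrightarrow> t < 1/3) \<and> (2/3 < T2 (y, t) \<longleftrightarrow> 2/3 < t)"
    proof -
      consider "t < 1/3" | "1/3 \<le> t" "t \<le> 2/3" | "2/3 < t" by linarith
      then show ?thesis using T2 F2(4,6)[OF xy(2), of t] xy(4) by cases auto
    qed
    have "s < 1/3 \<longleftrightarrow> t < 1/3" "2/3 < s \<longleftrightarrow> 2/3 < t" using T1' T2' eq by simp_all
    then consider "s < 1/3" "t < 1/3" | "2/3 < s" "2/3 < t" | "1/3 \<le> s" "s \<le> 2/3" "1/3 \<le> t" "t \<le> 2/3"
      by linarith
    then show "F1 (x, s) \<noteq> F2 (y, t)"
    proof cases
      case 1
      then show ?thesis
        using F1(4)[OF xy(1), of s] F2(4)[OF xy(2), of t] xy \<epsilon>'(3) sep[OF xy(1,2), of 0] by auto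
    next
      case 2
      then show ?thesis
        using F1(6)[OF xy(1), of s] F2(6)[OF xy(2), of t] xy \<epsilon>'(3) sep[OF xy(1,2), of 1] by auto
    next
      case 3
      then show ?thesis
        using F1(5)[OF xy(1), of s] F2(5)[OF xy(2), of t] xy eq \<tau>2(2)[of "(x, 3 * s - 1)" "(y, 3 * t - 1)"] by auto
    qed
  qed (use F1 F2 in auto)
qed

subsection \<open>Staircase discs\<close>

text \<open>A continuous map from a compact space to a Hausdorff space is closed, hence a quotient
  map onto its image.\<close>

lemma continuous_on_compact_quotient:
  fixes q :: "'a::topological_space \<Rightarrow> 'b::t2_space" and \<psi> :: "'a \<Rightarrow> 'c::topological_space"
  assumes P: "compact P" and q: "continuous_on P q" and \<psi>: "continuous_on P \<psi>"
    and eq: "\<And>p p'. p \<in> P \<Longrightarrow> p' \<in> P \<Longrightarrow> q p = q p' \<Longrightarrow> \<psi> p = \<psi> p'"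
  obtains \<phi> where "continuous_on (q ` P) \<phi>" "\<And>p. p \<in> P \<Longrightarrow> \<phi> (q p) = \<psi> p"
proof -
  define \<phi> where "\<phi> = (\<lambda>x. \<psi> (SOME p. p \<in> P \<and> q p = x))"
  have \<phi>: "\<phi> (q p) = \<psi> p" if "p \<in> P" for p
  proof -
    have "(SOME p'. p' \<in> P \<and> q p' = q p) \<in> P \<and> q (SOME p'. p' \<in> P \<and> q p' = q p) = q p"
      by (rule someI[of _ p]) (use that in simp)
    then show ?thesis using eq that unfolding \<phi>_def by blast
  qed
  have "continuous_on (q ` P) \<phi>"
    unfolding continuous_on_closed_invariant
  proof (intro allI impI)
    fix B :: "'c set" assume "closed B"
    then obtain A where A: "closed A" "A \<inter> P = \<psi> -` B \<inter> P"
      using \<psi> unfolding continuous_on_closed_invariant by blast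
    have "compact (q ` (P \<inter> A))"
      using P A(1) q by (intro compact_continuous_image compact_Int_closed continuous_on_subset[OF q]) auto
    moreover have "q ` (P \<inter> A) \<inter> q ` P = \<phi> -` B \<inter> q ` P"
      using A(2) \<phi> by auto
    ultimately show "\<exists>A. closed A \<and> A \<inter> q ` P = \<phi> -` B \<inter> q ` P"
      using compact_imp_closed by blast
  qed
  then show ?thesis using \<phi> that by blast
qed

text \<open>A ray from \<open>c\<close> meets the relative frontier only once: with
  \<open>s < t\<close> the point \<open>u\<close> would coincide with \<open>c\<close> or lie
  strictly between \<open>c\<close> and \<open>v\<close>, hence in the relative interior.\<close>

lemma cone_coordinates_unique:
  fixes D :: "'a::euclidean_space set"
  assumes D: "convex D" "compact D" "c \<in> rel_interior D"
    and u: "u \<in> rel_frontier D" "u' \<in> rel_frontier D" and s: "s \<in> {0..1}" "s' \<in> {0..1}"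
    and eq: "(1 - s) *\<^sub>R u + s *\<^sub>R c = (1 - s') *\<^sub>R u' + s' *\<^sub>R c"
  shows "s = s' \<and> (s = 1 \<or> u = u')"
proof -
  have *: False if uv: "u \<in> rel_frontier D" "v \<in> rel_frontier D" and st: "s < t" "s \<in> {0..1}" "t \<in> {0..1}"
    and eq: "(1 - s) *\<^sub>R u + s *\<^sub>R c = (1 - t) *\<^sub>R v + t *\<^sub>R c" for u v s t
  proof -
    define k where "k = (1 - t) / (1 - s)"
    have k: "0 \<le> k" "k < 1" using st by (auto simp: k_def)
    have "(1 - s) *\<^sub>R (u - c) = (1 - t) *\<^sub>R (v - c)" using eq by (simp add: algebra_simps)
    then have "(1 - s) *\<^sub>R (u - c) = (1 - s) *\<^sub>R (k *\<^sub>R (v - c))"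
      using st by (simp add: k_def)
    then have "u - c = k *\<^sub>R (v - c)"
      using st unfolding scaleR_cancel_left by simp
    then have uk: "u = (1 - k) *\<^sub>R c + k *\<^sub>R v" by (simp add: algebra_simps)
    have "v \<in> closure D" "u \<notin> rel_interior D" using uv by (auto simp: rel_frontier_def)
    have "c \<noteq> v" using uv(2) D(3) by (auto simp: rel_frontier_def)
    have "u \<in> rel_interior D"
    proof (cases "k = 0")
      case False
      then have "u \<in> open_segment c v"
        using uk k \<open>c \<noteq> v\<close> unfolding in_segment by (intro conjI exI[of _ k]) auto
      then show ?thesis
        using rel_interior_closure_convex_segment[OF D(1,3) \<open>v \<in> closure D\<close>] by blast
    qed (use uk D(3) in simp)
    then show False using \<open>u \<notin> rel_interior D\<close> by blast
  qed
  have "s = s'" using *[OF u _ s eq] *[OF u(2,1) _ s(2,1) eq[symmetric]]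
    by (cases s s' rule: linorder_cases) auto
  moreover from this eq have "(1 - s) *\<^sub>R u = (1 - s) *\<^sub>R u'" by simp
  ultimately show ?thesis by auto
qed

lemma cone_coordinates_surj:
  fixes D :: "'a::euclidean_space set"
  assumes "convex D" "compact D" "c \<in> rel_interior D" "D \<noteq> {c}"
  shows "(\<lambda>(u, s). (1 - s) *\<^sub>R u + s *\<^sub>R c) ` (rel_frontier D \<times> {0..1}) = D"
proof (intro equalityI subsetI)
  fix x assume "x \<in> (\<lambda>(u, s). (1 - s) *\<^sub>R u + s *\<^sub>R c) ` (rel_frontier D \<times> {0..1})"
  then obtain u s where us: "u \<in> rel_frontier D" "s \<in> {0..1}" "x = (1 - s) *\<^sub>R u + s *\<^sub>R c" by auto
  have "u \<in> D" "c \<in> D"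
    using us(1) assms(3) closure_closed[OF compact_imp_closed[OF assms(2)]] rel_interior_subset[of D]
    by (auto simp: rel_frontier_def)
  then show "x \<in> D" using us assms(1) unfolding convex_alt by auto
next
  fix x assume "x \<in> D"
  then obtain z where z: "z \<in> rel_frontier D" "x \<in> closed_segment c z"
    using segment_to_rel_frontier[OF assms(1) compact_imp_bounded[OF assms(2)] assms(3), of x] assms(4) by metis
  then obtain t where t: "0 \<le> t" "t \<le> 1" "x = (1 - t) *\<^sub>R c + t *\<^sub>R z" by (auto simp: in_segment)
  then show "x \<in> (\<lambda>(u, s). (1 - s) *\<^sub>R u + s *\<^sub>R c) ` (rel_frontier D \<times> {0..1})"
    using z(1) by (intro image_eqI[of _ _ "(z, 1 - t)"]) auto
qed

text \<open>A compact convex set is the quotient of \<open>rel_frontier D \<times> {0..1}\<close>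
  that collapses the top to the apex \<open>c\<close>; the condition \<open>D \<noteq> {c}\<close>
  excludes an empty relative frontier.\<close>

lemma continuous_on_cone:
  fixes D :: "'a::euclidean_space set" and \<psi> :: "'a \<times> real \<Rightarrow> 'c::topological_space"
  assumes D: "convex D" "compact D" "c \<in> rel_interior D" "D \<noteq> {c}"
    and \<psi>: "continuous_on (rel_frontier D \<times> {0..1}) \<psi>"
    and apex: "\<forall>u\<in>rel_frontier D. \<forall>v\<in>rel_frontier D. \<psi> (u, 1) = \<psi> (v, 1)"
  shows "\<exists>\<phi>. continuous_on D \<phi> \<and>
    (\<forall>u\<in>rel_frontier D. \<forall>s\<in>{0..1}. \<phi> ((1 - s) *\<^sub>R u + s *\<^sub>R c) = \<psi> (u, s))"
proof -
  let ?q = "\<lambda>(u, s). (1 - s) *\<^sub>R u + s *\<^sub>R c"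
  let ?P = "rel_frontier D \<times> {0..1::real}"
  have "compact ?P"
    using compact_rel_frontier[OF D(2)] by (intro compact_Times) auto
  moreover have "continuous_on ?P ?q"
    unfolding case_prod_beta by (intro continuous_intros)
  moreover have "\<psi> p = \<psi> p'" if "p \<in> ?P" "p' \<in> ?P" "?q p = ?q p'" for p p'
  proof -
    obtain u s u' s' where p: "p = (u, s)" "p' = (u', s')" by (cases p, cases p')
    have "s = s' \<and> (s = 1 \<or> u = u')"
      by (rule cone_coordinates_unique[OF D(1-3)]) (use that p in auto)
    then show ?thesis using apex that p by auto
  qed
  ultimately obtain \<phi> where \<phi>: "continuous_on (?q ` ?P) \<phi>" "\<And>p. p \<in> ?P \<Longrightarrow> \<phi> (?q p) = \<psi> p"
    using continuous_on_compact_quotient[OF _ _ \<psi>] by blast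
  then show ?thesis
    using cone_coordinates_surj[OF D] by (intro exI[of _ \<phi>]) force
qed

lemma rel_frontier_subset_skeleton:
  fixes D :: "'a::euclidean_space set"
  assumes "simplicial_complex \<T>" "D \<in> \<T>" "aff_dim D \<le> d + 1"
  shows "rel_frontier D \<subseteq> \<Union>{T \<in> \<T>. aff_dim T \<le> d}"
proof
  fix x assume "x \<in> rel_frontier D"
  then obtain F where F: "F face_of D" "F \<noteq> D" "x \<in> F"
    using rel_frontier_of_polyhedron_alt[OF simplicial_complex_simplex(1)[OF assms(1,2)]] by blast
  then have "aff_dim F < aff_dim D"
    using face_of_aff_dim_lt simplicial_complex_simplex(3)[OF assms(1,2)] by blast
  then show "x \<in> \<Union>{T \<in> \<T>. aff_dim T \<le> d}"
    using F simplicial_complex_face[OF assms(1,2)] assms(3) by (intro UnionI[of F]) auto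
qed

lemma finite_1_complex_skeleton:
  "simplicial_complex \<T> \<Longrightarrow> finite_1_complex (\<Union>{T \<in> \<T>. aff_dim T \<le> 1})"
  unfolding finite_1_complex_def
  by (rule exI[of _ "{T \<in> \<T>. aff_dim T \<le> 1}"]) (simp add: skeleton_simplicial_complex)

lemma finite_1_complex_rel_frontier:
  assumes "simplicial_complex \<T>" "D \<in> \<T>" "aff_dim D \<le> 2"
  shows "finite_1_complex (rel_frontier D)"
  unfolding finite_1_complex_def
proof (intro exI conjI ballI)
  let ?C = "{F. F face_of D \<and> F \<noteq> D}"
  have D: "polyhedron D" "convex D" using simplicial_complex_simplex[OF assms(1,2)] by auto
  show "simplicial_complex ?C"
  proof (rule simplicial_complex_subset[OF assms(1)])
    show "?C \<subseteq> \<T>" using simplicial_complex_face[OF assms(1,2)] by blast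
    fix F S assume *: "S \<in> ?C" "F face_of S"
    then have "F face_of D" using face_of_trans by blast
    moreover have "F \<noteq> D" using * face_of_imp_subset by blast
    ultimately show "F \<in> ?C" by simp
  qed
  show "aff_dim S \<le> 1" if "S \<in> ?C" for S
    using face_of_aff_dim_lt[OF D(2), of S] that assms(3) by simp
  show "rel_frontier D = \<Union>?C" using rel_frontier_of_polyhedron_alt[OF D(1)] .
qed

text \<open>In cone coordinates \<open>(u, s)\<close> on a triangle \<open>D\<close>, the outer half
  climbs the wall over \<open>u\<close> from \<open>\<sigma> u\<close> to the level of
  \<open>D\<close>, and the inner half runs through the cap \<open>\<Phi> D\<close>, which ends in a
  single point. The conclusion records only the wall or cap on which a value lies; the range of
  \<open>h\<close> is kept for distance estimates.\<close>

lemma staircase_disc: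
  fixes \<T> :: "'a::euclidean_space set set" and W :: "'a \<times> real \<Rightarrow> 'c::topological_space"
    and lev :: "'a set \<Rightarrow> real" and \<Phi> :: "'a set \<Rightarrow> 'a \<times> real \<Rightarrow> 'c"
  defines "G \<equiv> \<Union>{T \<in> \<T>. aff_dim T \<le> 1}" and "M \<equiv> {T \<in> \<T>. aff_dim T = 2}"
  assumes \<T>: "simplicial_complex \<T>" "\<And>T. T \<in> \<T> \<Longrightarrow> aff_dim T \<le> 2"
    and \<sigma>: "continuous_on G \<sigma>" and W: "continuous_on (G \<times> UNIV) W"
    and \<Phi>: "\<And>D. D \<in> M \<Longrightarrow> continuous_on (rel_frontier D \<times> {0..1}) (\<Phi> D)"
    and base: "\<And>D u. D \<in> M \<Longrightarrow> u \<in> rel_frontier D \<Longrightarrow> \<Phi> D (u, 0) = W (u, lev D)"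
    and apex: "\<And>D u v. D \<in> M \<Longrightarrow> u \<in> rel_frontier D \<Longrightarrow> v \<in> rel_frontier D \<Longrightarrow> \<Phi> D (u, 1) = \<Phi> D (v, 1)"
  shows "\<exists>\<phi>. continuous_on (\<Union>\<T>) \<phi> \<and> (\<forall>x\<in>\<Union>\<T>.
    (x \<in> G \<and> \<phi> x = W (x, \<sigma> x)) \<or>
    (\<exists>D\<in>M. \<exists>u\<in>rel_frontier D. x \<in> D \<and>
      ((\<exists>h\<in>closed_segment (\<sigma> u) (lev D). \<phi> x = W (u, h)) \<or> (\<exists>s\<in>{0..1}. \<phi> x = \<Phi> D (u, s)))))"
proof -
  define \<psi> where "\<psi> = (\<lambda>D z. if snd z \<le> 1/2 then W (fst z, (1 - 2 * snd z) * \<sigma> (fst z) + 2 * snd z * lev D)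
    else \<Phi> D (fst z, 2 * snd z - 1))"
  have fin: "finite \<T>" using \<T>(1) by (simp add: simplicial_complex_def)
  have simp: "convex D" "compact D" if "D \<in> \<T>" for D using simplicial_complex_simplex[OF \<T>(1) that] by auto
  have MT: "D \<in> \<T>" "aff_dim D = 2" if "D \<in> M" for D using that by (auto simp: M_def)
  have RG: "rel_frontier D \<subseteq> G" if "D \<in> M" for D
    unfolding G_def using rel_frontier_subset_skeleton[OF \<T>(1)] MT[OF that] by simp
  have clR: "closed (rel_frontier D)" if "D \<in> M" for D
    using compact_rel_frontier[OF simp(2)] MT[OF that] compact_imp_closed by blast
  have c\<psi>: "continuous_on (rel_frontier D \<times> {0..1}) (\<psi> D)" if D: "D \<in> M" for D
  proof -
    have 1: "continuous_on (rel_frontier D \<times> {0..1/2}) (\<psi> D)"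
    proof (rule continuous_on_eq)
      show "continuous_on (rel_frontier D \<times> {0..1/2})
          (\<lambda>z. W (fst z, (1 - 2 * snd z) * \<sigma> (fst z) + 2 * snd z * lev D))"
        by (rule continuous_on_compose2[OF W])
          (use RG[OF D] in \<open>auto intro!: continuous_intros continuous_on_compose2[OF \<sigma>, of _ fst]\<close>)
    qed (auto simp: \<psi>_def)
    have 2: "continuous_on (rel_frontier D \<times> {1/2..1}) (\<psi> D)"
    proof (rule continuous_on_eq)
      show "continuous_on (rel_frontier D \<times> {1/2..1}) (\<lambda>z. \<Phi> D (fst z, 2 * snd z - 1))"
        by (rule continuous_on_compose2[OF \<Phi>[OF D]]) (auto intro!: continuous_intros)
      fix z assume z: "z \<in> rel_frontier D \<times> {1/2..1::real}"
      show "\<Phi> D (fst z, 2 * snd z - 1) = \<psi> D z"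
      proof (cases "snd z = 1/2")
        case True
        then obtain u where "z = (u, 1/2)" by (metis prod.collapse)
        then show ?thesis using base[OF D, of u] z by (simp add: \<psi>_def)
      qed (use z in \<open>auto simp: \<psi>_def\<close>)
    qed
    have "continuous_on (rel_frontier D \<times> {0..1/2} \<union> rel_frontier D \<times> {1/2..1}) (\<psi> D)"
      using clR[OF D] 1 2 by (intro continuous_on_closed_Un closed_Times) auto
    moreover have "rel_frontier D \<times> {0..1/2} \<union> rel_frontier D \<times> {1/2..1} = rel_frontier D \<times> {0..1::real}" by auto
    ultimately show ?thesis by simp
  qed
  have "\<exists>c. D \<in> M \<longrightarrow> c \<in> rel_interior D" for D
  proof (cases "D \<in> M")
    case True
    then have "D \<noteq> {}" using MT(2) by force
    then show ?thesis using rel_interior_eq_empty[OF simp(1)[OF MT(1)[OF True]]] by blast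
  qed simp
  then obtain c where c: "\<And>D. D \<in> M \<Longrightarrow> c D \<in> rel_interior D" by metis
  have nc: "D \<noteq> {c D}" if "D \<in> M" for D
  proof
    assume *: "D = {c D}"
    have "aff_dim D = 0" unfolding aff_dim_eq_0 by (rule exI) (rule *)
    then show False using MT(2)[OF that] by simp
  qed
  have "\<exists>\<phi>. D \<in> M \<longrightarrow> continuous_on D \<phi> \<and>
      (\<forall>u\<in>rel_frontier D. \<forall>s\<in>{0..1}. \<phi> ((1 - s) *\<^sub>R u + s *\<^sub>R c D) = \<psi> D (u, s))" for D
  proof (cases "D \<in> M")
    case True
    have "\<forall>u\<in>rel_frontier D. \<forall>v\<in>rel_frontier D. \<psi> D (u, 1) = \<psi> D (v, 1)"
    proof (intro ballI)
      fix u v assume "u \<in> rel_frontier D" "v \<in> rel_frontier D"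
      from apex[OF True this] show "\<psi> D (u, 1) = \<psi> D (v, 1)" by (simp add: \<psi>_def)
    qed
    from continuous_on_cone[OF simp[OF MT(1)[OF True]] c[OF True] nc[OF True] c\<psi>[OF True] this]
    show ?thesis by simp
  qed simp
  then obtain f where "\<forall>D. D \<in> M \<longrightarrow> continuous_on D (f D) \<and>
      (\<forall>u\<in>rel_frontier D. \<forall>s\<in>{0..1}. f D ((1 - s) *\<^sub>R u + s *\<^sub>R c D) = \<psi> D (u, s))"
    using choice[of "\<lambda>D \<phi>. D \<in> M \<longrightarrow> continuous_on D \<phi> \<and>
      (\<forall>u\<in>rel_frontier D. \<forall>s\<in>{0..1}. \<phi> ((1 - s) *\<^sub>R u + s *\<^sub>R c D) = \<psi> D (u, s))"] by auto
  then have f: "\<And>D. D \<in> M \<Longrightarrow> continuous_on D (f D)"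
    "\<And>D u s. D \<in> M \<Longrightarrow> u \<in> rel_frontier D \<Longrightarrow> s \<in> {0..1} \<Longrightarrow> f D ((1 - s) *\<^sub>R u + s *\<^sub>R c D) = \<psi> D (u, s)"
    by simp_all
  have ri: "x \<in> rel_interior D \<longleftrightarrow> x \<notin> G" if D: "D \<in> M" "x \<in> D" for D x
  proof
    have "rel_interior D = \<Union>\<T> - \<Union>(\<T> - {D})"
      using top_simplex_rel_interior[OF \<T>(1) MT(1)[OF D(1)]] MT(2)[OF D(1)] \<T>(2) by simp
    then show "x \<in> rel_interior D \<Longrightarrow> x \<notin> G" using MT(2)[OF D(1)] by (auto simp: G_def)
    show "x \<notin> G \<Longrightarrow> x \<in> rel_interior D"
      using RG[OF D(1)] D(2) closure_subset[of D] by (auto simp: rel_frontier_def)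
  qed
  \<comment> \<open>Off \<open>G\<close> a point of the polyhedron lies in exactly one triangle, so
    the choice is forced; on \<open>G\<close> every adjacent triangle gives the value
    \<open>W (x, \<sigma> x)\<close> at \<open>s = 0\<close>.\<close>
  define \<phi> where "\<phi> = (\<lambda>x. if x \<in> G then W (x, \<sigma> x) else f (SOME D. D \<in> M \<and> x \<in> D) x)"
  have \<phi>D: "\<phi> x = f D x" if D: "D \<in> M" "x \<in> D" for D x
  proof (cases "x \<in> G")
    case True
    then have "x \<in> rel_frontier D"
      using ri[OF D] D(2) closure_subset[of D] by (auto simp: rel_frontier_def)
    from f(2)[OF D(1) this, of 0] True show ?thesis by (simp add: \<phi>_def \<psi>_def)
  next
    case False
    have "E = D" if "E \<in> M" "x \<in> E" for E
    proof -
      have "rel_interior E = \<Union>\<T> - \<Union>(\<T> - {E})"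
        using top_simplex_rel_interior[OF \<T>(1) MT(1)[OF that(1)]] MT(2)[OF that(1)] \<T>(2) by simp
      then show ?thesis using ri[OF that] False D(2) MT(1)[OF D(1)] by blast
    qed
    then have "(SOME D. D \<in> M \<and> x \<in> D) = D" using D by (intro some_equality) blast+
    then show ?thesis using False by (simp add: \<phi>_def)
  qed
  have cover: "\<Union>\<T> = G \<union> (\<Union>D\<in>M. D)"
  proof -
    have "aff_dim T \<le> 1 \<or> aff_dim T = 2" if "T \<in> \<T>" for T using \<T>(2)[OF that] by linarith
    then show ?thesis by (auto simp: G_def M_def)
  qed
  have finM: "finite M" using fin by (simp add: M_def)
  have clM: "closed D" if "D \<in> M" for D using compact_imp_closed[OF simp(2)[OF MT(1)[OF that]]] .
  have "closed G" unfolding G_def using fin simp(2) compact_imp_closed by (intro closed_Union) auto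
  moreover have "continuous_on G \<phi>"
  proof (rule continuous_on_eq)
    show "continuous_on G (\<lambda>x. W (x, \<sigma> x))"
      by (intro continuous_on_compose2[OF W] continuous_intros \<sigma>) auto
  qed (simp add: \<phi>_def)
  moreover have "continuous_on (\<Union>D\<in>M. D) \<phi>"
  proof (rule continuous_on_closed_Union[OF finM clM])
    show "continuous_on D \<phi>" if "D \<in> M" for D
      by (rule continuous_on_eq[OF f(1)[OF that]]) (use \<phi>D that in simp)
  qed
  moreover have "closed (\<Union>D\<in>M. D)"
    by (intro closed_UN finM ballI clM)
  ultimately have "continuous_on (\<Union>\<T>) \<phi>" unfolding cover by (intro continuous_on_closed_Un)
  moreover have "(x \<in> G \<and> \<phi> x = W (x, \<sigma> x)) \<or>
    (\<exists>D\<in>M. \<exists>u\<in>rel_frontier D. x \<in> D \<and>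
      ((\<exists>h\<in>closed_segment (\<sigma> u) (lev D). \<phi> x = W (u, h)) \<or> (\<exists>s\<in>{0..1}. \<phi> x = \<Phi> D (u, s))))"
    if x: "x \<in> \<Union>\<T>" for x
  proof (cases "x \<in> G")
    case True
    then show ?thesis by (simp add: \<phi>_def)
  next
    case False
    then obtain D where D: "D \<in> M" "x \<in> D" using x cover by blast
    then obtain u s where us: "u \<in> rel_frontier D" "s \<in> {0..1}" "x = (1 - s) *\<^sub>R u + s *\<^sub>R c D"
      using cone_coordinates_surj[OF simp[OF MT(1)[OF D(1)]] c[OF D(1)] nc[OF D(1)]] by force
    have eq: "\<phi> x = \<psi> D (u, s)" using \<phi>D[OF D] f(2)[OF D(1) us(1,2)] us(3) by simp
    have "(\<exists>h\<in>closed_segment (\<sigma> u) (lev D). \<phi> x = W (u, h)) \<or> (\<exists>s\<in>{0..1}. \<phi> x = \<Phi> D (u, s))"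
    proof (cases "s \<le> 1/2")
      case True
      have "(1 - 2 * s) * \<sigma> u + 2 * s * lev D \<in> closed_segment (\<sigma> u) (lev D)"
        using True us(2) unfolding in_segment by (intro exI[of _ "2 * s"]) auto
      then show ?thesis using True eq by (auto simp: \<psi>_def)
    next
      case False
      then show ?thesis using us(2) eq
        by (intro disjI2 bexI[of _ "2 * s - 1"]) (auto simp: \<psi>_def)
    qed
    then show ?thesis using D us(1) by blast
  qed
  ultimately show ?thesis by blast
qed

subsection \<open>Walls and caps\<close>

text \<open>The levels are chosen one after another, each near \<open>a j\<close> but off the
  finitely many others already chosen. The strict bound by \<open>\<delta>\<close> makes the closed
  slabs \<open>{c j..c j + \<delta>}\<close> pairwise disjoint.\<close>

lemma separated_levels:
  fixes a :: "'j \<Rightarrow> real"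
  assumes "finite J" "\<epsilon> > 0"
  obtains c \<delta> where "0 < \<delta>" "\<delta> < \<epsilon>" "\<And>j. j \<in> J \<Longrightarrow> \<bar>c j - a j\<bar> < \<epsilon>"
    "\<And>i j. i \<in> J \<Longrightarrow> j \<in> J \<Longrightarrow> i \<noteq> j \<Longrightarrow> \<delta> < \<bar>c i - c j\<bar>"
proof -
  have "\<exists>c. inj_on c J \<and> (\<forall>j\<in>J. \<bar>c j - a j\<bar> < \<epsilon>)"
    using assms(1)
  proof (induction J)
    case (insert j J)
    then obtain c where c: "inj_on c J" "\<forall>i\<in>J. \<bar>c i - a i\<bar> < \<epsilon>" by blast
    have "infinite ({a j<..<a j + \<epsilon>} - c ` J)"
      using insert(1) assms(2) by (intro Diff_infinite_finite) (auto simp: infinite_Ioo)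
    then obtain y where y: "y \<in> {a j<..<a j + \<epsilon>}" "y \<notin> c ` J"
      by (metis Diff_iff finite.emptyI all_not_in_conv)
    have "inj_on (c(j := y)) (insert j J)"
      using c(1) y(2) insert(2) by (auto simp: inj_on_def)
    moreover have "\<forall>i\<in>insert j J. \<bar>(c(j := y)) i - a i\<bar> < \<epsilon>"
      using c(2) y(1) insert(2) by (auto simp: abs_less_iff)
    ultimately show ?case by blast
  qed simp
  then obtain c where c: "inj_on c J" "\<And>j. j \<in> J \<Longrightarrow> \<bar>c j - a j\<bar> < \<epsilon>" by blast
  obtain r where r: "r > 0" "\<And>v w. v \<in> c ` J \<Longrightarrow> w \<in> c ` J \<Longrightarrow> v \<noteq> w \<Longrightarrow> r \<le> dist v w"
    using finite_separation[of "c ` J"] assms(1) by blast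
  show ?thesis
  proof (rule that[of "min (\<epsilon> / 2) (r / 2)" c])
    show "min (\<epsilon> / 2) (r / 2) < \<bar>c i - c j\<bar>" if "i \<in> J" "j \<in> J" "i \<noteq> j" for i j
    proof -
      have "r \<le> dist (c i) (c j)" using r(2) that c(1) by (auto simp: inj_on_def)
      then show ?thesis using r(1) by (simp add: dist_real_def min_def)
    qed
  qed (use c r assms in auto)
qed

text \<open>Outside the slabs the wall is straight; in slab \<open>j\<close> it is replaced by
  \<open>(A j, T j)\<close>, rescaled to thickness \<open>\<delta>\<close>. By \<open>ends\<close>
  the two descriptions agree at the bottom and at the top of the slab.\<close>

lemma wall_map:
  fixes G :: "'a::metric_space set" and g :: "'a \<Rightarrow> 'b::metric_space" and c :: "'j \<Rightarrow> real"
  assumes G: "closed G" and J: "finite J" and \<delta>: "\<delta> > 0"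
    and sep: "\<And>i j. i \<in> J \<Longrightarrow> j \<in> J \<Longrightarrow> i \<noteq> j \<Longrightarrow> \<delta> < \<bar>c i - c j\<bar>"
    and g: "continuous_on G g"
    and A: "\<And>j. j \<in> J \<Longrightarrow> continuous_on (G \<times> {0..1}) (A j)"
    and T: "\<And>j. j \<in> J \<Longrightarrow> continuous_on (G \<times> {0..1}) (T j)"
    and ends: "\<And>j u. j \<in> J \<Longrightarrow> u \<in> G \<Longrightarrow> A j (u, 0) = g u \<and> A j (u, 1) = g u \<and> T j (u, 0) = (0::real) \<and> T j (u, 1) = 1"
  shows "\<exists>W. continuous_on (G \<times> UNIV) W \<and>
    (\<forall>u\<in>G. \<forall>h. (\<forall>j\<in>J. h \<notin> {c j<..<c j + \<delta>}) \<longrightarrow> W (u, h) = (g u, h)) \<and>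
    (\<forall>j\<in>J. \<forall>u\<in>G. \<forall>t\<in>{0..1}. W (u, c j + \<delta> * t) = (A j (u, t), c j + \<delta> * T j (u, t)))"
proof -
  define idx where "idx = (\<lambda>h. SOME j. j \<in> J \<and> h \<in> {c j..c j + \<delta>})"
  have idx: "idx h = j" if "j \<in> J" "h \<in> {c j..c j + \<delta>}" for h j
  proof -
    have "i = j" if "i \<in> J" "h \<in> {c i..c i + \<delta>}" for i
      using sep[of i j] that \<open>j \<in> J\<close> \<open>h \<in> {c j..c j + \<delta>}\<close> by (cases "i = j") (auto simp: abs_if split: if_splits)
    then show ?thesis unfolding idx_def using that by (intro some_equality) blast+
  qed
  define P where "P = (\<lambda>j z. (A j (fst z, (snd z - c j) / \<delta>), c j + \<delta> * T j (fst z, (snd z - c j) / \<delta>)))"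
  define W where "W = (\<lambda>z. if \<exists>j\<in>J. snd z \<in> {c j..c j + \<delta>} then P (idx (snd z)) z else (g (fst z), snd z))"
  have WP: "W z = P j z" if "j \<in> J" "snd z \<in> {c j..c j + \<delta>}" for z j
    using that idx[OF that] by (auto simp: W_def)
  have in01: "(h - c j) / \<delta> \<in> {0..1}" if "h \<in> {c j..c j + \<delta>}" for h j
    using that \<delta> by (auto simp: divide_simps)
  have Wg: "W (u, h) = (g u, h)" if "u \<in> G" "\<forall>j\<in>J. h \<notin> {c j<..<c j + \<delta>}" for u h
  proof (cases "\<exists>j\<in>J. h \<in> {c j..c j + \<delta>}")
    case True
    then obtain j where j: "j \<in> J" "h \<in> {c j..c j + \<delta>}" by blast
    then have "h = c j \<or> h = c j + \<delta>" using that(2) by force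
    then show ?thesis using WP[of j "(u, h)"] j ends[OF j(1) that(1)] \<delta> by (auto simp: P_def)
  qed (auto simp: W_def)
  define N where "N = - (\<Union>j\<in>J. {c j<..<c j + \<delta>})"
  have "closed N" unfolding N_def by (intro closed_Compl open_UN) auto
  have cN: "continuous_on (G \<times> N) W"
  proof (rule continuous_on_eq)
    show "continuous_on (G \<times> N) (\<lambda>z. (g (fst z), snd z))"
      by (intro continuous_intros continuous_on_compose2[OF g]) auto
  qed (use Wg in \<open>auto simp: N_def\<close>)
  have "continuous_on (G \<times> {c j..c j + \<delta>}) W" if j: "j \<in> J" for j
  proof (rule continuous_on_eq)
    show "continuous_on (G \<times> {c j..c j + \<delta>}) (P j)"
      unfolding P_def
      by (intro continuous_on_Pair continuous_on_add continuous_on_mult continuous_on_const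
            continuous_on_compose2[OF A[OF j]] continuous_on_compose2[OF T[OF j]] continuous_on_fst
            continuous_on_snd continuous_on_id continuous_on_divide continuous_on_diff)
        (use in01 \<delta> in auto)
  qed (use WP[OF j] in auto)
  then have cJ: "continuous_on (\<Union>j\<in>J. G \<times> {c j..c j + \<delta>}) W"
    using J G by (intro continuous_on_closed_Union) (auto intro: closed_Times)
  have "continuous_on (G \<times> N \<union> (\<Union>j\<in>J. G \<times> {c j..c j + \<delta>})) W"
    by (rule continuous_on_closed_Un[OF _ _ cN cJ])
      (use \<open>closed N\<close> G J in \<open>auto intro!: closed_Times closed_UN\<close>)
  moreover have "G \<times> N \<union> (\<Union>j\<in>J. G \<times> {c j..c j + \<delta>}) = G \<times> UNIV"
    by (fastforce simp: N_def)
  moreover have "W (u, c j + \<delta> * t) = (A j (u, t), c j + \<delta> * T j (u, t))"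
    if "j \<in> J" "u \<in> G" "t \<in> {0..1}" for j u t
  proof -
    have "c j + \<delta> * t \<in> {c j..c j + \<delta>}" using that(3) \<delta> by (auto simp: mult_left_le)
    then show ?thesis using WP[of j "(u, c j + \<delta> * t)"] that(1) \<delta> by (simp add: P_def)
  qed
  ultimately show ?thesis using Wg by (intro exI[of _ W]) auto
qed

text \<open>Three stages: short paths from \<open>g u\<close> back to \<open>f u\<close>, the image
  under \<open>f\<close> of the straight contraction of \<open>R\<close> to \<open>v\<close> inside
  \<open>D\<close>, and a short path from \<open>f v\<close> to \<open>g v\<close>. The last stage
  puts the final point into the image of \<open>g\<close>, so that disjointness of the graphs covers
  both ends of the slab.\<close>

lemma cap_homotopy:
  fixes D :: "(real^3) set" and X :: "'a::metric_space set"
  assumes D: "convex D" and R: "closed R" "R \<subseteq> D" "v \<in> R"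
    and f: "continuous_on D f" "f ` D \<subseteq> C" "f ` D \<subseteq> X" and g: "continuous_on R g" "g ` R \<subseteq> X"
    and near: "\<And>u. u \<in> R \<Longrightarrow> dist (f u) (g u) < \<delta>"
    and lam: "continuous_on {(x, y, t). x \<in> C \<and> y \<in> X \<and> dist x y < \<delta> \<and> t \<in> {0..1::real}} (\<lambda>(x, y, t). lam x y t)"
    "\<And>x y t. x \<in> C \<Longrightarrow> y \<in> X \<Longrightarrow> dist x y < \<delta> \<Longrightarrow> t \<in> {0..1} \<Longrightarrow> lam x y t \<in> X \<and> dist (lam x y t) x < \<epsilon>"
    "\<And>x y. x \<in> C \<Longrightarrow> y \<in> X \<Longrightarrow> lam x y 0 = x" "\<And>x y. x \<in> C \<Longrightarrow> y \<in> X \<Longrightarrow> lam x y 1 = y"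
    and "\<epsilon> > 0"
  shows "\<exists>\<Gamma>. continuous_on (R \<times> {0..1}) \<Gamma> \<and> \<Gamma> ` (R \<times> {0..1}) \<subseteq> X \<and> (\<forall>u\<in>R. \<Gamma> (u, 0) = g u \<and> \<Gamma> (u, 1) = g v) \<and>
    (\<forall>z\<in>R \<times> {0..1::real}. \<exists>p\<in>D. dist (\<Gamma> z) (f p) < \<epsilon>)"
proof -
  define a where "a = (\<lambda>z. lam (f (fst z)) (g (fst z)) (1 - snd z))"
  define b where "b = (\<lambda>z. f ((1 - snd z) *\<^sub>R fst z + snd z *\<^sub>R v))"
  define d where "d = (\<lambda>z :: (real^3) \<times> real. lam (f v) (g v) (snd z))"
  have v: "v \<in> D" "f v \<in> C" "g v \<in> X" "dist (f v) (g v) < \<delta>" using R f g near by auto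
  have u: "u \<in> D" "f u \<in> C" "g u \<in> X" "dist (f u) (g u) < \<delta>" if "u \<in> R" for u using R f g near that by auto
  have seg: "(1 - s) *\<^sub>R u + s *\<^sub>R v \<in> D" if "u \<in> R" "s \<in> {0..1}" for u s
    using D u(1)[OF that(1)] v(1) that(2) unfolding convex_alt by auto
  have "continuous_on (R \<times> {0..1}) (\<lambda>z. (\<lambda>(x, y, t). lam x y t) (f (fst z), g (fst z), 1 - snd z))"
    by (rule continuous_on_compose2[OF lam(1)],
        intro continuous_on_Pair continuous_on_diff continuous_on_const continuous_on_snd continuous_on_id
          continuous_on_compose2[OF f(1)] continuous_on_compose2[OF g(1)] continuous_on_fst)
      (use u in auto)
  then have ca: "continuous_on (R \<times> {0..1}) a" by (simp add: a_def)
  have cb: "continuous_on (R \<times> {0..1}) b"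
    unfolding b_def by (intro continuous_on_compose2[OF f(1)] continuous_intros) (use seg in auto)
  have "continuous_on (R \<times> {0..1}) (\<lambda>z. (\<lambda>(x, y, t). lam x y t) (f v, g v, snd z))"
    by (rule continuous_on_compose2[OF lam(1)],
        intro continuous_on_Pair continuous_on_const continuous_on_snd continuous_on_id)
      (use v in auto)
  then have cd: "continuous_on (R \<times> {0..1}) d" by (simp add: d_def)
  have ab: "a (x, 1) = b (x, 0)" and bd: "b (x, 1) = d (x, 0)" if "x \<in> R" for x
    using lam(3) u[OF that] v by (auto simp: a_def b_def d_def)
  have "continuous_on (R \<times> {0..1}) (join3 a b d)"
    using ab bd by (rule continuous_on_join3[OF R(1) ca cb cd])
  moreover have "join3 a b d (x, t) \<in> X \<and> (\<exists>p\<in>D. dist (join3 a b d (x, t)) (f p) < \<epsilon>)" if "x \<in> R" "t \<in> {0..1}" for x t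
  proof (rule join3_image[where P = "\<lambda>y. y \<in> X \<and> (\<exists>p\<in>D. dist y (f p) < \<epsilon>)", OF _ _ _ that(2)])
    fix s :: real assume s: "s \<in> {0..1}"
    show "a (x, s) \<in> X \<and> (\<exists>p\<in>D. dist (a (x, s)) (f p) < \<epsilon>)"
      using lam(2)[of "f x" "g x" "1 - s"] u[OF that(1)] s by (auto simp: a_def)
    have "f ((1 - s) *\<^sub>R x + s *\<^sub>R v) \<in> X" using f(3) seg[OF that(1) s] by blast
    then show "b (x, s) \<in> X \<and> (\<exists>p\<in>D. dist (b (x, s)) (f p) < \<epsilon>)"
      using seg[OF that(1) s] \<open>\<epsilon> > 0\<close> unfolding b_def
      by (intro conjI bexI[of _ "(1 - s) *\<^sub>R x + s *\<^sub>R v"]) auto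
    show "d (x, s) \<in> X \<and> (\<exists>p\<in>D. dist (d (x, s)) (f p) < \<epsilon>)"
      using lam(2)[of "f v" "g v" s] v s by (auto simp: d_def)
  qed
  moreover have "join3 a b d (x, 0) = g x \<and> join3 a b d (x, 1) = g v" if "x \<in> R" for x
    using lam(4) u[OF that] v by (simp add: join3_def a_def d_def)
  ultimately show ?thesis
    by (intro exI[of _ "join3 a b d"]) (auto simp: image_subset_iff)
qed

subsection \<open>Disjoint staircases\<close>

lemma separated_slabD:
  assumes "separated_slab X K1 f1 K2 f2 \<epsilon> F1 T1 F2 T2"
  shows "category_K X K1 F1 T1" "category_K X K2 F2 T2"
    "\<And>x. x \<in> K1 \<Longrightarrow> F1 (x, 0) = f1 x" "\<And>x. x \<in> K1 \<Longrightarrow> F1 (x, 1) = f1 x"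
    "\<And>y. y \<in> K2 \<Longrightarrow> F2 (y, 0) = f2 (y, 0)" "\<And>y. y \<in> K2 \<Longrightarrow> F2 (y, 1) = f2 (y, 1)"
    "\<And>x t. x \<in> K1 \<Longrightarrow> t \<in> {0..1} \<Longrightarrow> dist (F1 (x, t)) (f1 x) < \<epsilon>"
    "\<And>y t. y \<in> K2 \<Longrightarrow> t \<in> {0..1} \<Longrightarrow> \<exists>s\<in>{0..1}. dist (F2 (y, t)) (f2 (y, s)) < \<epsilon>"
    "\<And>x y s t. x \<in> K1 \<Longrightarrow> y \<in> K2 \<Longrightarrow> s \<in> {0..1} \<Longrightarrow> t \<in> {0..1} \<Longrightarrow> T1 (x, s) = T2 (y, t) \<Longrightarrow>
      F1 (x, s) \<noteq> F2 (y, t)"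
  using assms unfolding separated_slab_def by blast+

text \<open>The index \<open>i\<close> names one disc and \<open>\<not> i\<close> the other, so a
  single argument covers both roles: slab \<open>(i, D)\<close> belongs to the cap of disc
  \<open>i\<close> over \<open>D\<close>, and in it the wall of disc \<open>\<not> i\<close> is bent
  out of the way.\<close>

lemma fuzzy_ribbons_disjoint_polyhedra:
  fixes X :: "'a::metric_space set" and f :: "bool \<Rightarrow> real^3 \<Rightarrow> 'a" and \<sigma> :: "bool \<Rightarrow> real^3 \<Rightarrow> real"
  assumes ANR: "metrizable_ANR (top_of_set X)" and fuzzy: "fuzzy_ribbons_property X"
    and \<T>: "simplicial_complex \<T>" "\<And>T. T \<in> \<T> \<Longrightarrow> aff_dim T \<le> 2"
    and f: "\<And>i. continuous_on (\<Union>\<T>) (f i)" "\<And>i. f i ` \<Union>\<T> \<subseteq> X"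
    and \<sigma>: "\<And>i. continuous_on (\<Union>\<T>) (\<sigma> i)" and "\<epsilon> > 0"
    and fine: "\<And>T x y i. T \<in> \<T> \<Longrightarrow> x \<in> T \<Longrightarrow> y \<in> T \<Longrightarrow> dist (f i x) (f i y) < \<epsilon> \<and> \<bar>\<sigma> i x - \<sigma> i y\<bar> < \<epsilon>"
  shows "\<exists>\<phi>. (\<forall>i. continuous_on (\<Union>\<T>) (\<phi> i) \<and> \<phi> i ` \<Union>\<T> \<subseteq> X \<times> UNIV \<and>
      (\<forall>x\<in>\<Union>\<T>. dist (fst (\<phi> i x)) (f i x) < 3 * \<epsilon> \<and> \<bar>snd (\<phi> i x) - \<sigma> i x\<bar> < 4 * \<epsilon>)) \<and>
    \<phi> False ` \<Union>\<T> \<inter> \<phi> True ` \<Union>\<T> = {}"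
proof -
  define G where "G = \<Union>{T \<in> \<T>. aff_dim T \<le> 1}"
  define M where "M = {T \<in> \<T>. aff_dim T = 2}"
  define R where "R = (rel_frontier :: (real^3) set \<Rightarrow> _)"
  have fin: "finite \<T>" "finite M" using \<T>(1) by (auto simp: simplicial_complex_def M_def)
  have MT: "D \<in> \<T>" "aff_dim D = 2" if "D \<in> M" for D using that by (auto simp: M_def)
  have MS: "D \<subseteq> \<Union>\<T>" if "D \<in> M" for D using MT(1)[OF that] by blast
  have GS: "G \<subseteq> \<Union>\<T>" by (auto simp: G_def)
  have simp: "convex D" "compact D" if "D \<in> \<T>" for D using simplicial_complex_simplex[OF \<T>(1) that] by auto
  have G1: "finite_1_complex G" unfolding G_def by (rule finite_1_complex_skeleton[OF \<T>(1)])
  have cG: "compact G" using finite_1_complex_imp_compact[OF G1] .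
  have cS: "compact (\<Union>\<T>)" using fin(1) simp(2) by (intro compact_Union) auto
  have R1: "finite_1_complex (R D)" if "D \<in> M" for D
    unfolding R_def by (rule finite_1_complex_rel_frontier[OF \<T>(1) MT(1)[OF that]]) (simp add: MT(2)[OF that])
  have cR: "closed (R D)" if "D \<in> M" for D
    using finite_1_complex_imp_compact[OF R1[OF that]] compact_imp_closed by blast
  have RG: "R D \<subseteq> G" if "D \<in> M" for D
    unfolding G_def R_def using rel_frontier_subset_skeleton[OF \<T>(1) MT(1)[OF that]] MT(2)[OF that] by simp
  have RD: "R D \<subseteq> D" if "D \<in> M" for D
    using closure_closed[OF compact_imp_closed[OF simp(2)[OF MT(1)[OF that]]]] by (auto simp: R_def rel_frontier_def)
  \<comment> \<open>\<open>v D\<close> is both the point to which the cap over \<open>D\<close>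
    contracts and the point whose height the level of \<open>D\<close> approximates.\<close>
  have "\<exists>v. D \<in> M \<longrightarrow> v \<in> R D" for D
  proof (cases "D \<in> M")
    case True
    then have "R D \<noteq> {}"
      unfolding R_def using MT(2)[OF True] simp[OF MT(1)[OF True]]
      by (metis affine_bounded_eq_lowdim compact_imp_bounded rel_frontier_eq_empty not_numeral_le_zero)
    then show ?thesis by blast
  qed simp
  then obtain v where v: "\<And>D. D \<in> M \<Longrightarrow> v D \<in> R D" by metis

  define C where "C = f False ` \<Union>\<T> \<union> f True ` \<Union>\<T>"
  have C: "compact C" "C \<subseteq> X" unfolding C_def
    using compact_Un[OF compact_continuous_image[OF f(1) cS] compact_continuous_image[OF f(1) cS]] f(2) by auto
  have fC: "f i ` \<Union>\<T> \<subseteq> C" for i unfolding C_def by (cases i) auto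
  obtain \<delta>0 lam where \<delta>0: "\<delta>0 > 0" and
    lam: "continuous_on {(x, y, t). x \<in> C \<and> y \<in> X \<and> dist x y < \<delta>0 \<and> t \<in> {0..1::real}} (\<lambda>(x, y, t). lam x y t)"
    "\<And>x y t. x \<in> C \<Longrightarrow> y \<in> X \<Longrightarrow> dist x y < \<delta>0 \<Longrightarrow> t \<in> {0..1} \<Longrightarrow> lam x y t \<in> X \<and> dist (lam x y t) x < \<epsilon>"
    "\<And>x y. x \<in> C \<Longrightarrow> y \<in> X \<Longrightarrow> lam x y 0 = x" "\<And>x y. x \<in> C \<Longrightarrow> y \<in> X \<Longrightarrow> lam x y 1 = y"
    using that by (rule ANR_short_paths[OF ANR C \<open>\<epsilon> > 0\<close>])
  \<comment> \<open>The bound \<open>\<delta>0\<close> keeps the new graph maps within the range of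
    short paths from \<open>f\<close>, which the caps need.\<close>
  have \<epsilon>\<delta>: "min \<epsilon> \<delta>0 > 0" using \<open>\<epsilon> > 0\<close> \<delta>0 by simp
  have fG: "continuous_on G (f i)" "f i ` G \<subseteq> X" for i
    using continuous_on_subset[OF f(1) GS] order_trans[OF image_mono[OF GS] f(2)] by auto
  obtain gF gT where gFT: "continuous_on G gF" "gF ` G \<subseteq> X" "continuous_on G gT" "gT ` G \<subseteq> X"
    "\<And>x. x \<in> G \<Longrightarrow> dist (gF x) (f False x) < min \<epsilon> \<delta>0" "\<And>x. x \<in> G \<Longrightarrow> dist (gT x) (f True x) < min \<epsilon> \<delta>0"
    "gF ` G \<inter> gT ` G = {}"
    using that by (rule fuzzy_ribbons_disjoint_graphs[OF ANR fuzzy G1 fG G1 fG \<epsilon>\<delta>])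
  define g where "g = (\<lambda>i. if i then gT else gF)"
  have g: "continuous_on G (g i)" "g i ` G \<subseteq> X" for i using gFT by (auto simp: g_def)
  have gf: "dist (g i u) (f i u) < \<epsilon>" "dist (f i u) (g i u) < \<delta>0" if "u \<in> G" for i u
    using gFT(5,6)[OF that] by (auto simp: g_def dist_commute)
  obtain \<eta>0 where \<eta>0: "\<eta>0 > 0" "\<And>x y. x \<in> gF ` G \<Longrightarrow> y \<in> gT ` G \<Longrightarrow> \<eta>0 \<le> dist x y"
    using compact_disjoint_dist_pos[OF compact_continuous_image[OF gFT(1) cG] compact_continuous_image[OF gFT(3) cG] gFT(7)]
    by metis
  \<comment> \<open>In the slabs each wall moves by less than \<open>\<eta>\<close> in
    \<open>X\<close>; half of the gap \<open>\<eta>0\<close> leaves the two walls disjoint whatever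
    their heights.\<close>
  define \<eta> where "\<eta> = min \<epsilon> (\<eta>0 / 2)"
  have \<eta>: "\<eta> > 0" "\<eta> \<le> \<epsilon>" "2 * \<eta> \<le> \<eta>0" using \<eta>0(1) \<open>\<epsilon> > 0\<close> by (auto simp: \<eta>_def)
  have gsep: "g (\<not> i) u \<noteq> g i w" if "u \<in> G" "w \<in> G" for i u w
    using gFT(7) that by (cases i) (auto simp: g_def)

  define capP where "capP = (\<lambda>i D \<Gamma>. continuous_on (R D \<times> {0..1}) \<Gamma> \<and> \<Gamma> ` (R D \<times> {0..1}) \<subseteq> X \<and>
    (\<forall>u\<in>R D. \<Gamma> (u, 0) = g i u \<and> \<Gamma> (u, 1) = g i (v D)) \<and>
    (\<forall>z\<in>R D \<times> {0..1::real}. \<exists>p\<in>D. dist (\<Gamma> z) (f i p) < \<epsilon>))"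
  have "\<exists>\<Gamma>. D \<in> M \<longrightarrow> capP i D \<Gamma>" for i D
  proof (cases "D \<in> M")
    case True
    have *: "continuous_on D (f i)" "f i ` D \<subseteq> C" "f i ` D \<subseteq> X" "continuous_on (R D) (g i)" "g i ` R D \<subseteq> X"
      by (fact continuous_on_subset[OF f(1) MS[OF True]] order_trans[OF image_mono[OF MS[OF True]] fC]
          order_trans[OF image_mono[OF MS[OF True]] f(2)] continuous_on_subset[OF g(1) RG[OF True]]
          order_trans[OF image_mono[OF RG[OF True]] g(2)])+
    have near: "\<And>u. u \<in> R D \<Longrightarrow> dist (f i u) (g i u) < \<delta>0" using gf(2) RG[OF True] by blast
    have "\<exists>\<Gamma>. capP i D \<Gamma>" unfolding capP_def
      by (rule cap_homotopy[OF simp(1)[OF MT(1)[OF True]] cR[OF True] RD[OF True] v[OF True] * near lam \<open>\<epsilon> > 0\<close>])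
    then show ?thesis by blast
  qed simp
  then have "\<forall>i D. \<exists>\<Gamma>. D \<in> M \<longrightarrow> capP i D \<Gamma>" by blast
  then obtain \<Gamma> where "\<forall>i D. D \<in> M \<longrightarrow> capP i D (\<Gamma> i D)" unfolding choice_iff by (elim exE)
  then have \<Gamma>: "\<And>i D. D \<in> M \<Longrightarrow> continuous_on (R D \<times> {0..1}) (\<Gamma> i D)" "\<And>i D. D \<in> M \<Longrightarrow> \<Gamma> i D ` (R D \<times> {0..1}) \<subseteq> X"
    "\<And>i D u. D \<in> M \<Longrightarrow> u \<in> R D \<Longrightarrow> \<Gamma> i D (u, 0) = g i u" "\<And>i D u. D \<in> M \<Longrightarrow> u \<in> R D \<Longrightarrow> \<Gamma> i D (u, 1) = g i (v D)"
    "\<And>i D z. D \<in> M \<Longrightarrow> z \<in> R D \<times> {0..1} \<Longrightarrow> \<exists>p\<in>D. dist (\<Gamma> i D z) (f i p) < \<epsilon>"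
    unfolding capP_def by blast+

  have "\<exists>A T B U. D \<in> M \<longrightarrow> separated_slab X G (g (\<not> i)) (R D) (\<Gamma> i D) \<eta> A T B U" for i D
  proof (cases "D \<in> M")
    case True
    have ends: "\<And>x y e. x \<in> G \<Longrightarrow> y \<in> R D \<Longrightarrow> e \<in> {0, 1} \<Longrightarrow> g (\<not> i) x \<noteq> \<Gamma> i D (y, e)"
      using \<Gamma>(3,4)[OF True] gsep RG[OF True] v[OF True] by auto
    have "\<exists>A T B U. separated_slab X G (g (\<not> i)) (R D) (\<Gamma> i D) \<eta> A T B U"
      by (rule fuzzy_ribbons_slab[OF ANR fuzzy G1 g R1[OF True] \<Gamma>(1,2)[OF True] ends \<eta>(1)])
    then show ?thesis by blast
  qed simp
  then have "\<forall>i D. \<exists>A T B U. D \<in> M \<longrightarrow> separated_slab X G (g (\<not> i)) (R D) (\<Gamma> i D) \<eta> A T B U" by blast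
  then obtain A T B U where
    "\<forall>i D. D \<in> M \<longrightarrow> separated_slab X G (g (\<not> i)) (R D) (\<Gamma> i D) \<eta> (A i D) (T i D) (B i D) (U i D)"
    unfolding choice_iff by (elim exE)
  then have slab:
    "\<And>i D. D \<in> M \<Longrightarrow> separated_slab X G (g (\<not> i)) (R D) (\<Gamma> i D) \<eta> (A i D) (T i D) (B i D) (U i D)"
    by blast
  note sl = separated_slabD[OF slab]

  \<comment> \<open>The levels of both discs are chosen jointly, so that a slab of one disc also
    avoids all slabs of the other.\<close>
  have finJ: "finite ((UNIV :: bool set) \<times> M)" using fin(2) by simp
  obtain c \<delta> where \<delta>: "0 < \<delta>" "\<delta> < \<epsilon>" and c: "\<And>j. j \<in> (UNIV :: bool set) \<times> M \<Longrightarrow> \<bar>c j - (\<lambda>(i, D). \<sigma> i (v D)) j\<bar> < \<epsilon>"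
    and csep: "\<And>j k. j \<in> (UNIV :: bool set) \<times> M \<Longrightarrow> k \<in> UNIV \<times> M \<Longrightarrow> j \<noteq> k \<Longrightarrow> \<delta> < \<bar>c j - c k\<bar>"
    using that by (rule separated_levels[OF finJ \<open>\<epsilon> > 0\<close>])
  have cv: "\<bar>c (i, D) - \<sigma> i (v D)\<bar> < \<epsilon>" if "D \<in> M" for i D using c[of "(i, D)"] that by simp
  have cs: "i = j \<and> D = E" if "D \<in> M" "E \<in> M" "h \<in> {c (i, D)..c (i, D) + \<delta>}" "h \<in> {c (j, E)..c (j, E) + \<delta>}" for i j D E h
    using csep[of "(i, D)" "(j, E)"] that by (cases "(i, D) = (j, E)") (auto simp: abs_if split: if_splits)

  \<comment> \<open>The wall of disc \<open>i\<close> is bent only in the slabs that carry caps of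
    the other disc; it crosses the slabs of its own caps straight.\<close>
  define wallP where "wallP = (\<lambda>i W. continuous_on (G \<times> UNIV) W \<and>
    (\<forall>u\<in>G. \<forall>h. (\<forall>D\<in>M. h \<notin> {c (\<not> i, D)<..<c (\<not> i, D) + \<delta>}) \<longrightarrow> W (u, h) = (g i u, h)) \<and>
    (\<forall>D\<in>M. \<forall>u\<in>G. \<forall>t\<in>{0..1}. W (u, c (\<not> i, D) + \<delta> * t) =
       (A (\<not> i) D (u, t), c (\<not> i, D) + \<delta> * T (\<not> i) D (u, t))))"
  have "\<exists>W. wallP i W" for i
  proof -
    have 1: "\<delta> < \<bar>c (\<not> i, D) - c (\<not> i, E)\<bar>" if "D \<in> M" "E \<in> M" "D \<noteq> E" for D E
      using csep[of "(\<not> i, D)" "(\<not> i, E)"] that by simp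
    have 2: "continuous_on (G \<times> {0..1}) (A (\<not> i) D)" "continuous_on (G \<times> {0..1}) (T (\<not> i) D)" if "D \<in> M" for D
      using category_KD(1,3)[OF sl(1)[OF that]] by auto
    have 3: "A (\<not> i) D (u, 0) = g i u \<and> A (\<not> i) D (u, 1) = g i u \<and> T (\<not> i) D (u, 0) = 0 \<and> T (\<not> i) D (u, 1) = 1"
      if "D \<in> M" "u \<in> G" for D u
      using sl(3,4)[OF that(1), of u "\<not> i"] category_KD(5,6)[OF sl(1)[OF that(1), of "\<not> i"]] that(2) by simp
    show ?thesis unfolding wallP_def
      by (rule wall_map[where c = "\<lambda>D. c (\<not> i, D)", OF compact_imp_closed[OF cG] fin(2) \<delta>(1) 1 g(1) 2 3])
  qed
  then have "\<forall>i. \<exists>W. wallP i W" by blast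
  then obtain W where "\<forall>i. wallP i (W i)" unfolding choice_iff by (elim exE)
  then have W: "\<And>i. continuous_on (G \<times> UNIV) (W i)"
    "\<And>i u h. u \<in> G \<Longrightarrow> \<forall>D\<in>M. h \<notin> {c (\<not> i, D)<..<c (\<not> i, D) + \<delta>} \<Longrightarrow> W i (u, h) = (g i u, h)"
    "\<And>i D u t. D \<in> M \<Longrightarrow> u \<in> G \<Longrightarrow> t \<in> {0..1} \<Longrightarrow>
      W i (u, c (\<not> i, D) + \<delta> * t) = (A (\<not> i) D (u, t), c (\<not> i, D) + \<delta> * T (\<not> i) D (u, t))"
    unfolding wallP_def by blast+
  have T01: "T i D (u, t) \<in> {0..1}" "A i D (u, t) \<in> X" if "D \<in> M" "u \<in> G" "t \<in> {0..1}" for i D u t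
    using category_KD(2,4)[OF sl(1)[OF that(1), of i]] that by (auto simp: image_subset_iff)
  have U01: "U i D (u, t) \<in> {0..1}" "B i D (u, t) \<in> X" if "D \<in> M" "u \<in> R D" "t \<in> {0..1}" for i D u t
    using category_KD(2,4)[OF sl(2)[OF that(1), of i]] that by (auto simp: image_subset_iff)
  have sl01: "c (i, D) + \<delta> * t \<in> {c (i, D)..c (i, D) + \<delta>}" if "t \<in> {0..1}" for i D t
    using that \<delta>(1) by (auto simp: mult_left_le)
  have Wcases: "W i (u, h) = (g i u, h) \<and> (\<forall>D\<in>M. h \<notin> {c (\<not> i, D)<..<c (\<not> i, D) + \<delta>}) \<or>
    (\<exists>D\<in>M. \<exists>t\<in>{0..1}. h = c (\<not> i, D) + \<delta> * t \<and>
      W i (u, h) = (A (\<not> i) D (u, t), c (\<not> i, D) + \<delta> * T (\<not> i) D (u, t)))"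
    if u: "u \<in> G" for i u h
  proof (cases "\<exists>D\<in>M. h \<in> {c (\<not> i, D)<..<c (\<not> i, D) + \<delta>}")
    case True
    then obtain D where D: "D \<in> M" "h \<in> {c (\<not> i, D)<..<c (\<not> i, D) + \<delta>}" by blast
    define t where "t = (h - c (\<not> i, D)) / \<delta>"
    have t: "t \<in> {0..1}" "h = c (\<not> i, D) + \<delta> * t" using D(2) \<delta>(1) by (auto simp: t_def divide_simps)
    then show ?thesis using W(3)[OF D(1) u t(1), of i] D(1) by blast
  next
    case False
    then show ?thesis using W(2)[OF u, of h i] by blast
  qed
  have Wfst: "fst (W i (u, h)) \<in> X" "dist (fst (W i (u, h))) (g i u) < \<eta>" "\<bar>snd (W i (u, h)) - h\<bar> \<le> \<delta>"
    if u: "u \<in> G" for i u h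
  proof -
    have "fst (W i (u, h)) \<in> X \<and> dist (fst (W i (u, h))) (g i u) < \<eta> \<and> \<bar>snd (W i (u, h)) - h\<bar> \<le> \<delta>"
      using Wcases[OF u, of i h]
    proof (elim disjE bexE)
      assume "W i (u, h) = (g i u, h) \<and> (\<forall>D\<in>M. h \<notin> {c (\<not> i, D)<..<c (\<not> i, D) + \<delta>})"
      then show ?thesis using g(2)[of i] u \<eta>(1) \<delta>(1) by auto
    next
      fix D t assume D: "D \<in> M" and t: "t \<in> {0..1}" and
        *: "h = c (\<not> i, D) + \<delta> * t \<and> W i (u, h) = (A (\<not> i) D (u, t), c (\<not> i, D) + \<delta> * T (\<not> i) D (u, t))"
      have "\<bar>(c (\<not> i, D) + \<delta> * T (\<not> i) D (u, t)) - h\<bar> \<le> \<delta>"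
        using sl01[OF t, of "\<not> i" D] sl01[OF T01(1)[OF D u t], of "\<not> i" D "\<not> i"] * by (auto simp: abs_le_iff)
      then show ?thesis
        using T01(2)[OF D u t, of "\<not> i"] sl(7)[OF D u t, of "\<not> i"]
        unfolding conjunct2[OF *] by simp
    qed
    then show "fst (W i (u, h)) \<in> X" "dist (fst (W i (u, h))) (g i u) < \<eta>" "\<bar>snd (W i (u, h)) - h\<bar> \<le> \<delta>" by blast+
  qed

  define \<Phi> where "\<Phi> = (\<lambda>i D z. (B i D z, c (i, D) + \<delta> * U i D z))"
  \<comment> \<open>The bottom of a slab of disc \<open>i\<close> lies in no slab of the other disc,
    so the wall is straight there and fits the base of the cap.\<close>
  have Wbase: "W i (u, c (i, D)) = (g i u, c (i, D))" if D: "D \<in> M" and u: "u \<in> G" for i D u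
  proof (rule W(2)[OF u], intro ballI notI)
    fix E assume E: "E \<in> M" "c (i, D) \<in> {c (\<not> i, E)<..<c (\<not> i, E) + \<delta>}"
    then have "i = (\<not> i) \<and> D = E"
      using \<delta>(1) by (intro cs[OF D E(1), of "c (i, D)"]) auto
    then show False by simp
  qed
  define goodP where "goodP = (\<lambda>i \<phi>. continuous_on (\<Union>\<T>) \<phi> \<and> (\<forall>x\<in>\<Union>\<T>.
    (x \<in> G \<and> \<phi> x = W i (x, \<sigma> i x)) \<or>
    (\<exists>D\<in>M. \<exists>u\<in>R D. x \<in> D \<and>
      ((\<exists>h\<in>closed_segment (\<sigma> i u) (c (i, D)). \<phi> x = W i (u, h)) \<or> (\<exists>s\<in>{0..1}. \<phi> x = \<Phi> i D (u, s))))))"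
  have "\<exists>\<phi>. goodP i \<phi>" for i
  proof -
    have 1: "continuous_on (R D \<times> {0..1}) (\<Phi> i D)" if "D \<in> M" for D
      unfolding \<Phi>_def using category_KD(1,3)[OF sl(2)[OF that, of i]] by (intro continuous_intros)
    have 2: "\<Phi> i D (u, 0) = W i (u, c (i, D))" if D: "D \<in> M" and u: "u \<in> R D" for D u
    proof -
      have "u \<in> G" using RG[OF D] u by blast
      then show ?thesis
        using Wbase[OF D] sl(5)[OF D u, of i] \<Gamma>(3)[OF D u, of i] category_KD(5)[OF sl(2)[OF D, of i] u] by (simp add: \<Phi>_def)
    qed
    have 3: "\<Phi> i D (u, 1) = \<Phi> i D (w, 1)" if D: "D \<in> M" and u: "u \<in> R D" and w: "w \<in> R D" for D u w
      using sl(6)[OF D u, of i] \<Gamma>(4)[OF D u, of i] category_KD(6)[OF sl(2)[OF D, of i] u]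
        sl(6)[OF D w, of i] \<Gamma>(4)[OF D w, of i] category_KD(6)[OF sl(2)[OF D, of i] w] by (simp add: \<Phi>_def)
    show ?thesis
      unfolding goodP_def
      by (rule staircase_disc[where \<T> = \<T> and lev = "\<lambda>D. c (i, D)" and \<Phi> = "\<Phi> i", folded G_def M_def R_def,
            OF \<T> continuous_on_subset[OF \<sigma> GS] W(1) 1 2 3])
  qed
  then have "\<forall>i. \<exists>\<phi>. goodP i \<phi>" by blast
  then obtain \<phi> where good: "\<forall>i. goodP i (\<phi> i)" unfolding choice_iff by (elim exE)
  have c\<phi>: "continuous_on (\<Union>\<T>) (\<phi> i)" for i using good unfolding goodP_def by blast
  have kinds: "(x \<in> G \<and> \<phi> i x = W i (x, \<sigma> i x)) \<or>
    (\<exists>D\<in>M. \<exists>u\<in>R D. x \<in> D \<and>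
      ((\<exists>h\<in>closed_segment (\<sigma> i u) (c (i, D)). \<phi> i x = W i (u, h)) \<or> (\<exists>s\<in>{0..1}. \<phi> i x = \<Phi> i D (u, s))))"
    if "x \<in> \<Union>\<T>" for i x
    using good that unfolding goodP_def by blast
  \<comment> \<open>Horizontally, the slab costs \<open>\<eta>\<close>, the passage from graph or
    cap homotopy to \<open>f\<close> costs \<open>\<epsilon>\<close>, and the diameter of the image
    of the triangle costs another \<open>\<epsilon>\<close>. Vertically on a wall, the slab costs
    \<open>\<delta>\<close>, the way from \<open>c (i, D)\<close> by \<open>v D\<close> to
    \<open>\<sigma> i u\<close> costs \<open>2 * \<epsilon>\<close>, and the step from
    \<open>u\<close> to \<open>x\<close> costs \<open>\<epsilon>\<close>. A cap stays vertically
    within \<open>3 * \<epsilon>\<close>.\<close>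
  have near: "fst (\<phi> i x) \<in> X \<and> dist (fst (\<phi> i x)) (f i x) < 3 * \<epsilon> \<and> \<bar>snd (\<phi> i x) - \<sigma> i x\<bar> < 4 * \<epsilon>"
    if x: "x \<in> \<Union>\<T>" for i x
    using kinds[OF x, of i]
  proof (elim disjE bexE conjE)
    assume "x \<in> G" "\<phi> i x = W i (x, \<sigma> i x)"
    then show ?thesis
      using Wfst[OF \<open>x \<in> G\<close>, of i "\<sigma> i x"] gf(1)[OF \<open>x \<in> G\<close>, of i] \<eta> \<delta> \<open>\<epsilon> > 0\<close>
        dist_triangle[of "fst (\<phi> i x)" "f i x" "g i x"] by auto
  next
    fix D u h assume D: "D \<in> M" "u \<in> R D" "x \<in> D" and h: "h \<in> closed_segment (\<sigma> i u) (c (i, D))" "\<phi> i x = W i (u, h)"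
    have u: "u \<in> G" "u \<in> D" using RG[OF D(1)] RD[OF D(1)] D(2) by auto
    have vD: "v D \<in> D" using v[OF D(1)] RD[OF D(1)] by blast
    have "\<bar>h - \<sigma> i u\<bar> \<le> \<bar>c (i, D) - \<sigma> i u\<bar>"
      using h(1) segment_bound(1)[of h "\<sigma> i u" "c (i, D)"] by (simp add: real_norm_def)
    moreover have "\<bar>c (i, D) - \<sigma> i (v D)\<bar> < \<epsilon>" using cv[OF D(1)] .
    moreover have "\<bar>\<sigma> i (v D) - \<sigma> i u\<bar> < \<epsilon>" "\<bar>\<sigma> i u - \<sigma> i x\<bar> < \<epsilon>" "dist (f i u) (f i x) < \<epsilon>"
      using fine[OF MT(1)[OF D(1)]] vD u(2) D(3) by blast+
    moreover have "dist (fst (\<phi> i x)) (f i x) \<le> dist (fst (\<phi> i x)) (g i u) + (dist (g i u) (f i u) + dist (f i u) (f i x))"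
      using dist_triangle[of "fst (\<phi> i x)" "f i x" "g i u"] dist_triangle[of "g i u" "f i x" "f i u"] by simp
    ultimately show ?thesis
      using Wfst[OF u(1), of i h] gf(1)[OF u(1), of i] \<eta>(2) \<delta>(2) h(2) by (auto simp: abs_le_iff abs_less_iff)
  next
    fix D u s assume D: "D \<in> M" "u \<in> R D" "x \<in> D" and s: "s \<in> {0..1}" "\<phi> i x = \<Phi> i D (u, s)"
    have vD: "v D \<in> D" using v[OF D(1)] RD[OF D(1)] by blast
    obtain s' where s': "s' \<in> {0..1}" "dist (B i D (u, s)) (\<Gamma> i D (u, s')) < \<eta>" using sl(8)[OF D(1,2) s(1), of i] by blast
    obtain p where p: "p \<in> D" "dist (\<Gamma> i D (u, s')) (f i p) < \<epsilon>"
      using \<Gamma>(5)[OF D(1), of "(u, s')" i] D(2) s'(1) by blast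
    have "\<bar>\<sigma> i (v D) - \<sigma> i x\<bar> < \<epsilon>" "dist (f i p) (f i x) < \<epsilon>"
      using fine[OF MT(1)[OF D(1)]] vD p(1) D(3) by blast+
    moreover have "\<bar>c (i, D) - \<sigma> i (v D)\<bar> < \<epsilon>" using cv[OF D(1)] .
    moreover have "dist (B i D (u, s)) (f i x) \<le> dist (B i D (u, s)) (\<Gamma> i D (u, s')) + (dist (\<Gamma> i D (u, s')) (f i p) + dist (f i p) (f i x))"
      using dist_triangle[of "B i D (u, s)" "f i x" "\<Gamma> i D (u, s')"] dist_triangle[of "\<Gamma> i D (u, s')" "f i x" "f i p"] by simp
    moreover have "c (i, D) + \<delta> * U i D (u, s) \<in> {c (i, D)..c (i, D) + \<delta>}"
      using sl01[OF U01(1)[OF D(1,2) s(1)]] .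
    ultimately show ?thesis
      using s'(2) p(2) \<eta>(2) \<delta>(2) U01(2)[OF D(1,2) s(1), of i] s(2) by (auto simp: \<Phi>_def abs_less_iff)
  qed
  \<comment> \<open>A meeting places the wall in some slab \<open>(i, E)\<close>. Equal heights then
    force \<open>E = D\<close>, since slabs are disjoint, and the separation within slab
    \<open>(i, D)\<close> excludes the meeting.\<close>
  have wallcap: "W (\<not> i) (w, h) \<noteq> \<Phi> i D (u, s)" if D: "D \<in> M" "u \<in> R D" "s \<in> {0..1}" and w: "w \<in> G" for i D u s w h
  proof
    assume eq: "W (\<not> i) (w, h) = \<Phi> i D (u, s)"
    have ci: "c (i, D) + \<delta> * U i D (u, s) \<in> {c (i, D)..c (i, D) + \<delta>}" using sl01[OF U01(1)[OF D]] .
    obtain E t where E: "E \<in> M" "t \<in> {0..1}"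
      "W (\<not> i) (w, h) = (A i E (w, t), c (i, E) + \<delta> * T i E (w, t))"
    \<comment> \<open>At the two ends of the slab \<open>Wcases\<close> may report a straight wall,
      because it excludes only open slabs; there \<open>t\<close> is 0 or 1 and the description by
      \<open>A\<close> and \<open>T\<close> holds as well.\<close>
    proof (cases "h = c (i, D) \<or> h = c (i, D) + \<delta>")
      case True
      then obtain t where "t \<in> {0..1}" "h = c (i, D) + \<delta> * t" by (metis add.right_neutral atLeastAtMost_iff
            mult.right_neutral mult_zero_right order_refl zero_le_one)
      then show thesis using W(3)[OF D(1) w, of t "\<not> i"] that[of D t] D(1) by simp
    next
      case False
      from Wcases[OF w, of "\<not> i" h] show thesis
      proof (elim disjE bexE)
        assume *: "W (\<not> i) (w, h) = (g (\<not> i) w, h) \<and> (\<forall>D\<in>M. h \<notin> {c (\<not> \<not> i, D)<..<c (\<not> \<not> i, D) + \<delta>})"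
        then have "h = c (i, D) + \<delta> * U i D (u, s)" using eq by (simp add: \<Phi>_def)
        with ci have "h \<in> {c (i, D)..c (i, D) + \<delta>}" by (simp only:)
        then have "h \<in> {c (i, D)<..<c (i, D) + \<delta>}" using False by auto
        then show thesis using * D(1) by auto
      next
        fix E t assume E: "E \<in> M" and t: "t \<in> {0..1}" and *: "h = c (\<not> \<not> i, E) + \<delta> * t \<and>
          W (\<not> i) (w, h) = (A (\<not> \<not> i) E (w, t), c (\<not> \<not> i, E) + \<delta> * T (\<not> \<not> i) E (w, t))"
        show thesis by (rule that[OF E t]) (use conjunct2[OF *] in \<open>simp only: not_not\<close>)
      qed
    qed
    have h: "c (i, E) + \<delta> * T i E (w, t) = c (i, D) + \<delta> * U i D (u, s)" and AB: "A i E (w, t) = B i D (u, s)"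
      using eq E(3) by (auto simp: \<Phi>_def)
    have "E = D"
      using cs[OF E(1) D(1), of "c (i, D) + \<delta> * U i D (u, s)" i i] ci sl01[OF T01(1)[OF E(1) w E(2)], of i E i] h by simp
    then have "T i D (w, t) = U i D (u, s)" using h \<delta>(1) by simp
    then show False using sl(9)[OF D(1) w D(2) E(2) D(3), of i] AB \<open>E = D\<close> by simp
  qed
  have capcap: "\<Phi> False D (u, s) \<noteq> \<Phi> True E (w, t)"
    if "D \<in> M" "u \<in> R D" "s \<in> {0..1}" "E \<in> M" "w \<in> R E" "t \<in> {0..1}" for D u s E w t
    using cs[OF that(1,4), of "c (False, D) + \<delta> * U False D (u, s)" False True]
      sl01[OF U01(1)[OF that(1-3)], of False D False] sl01[OF U01(1)[OF that(4-6)], of True E True]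
    by (auto simp: \<Phi>_def)
  have wallwall: "W False (u, h) \<noteq> W True (w, k)" if "u \<in> G" "w \<in> G" for u h w k
  proof
    assume eq: "W False (u, h) = W True (w, k)"
    have "dist (gF u) (gT w) < 2 * \<eta>"
      using Wfst(2)[OF that(1), of False h] Wfst(2)[OF that(2), of True k] eq
        dist_triangle3[of "gF u" "gT w" "fst (W False (u, h))"] by (simp add: g_def)
    moreover have "\<eta>0 \<le> dist (gF u) (gT w)" using \<eta>0(2) that by blast
    ultimately show False using \<eta>(3) by simp
  qed
  have kind2: "(\<exists>u\<in>G. \<exists>h. \<phi> i x = W i (u, h)) \<or> (\<exists>D\<in>M. \<exists>u\<in>R D. \<exists>s\<in>{0..1}. \<phi> i x = \<Phi> i D (u, s))"
    if "x \<in> \<Union>\<T>" for i x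
    using kinds[OF that, of i] RG by (elim disjE conjE bexE) blast+
  have "\<phi> False x \<noteq> \<phi> True y" if "x \<in> \<Union>\<T>" "y \<in> \<Union>\<T>" for x y
  proof -
    from kind2[OF that(1), of False] kind2[OF that(2), of True] show ?thesis
    proof (elim disjE bexE exE)
      fix u h w k assume "u \<in> G" "w \<in> G" "\<phi> False x = W False (u, h)" "\<phi> True y = W True (w, k)"
      then show ?thesis using wallwall by simp
    next
      fix u h D w s assume "u \<in> G" "\<phi> False x = W False (u, h)" "D \<in> M" "w \<in> R D" "s \<in> {0..1}" "\<phi> True y = \<Phi> True D (w, s)"
      then show ?thesis using wallcap[of D w s u True h] by simp
    next
      fix D u s w k assume "w \<in> G" "\<phi> True y = W True (w, k)" "D \<in> M" "u \<in> R D" "s \<in> {0..1}" "\<phi> False x = \<Phi> False D (u, s)"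
      then show ?thesis using wallcap[of D u s w False k] by simp
    next
      fix D u s E w t assume "D \<in> M" "u \<in> R D" "s \<in> {0..1}" "\<phi> False x = \<Phi> False D (u, s)"
        "E \<in> M" "w \<in> R E" "t \<in> {0..1}" "\<phi> True y = \<Phi> True E (w, t)"
      then show ?thesis using capcap by simp
    qed
  qed
  then have "\<phi> False ` \<Union>\<T> \<inter> \<phi> True ` \<Union>\<T> = {}" by blast
  then show ?thesis using c\<phi> near by (intro exI[of _ \<phi>]) (auto simp: image_subset_iff mem_Times_iff)
qed

section \<open>From discs in the plane to a triangulated rectangle in 3-space\<close>

theorem corollary9p5:
  fixes X :: "'a::metric_space set"
  assumes "metrizable_ANR (top_of_set X)"
    and "fuzzy_ribbons_property X"
  shows "disjoint_disks_property (X \<times> (UNIV :: real set))"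
  unfolding disjoint_disks_property_def
proof (intro allI impI, elim conjE)
  fix f g :: "real^2 \<Rightarrow> 'a \<times> real" and \<epsilon> :: real
  assume fg: "continuous_on (cball 0 1) f" "f ` cball 0 1 \<subseteq> X \<times> UNIV"
    "continuous_on (cball 0 1) g" "g ` cball 0 1 \<subseteq> X \<times> UNIV" and "\<epsilon> > 0"
  \<comment> \<open>Finite 1-complexes are realised in 3-space, so the plane is embedded there to
    make the 1-skeleton of a triangulation admissible.\<close>
  obtain \<iota> :: "real^2 \<Rightarrow> real^3" where \<iota>: "linear \<iota>" "\<And>x. norm (\<iota> x) = norm x"
    using isometry_subset_subspace[of "UNIV :: (real^2) set" "UNIV :: (real^3) set"] by auto
  have "inj \<iota>"
    using \<iota> by (metis linear_injective_0 norm_eq_zero)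
  then obtain \<pi> where \<pi>: "linear \<pi>" "\<pi> \<circ> \<iota> = id"
    using linear_injective_left_inverse[OF \<iota>(1)] by blast
  obtain a :: "real^2" where a: "cball 0 1 \<subseteq> cbox (- a) a"
    using bounded_subset_cbox_symmetric[OF bounded_cball] by blast
  \<comment> \<open>The round disc is not a polytope, so a surrounding rectangle is triangulated
    instead; the maps are extended over it by the closest-point retraction in
    \<open>\<rho>\<close>.\<close>
  define S where "S = \<iota> ` cbox (- a) a"
  have S: "polytope S" "aff_dim S \<le> 2"
  proof -
    show "polytope S" unfolding S_def by (intro polytope_linear_image \<iota>(1) polytope_interval)
    have "aff_dim S \<le> aff_dim (cbox (- a) a)" unfolding S_def by (rule aff_dim_linear_image_le[OF \<iota>(1)])
    also have "\<dots> \<le> 2" using aff_dim_le_DIM[of "cbox (- a) a"] by simp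
    finally show "aff_dim S \<le> 2" .
  qed
  define \<rho> where "\<rho> = (\<lambda>x. closest_point (cball 0 1) (\<pi> x))"
  have "continuous_on S \<rho>"
    unfolding \<rho>_def
    by (rule continuous_on_compose2[OF continuous_on_closest_point[of "cball (0::real^2) 1" UNIV]])
      (auto intro: linear_continuous_on linear_conv_bounded_linear[THEN iffD1, OF \<pi>(1)])
  moreover have \<rho>: "\<rho> x \<in> cball 0 1" for x
    unfolding \<rho>_def by (intro closest_point_in_set) auto
  moreover have \<rho>\<iota>: "\<rho> (\<iota> z) = z" if "z \<in> cball 0 1" for z
    using that \<pi>(2) closest_point_self[of z "cball 0 1"] by (metis \<rho>_def comp_apply id_apply)
  define F where "F = (\<lambda>i x. (if i then g else f) (\<rho> x))"
  have F: "continuous_on S (F i)" "F i ` S \<subseteq> X \<times> UNIV" for i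
    using continuous_on_compose2[OF fg(1) \<open>continuous_on S \<rho>\<close>] continuous_on_compose2[OF fg(3) \<open>continuous_on S \<rho>\<close>]
      \<rho> fg(2,4) by (cases i; force simp: F_def)+
  \<comment> \<open>The two coordinates contribute errors below \<open>3 * e\<close> and
    \<open>4 * e\<close>, whose sum \<open>7 * e\<close> stays below
    \<open>\<epsilon> = 8 * e\<close>.\<close>
  define e where "e = \<epsilon> / 8"
  have e: "e > 0" "7 * e < \<epsilon>" using \<open>\<epsilon> > 0\<close> by (auto simp: e_def)
  have "compact S" using S(1) polytope_imp_compact by blast
  have "\<exists>d>0. \<forall>x\<in>S. \<forall>y\<in>S. dist y x < d \<longrightarrow> dist (F i y) (F i x) < e" for i
    using compact_uniformly_continuous[OF F(1) \<open>compact S\<close>] e(1) unfolding uniformly_continuous_on_def by blast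
  then obtain d where d: "\<And>i. d i > 0" "\<And>i x y. x \<in> S \<Longrightarrow> y \<in> S \<Longrightarrow> dist y x < d i \<Longrightarrow> dist (F i y) (F i x) < e"
    by metis
  \<comment> \<open>One triangulation serves both discs, so its mesh has to suit both maps.\<close>
  define d0 where "d0 = min (d False) (d True)"
  have d0: "d0 > 0" "d0 \<le> d i" for i using d(1) by (cases i; simp add: d0_def)+
  obtain \<T> where \<T>: "simplicial_complex \<T>" "\<And>K. K \<in> \<T> \<Longrightarrow> diameter K < d0" "\<Union>\<T> = \<Union>{S}"
    using fine_simplicial_subdivision_of_cell_complex[of d0 "{S}"] d0(1) S(1) polytope_imp_convex face_of_refl
    by (metis finite.emptyI finite_insert inf.idem singletonD)
  have U: "\<Union>\<T> = S" using \<T>(3) by simp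
  have dim: "aff_dim T \<le> 2" if "T \<in> \<T>" for T
  proof -
    have "T \<subseteq> S" using that U by blast
    then show ?thesis using aff_dim_subset S(2) order_trans by blast
  qed
  have fine: "dist (fst (F i x)) (fst (F i y)) < e \<and> \<bar>snd (F i x) - snd (F i y)\<bar> < e"
    if T: "T \<in> \<T>" "x \<in> T" "y \<in> T" for T x y i
  proof -
    have "bounded T" using simplicial_complex_simplex(2)[OF \<T>(1) T(1)] compact_imp_bounded by blast
    then have "dist x y < d i"
      using diameter_bounded_bound[of T x y] T \<T>(2)[OF T(1)] d0(2)[of i] by simp
    then have "dist (F i x) (F i y) < e" using d(2)[of y x i] T U by blast
    then show ?thesis
      using dist_fst_le[of "F i x" "F i y"] dist_snd_le[of "F i x" "F i y"] by (simp add: dist_real_def)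
  qed
  have cont: "continuous_on (\<Union>\<T>) (\<lambda>x. fst (F i x))" "continuous_on (\<Union>\<T>) (\<lambda>x. snd (F i x))"
    "(\<lambda>x. fst (F i x)) ` \<Union>\<T> \<subseteq> X" for i
    using F[of i] unfolding U by (auto intro!: continuous_intros simp: image_subset_iff mem_Times_iff)
  obtain \<phi> where \<phi>: "\<And>i. continuous_on S (\<phi> i)" "\<And>i. \<phi> i ` S \<subseteq> X \<times> UNIV"
    "\<And>i x. x \<in> S \<Longrightarrow> dist (fst (\<phi> i x)) (fst (F i x)) < 3 * e \<and> \<bar>snd (\<phi> i x) - snd (F i x)\<bar> < 4 * e"
    "\<phi> False ` S \<inter> \<phi> True ` S = {}"
  proof -
    have "\<exists>\<phi>. (\<forall>i. continuous_on (\<Union>\<T>) (\<phi> i) \<and> \<phi> i ` \<Union>\<T> \<subseteq> X \<times> UNIV \<and>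
        (\<forall>x\<in>\<Union>\<T>. dist (fst (\<phi> i x)) (fst (F i x)) < 3 * e \<and> \<bar>snd (\<phi> i x) - snd (F i x)\<bar> < 4 * e)) \<and>
      \<phi> False ` \<Union>\<T> \<inter> \<phi> True ` \<Union>\<T> = {}"
      by (rule fuzzy_ribbons_disjoint_polyhedra[where f = "\<lambda>i x. fst (F i x)" and \<sigma> = "\<lambda>i x. snd (F i x)",
            OF assms \<T>(1) dim cont(1,3,2) e(1) fine])
    then show thesis using that unfolding U by blast
  qed
  have near: "dist (\<phi> i x) (F i x) < \<epsilon>" if "x \<in> S" for i x
  proof -
    have "dist (\<phi> i x) (F i x) \<le> dist (fst (\<phi> i x)) (fst (F i x)) + dist (snd (\<phi> i x)) (snd (F i x))"
      unfolding dist_prod_def by (rule sqrt_sum_squares_le_sum) auto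
    then show ?thesis using \<phi>(3)[OF that, of i] e(2) by (simp add: dist_real_def)
  qed
  have \<iota>S: "\<iota> z \<in> S" if "z \<in> cball 0 1" for z using a that by (auto simp: S_def)
  have c\<iota>: "continuous_on (cball 0 1) \<iota>"
    using \<iota>(1) by (simp add: linear_continuous_on linear_conv_bounded_linear)
  define q where "q = (\<lambda>i z. \<phi> i (\<iota> z))"
  have q: "continuous_on (cball 0 1) (q i)" "q i ` cball 0 1 \<subseteq> X \<times> UNIV" for i
  proof -
    show "continuous_on (cball 0 1) (q i)"
      unfolding q_def by (rule continuous_on_compose2[OF \<phi>(1) c\<iota>]) (use \<iota>S in blast)
    show "q i ` cball 0 1 \<subseteq> X \<times> UNIV" unfolding q_def using \<phi>(2)[of i] \<iota>S by blast
  qed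
  have qF: "dist (q i z) (F i (\<iota> z)) < \<epsilon>" "F False (\<iota> z) = f z" "F True (\<iota> z) = g z" if "z \<in> cball 0 1" for i z
    using near[OF \<iota>S[OF that]] \<rho>\<iota>[OF that] by (auto simp: q_def F_def)
  have near_fg: "dist (q False z) (f z) < \<epsilon>" "dist (q True z) (g z) < \<epsilon>" if "z \<in> cball 0 1" for z
    using qF(1)[OF that, of False] qF(1)[OF that, of True] qF(2,3)[OF that] by simp_all
  have "q False ` cball 0 1 \<inter> q True ` cball 0 1 = {}"
    unfolding q_def using \<phi>(4) \<iota>S by blast
  then show "\<exists>f' g'. continuous_on (cball 0 1) f' \<and> f' ` cball 0 1 \<subseteq> X \<times> UNIV \<and>
      continuous_on (cball 0 1) g' \<and> g' ` cball 0 1 \<subseteq> X \<times> UNIV \<and>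
      (\<forall>z\<in>cball 0 1. dist (f' z) (f z) < \<epsilon>) \<and> (\<forall>z\<in>cball 0 1. dist (g' z) (g z) < \<epsilon>) \<and>
      f' ` cball 0 1 \<inter> g' ` cball 0 1 = {}"
    by - (rule exI[of _ "q False"], rule exI[of _ "q True"], use q near_fg in blast)
qed

end
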